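(* There exists a probabilistic polynomial-time reduction from the problem of deciding, for a given $N\in\mathbb{N}$, whether $N=X^2+Y^2$ has a solution in integers $X,Y$, to $CRS(2)$. That is, there is a randomized algorithm which, given $N\in\mathbb{N}$ and oracle access to a procedure solving $CRS(2)$, correctly decides whether $N$ is a sum of two integer squares (with error probability that can be made arbitrarily small) in time polynomial in $\log N$. Moreover, if the Extended Riemann Hypothesis holds, there exists such a reduction that is deterministic.
   Context: For $k\in\mathbb{N}_0$, a prime $p$ and $a\in\mathbb{Z}$ with $p\nmid a$, the rational $2^k$-th power residue symbol is $\left(\frac{a}{p}\right)_{2^k}=1$ if there is $x\in\mathbb{Z}$ with $x^{2^k}\equiv a \pmod p$, and $-1$ otherwise. For $n=p_1\cdots p_l$ a product of not necessarily distinct primes with $\gcd(n,a)=1$, set $\left(\frac{a}{n}\right)_{2^k}=\prod_{i=1}^l\left(\frac{a}{p_i}\right)_{2^k}$. For fixed $k\in\mathbb{N}$, the problem $CRS(k)$ is: given coprime $n,m\in\mathbb{N}$ such that $\left(\frac{m}{p}\right)_{2^{k-1}}=1$ for every prime factor $p$ of $n$, compute $\left(\frac{m}{n}\right)_{2^k}$. A (polynomial-time) reduction from a problem to $CRS(k)$ is an algorithm running in polynomial time that solves the problem using calls to an oracle solving $CRS(k)$, each call counted as one step. *)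

theory Defs
  imports
    "HOL-Number_Theory.Cong"
    "HOL-Computational_Algebra.Computational_Algebra"
    "HOL-Library.Log_Nat"
    "HOL-Complex_Analysis.Complex_Analysis"
    "HOL-Probability.Probability"
begin

section \<open>Rational power residue symbols and the problem CRS\<close>

text \<open>The symbols are only meaningful if the two arguments are coprime; no other values are used.\<close>

definition prime_residue_symbol :: "nat \<Rightarrow> int \<Rightarrow> nat \<Rightarrow> int" where
  "prime_residue_symbol k a p = (if \<exists>x::int. [x ^ (2 ^ k) = a] (mod int p) then 1 else -1)"

definition residue_symbol :: "nat \<Rightarrow> int \<Rightarrow> nat \<Rightarrow> int" where
  "residue_symbol k a n = (\<Prod>p\<in>#prime_factorization n. prime_residue_symbol k a p)"

definition CRS_instance :: "nat \<Rightarrow> nat \<Rightarrow> nat \<Rightarrow> bool" where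
  "CRS_instance k n m \<longleftrightarrow> n > 0 \<and> m > 0 \<and> coprime n m \<and>
     (\<forall>p. prime p \<and> p dvd n \<longrightarrow> prime_residue_symbol (k - 1) (int m) p = 1)"

type_synonym oracle_fun = "nat \<Rightarrow> nat \<Rightarrow> int"

text \<open>The answers of oracles on pairs that are not instances of the problem are arbitrary.\<close>

definition solves_CRS :: "nat \<Rightarrow> oracle_fun \<Rightarrow> bool" where
  "solves_CRS k orc \<longleftrightarrow> (\<forall>n m. CRS_instance k n m \<longrightarrow> orc n m = residue_symbol k (int m) n)"

definition sum_of_two_squares :: "nat \<Rightarrow> bool" where
  "sum_of_two_squares N \<longleftrightarrow> (\<exists>X Y::int. int N = X\<^sup>2 + Y\<^sup>2)"


section \<open>Randomised algorithms with oracles and their running time\<close>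

text \<open>
  Algorithms are while programs over finitely many integer registers, with the arithmetic
  instructions of the random access machine of Aho, Hopcroft and Ullman and its logarithmic
  cost criterion: an operation is charged the bit lengths of its operands, so that polynomial
  time is the same as on Turing machines. Tosses of a fair coin and queries of the given
  solver are added; a query counts as one step. \<open>Quo\<close> and \<open>Rem\<close> are
  floored division and its remainder, with the usual convention for the divisor 0.
\<close>

datatype arith = Add | Sub | Mul | Quo | Rem

datatype aexp = Num int | Reg nat | Op arith aexp aexp

datatype cmd =
    Skip
  | Assign nat aexp
  | Toss nat
  | Query nat nat nat
  | Seq cmd cmd
  | Cond aexp cmd cmd
  | While aexp cmd

type_synonym store = "nat \<Rightarrow> int"

fun arith_val :: "arith \<Rightarrow> int \<Rightarrow> int \<Rightarrow> int" where
  "arith_val Add x y = x + y"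
| "arith_val Sub x y = x - y"
| "arith_val Mul x y = x * y"
| "arith_val Quo x y = x div y"
| "arith_val Rem x y = x mod y"

fun aval :: "aexp \<Rightarrow> store \<Rightarrow> int" where
  "aval (Num c) s = c"
| "aval (Reg i) s = s i"
| "aval (Op f a b) s = arith_val f (aval a s) (aval b s)"

text \<open>\<^term>\<open>floorlog 2 n\<close> is the number of binary digits of \<^term>\<open>n\<close>; one more is charged for the sign.\<close>

definition int_size :: "int \<Rightarrow> nat" where
  "int_size x = floorlog 2 (nat \<bar>x\<bar>) + 1"

fun acost :: "aexp \<Rightarrow> store \<Rightarrow> nat" where
  "acost (Num c) s = int_size c"
| "acost (Reg i) s = int_size (s i)"
| "acost (Op f a b) s = acost a s + acost b s + int_size (aval a s) + int_size (aval b s)"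

text \<open>
  \<open>exec orc c s bs t s' bs'\<close>: started in store \<open>s\<close> with \<open>bs\<close> the outcomes of the coin tosses
  to come, \<open>c\<close> halts at total cost \<open>t\<close> in store \<open>s'\<close>, and \<open>bs'\<close> are the outcomes not used. There is no
  execution if \<open>bs\<close> is too short. A test \<open>a\<close> in \<open>Cond\<close> and \<open>While\<close> succeeds if the value of \<open>a\<close> is positive.
\<close>

inductive exec ::
  "oracle_fun \<Rightarrow> cmd \<Rightarrow> store \<Rightarrow> bool list \<Rightarrow> nat \<Rightarrow> store \<Rightarrow> bool list \<Rightarrow> bool"
  for orc :: oracle_fun where
  Skip: "exec orc Skip s bs 1 s bs"
| Assign: "exec orc (Assign i a) s bs (acost a s + 1) (s(i := aval a s)) bs"
| Toss: "exec orc (Toss i) s (b # bs) 1 (s(i := of_bool b)) bs"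
| Query: "exec orc (Query i j l) s bs 1 (s(i := orc (nat (s j)) (nat (s l)))) bs"
| Seq: "exec orc c s bs t s' bs' \<Longrightarrow> exec orc d s' bs' u s'' bs''
    \<Longrightarrow> exec orc (Seq c d) s bs (t + u) s'' bs''"
| CondTrue: "aval a s > 0 \<Longrightarrow> exec orc c s bs t s' bs'
    \<Longrightarrow> exec orc (Cond a c d) s bs (acost a s + 1 + t) s' bs'"
| CondFalse: "\<not> aval a s > 0 \<Longrightarrow> exec orc d s bs t s' bs'
    \<Longrightarrow> exec orc (Cond a c d) s bs (acost a s + 1 + t) s' bs'"
| WhileTrue: "aval a s > 0 \<Longrightarrow> exec orc c s bs t s' bs' \<Longrightarrow> exec orc (While a c) s' bs' u s'' bs''
    \<Longrightarrow> exec orc (While a c) s bs (acost a s + 1 + t + u) s'' bs''"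
| WhileFalse: "\<not> aval a s > 0 \<Longrightarrow> exec orc (While a c) s bs (acost a s + 1) s bs"

inductive_cases SkipE: "exec orc Skip s bs t s' bs'"
inductive_cases AssignE: "exec orc (Assign i a) s bs t s' bs'"
inductive_cases TossE: "exec orc (Toss i) s bs t s' bs'"
inductive_cases QueryE: "exec orc (Query i j l) s bs t s' bs'"
inductive_cases SeqE: "exec orc (Seq c d) s bs t s' bs'"
inductive_cases CondE: "exec orc (Cond a c d) s bs t s' bs'"
inductive_cases WhileE: "exec orc (While a c) s bs t s' bs'"

lemma exec_deterministic:
  "exec orc c s bs t s1 bs1 \<Longrightarrow> exec orc c s bs u s2 bs2 \<Longrightarrow> u = t \<and> s2 = s1 \<and> bs2 = bs1"
proof (induction arbitrary: u s2 bs2 rule: exec.induct)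
  case (Seq c s bs t s' bs' d u' s'' bs'')
  from Seq.prems show ?case by (rule SeqE) (auto dest!: Seq.IH)
next
  case (CondTrue a s c bs t s' bs' d)
  from CondTrue.prems show ?case by (rule CondE) (use CondTrue.hyps(1) in \<open>auto dest: CondTrue.IH\<close>)
next
  case (CondFalse a s d bs t s' bs' c)
  from CondFalse.prems show ?case by (rule CondE) (use CondFalse.hyps(1) in \<open>auto dest: CondFalse.IH\<close>)
next
  case (WhileTrue a s c bs t s' bs' u' s'' bs'')
  from WhileTrue.prems show ?case by (rule WhileE) (use WhileTrue.hyps(1) in \<open>auto dest: WhileTrue.IH\<close>)
next
  case (WhileFalse a s c bs)
  from WhileFalse.prems show ?case by (rule WhileE) (use WhileFalse.hyps in simp_all)
qed (auto elim: SkipE AssignE TossE QueryE)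

fun toss_free :: "cmd \<Rightarrow> bool" where
  "toss_free (Toss i) = False"
| "toss_free (Seq c d) = (toss_free c \<and> toss_free d)"
| "toss_free (Cond a c d) = (toss_free c \<and> toss_free d)"
| "toss_free (While a c) = toss_free c"
| "toss_free _ = True"

definition input :: "nat list \<Rightarrow> store" where
  "input xs = (\<lambda>i. if i < length xs then int (xs ! i) else 0)"


section \<open>Polynomial-time reductions\<close>

text \<open>
  A decision problem on the positive integers is reduced to the problem whose oracles
  are described by \<open>solves\<close>. The answer 1 (yes) or 0 (no) is left in register 0.
\<close>

definition deterministic_poly_reduction ::
    "(nat \<Rightarrow> bool) \<Rightarrow> (oracle_fun \<Rightarrow> bool) \<Rightarrow> cmd \<Rightarrow> bool" where
  "deterministic_poly_reduction A solves c \<longleftrightarrow> toss_free c \<and>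
     (\<exists>p :: nat poly. \<forall>orc. solves orc \<longrightarrow> (\<forall>N>0.
        \<exists>t s'. exec orc c (input [N]) [] t s' [] \<and> t \<le> poly p (floorlog 2 N) \<and>
               s' 0 = of_bool (A N)))"

text \<open>
  The second input \<open>k\<close> of a probabilistic reduction controls the error probability,
  which is at most \<open>1 / 2 ^ k\<close> for every \<open>N\<close>; for each fixed \<open>k\<close> the running time is
  polynomial in the length of \<open>N\<close> for all outcomes of the coin tosses. A run of cost at most
  \<open>T\<close> tosses at most \<open>T\<close> coins, so \<open>T\<close> independent fair bits are provided.
\<close>

definition probabilistic_poly_reduction ::
    "(nat \<Rightarrow> bool) \<Rightarrow> (oracle_fun \<Rightarrow> bool) \<Rightarrow> cmd \<Rightarrow> bool" where
  "probabilistic_poly_reduction A solves c \<longleftrightarrow>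
     (\<forall>k::nat. \<exists>p :: nat poly. \<forall>orc. solves orc \<longrightarrow> (\<forall>N>0.
        let T = poly p (floorlog 2 N); coins = {bs :: bool list. length bs = T} in
          (\<forall>bs\<in>coins. \<exists>t s' bs'. exec orc c (input [N, k]) bs t s' bs' \<and> t \<le> T) \<and>
          measure_pmf.prob (pmf_of_set coins)
            {bs. \<exists>t s' bs'. exec orc c (input [N, k]) bs t s' bs' \<and> s' 0 = of_bool (A N)}
          \<ge> 1 - 1 / 2 ^ k))"


section \<open>The Extended Riemann Hypothesis\<close>

definition dirichlet_character :: "nat \<Rightarrow> (nat \<Rightarrow> complex) \<Rightarrow> bool" where
  "dirichlet_character q \<psi> \<longleftrightarrow> q > 0 \<and> \<psi> 1 = 1 \<and>
     (\<forall>a b. \<psi> (a * b) = \<psi> a * \<psi> b) \<and> (\<forall>a. \<psi> (a + q) = \<psi> a) \<and>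
     (\<forall>a. \<psi> a \<noteq> 0 \<longleftrightarrow> coprime a q)"

text \<open>
  \<open>L\<close> is the analytic continuation of the Dirichlet series of \<open>\<psi>\<close> to the right half plane, with
  the possible pole at 1 left out. As this domain is connected, \<open>L\<close> is unique there.
\<close>

definition dirichlet_L_function :: "(nat \<Rightarrow> complex) \<Rightarrow> (complex \<Rightarrow> complex) \<Rightarrow> bool" where
  "dirichlet_L_function \<psi> L \<longleftrightarrow> L holomorphic_on ({s. Re s > 0} - {1}) \<and>
     (\<forall>s. Re s > 1 \<longrightarrow> (\<lambda>n. \<psi> (Suc n) / of_nat (Suc n) powr s) sums L s)"

text \<open>
  Principal characters are included, so the Riemann Hypothesis is a special case. For
  imprimitive characters the zeros of the missing Euler factors lie on the imaginary axis,
  outside the open critical strip.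
\<close>

definition extended_riemann_hypothesis :: bool where
  "extended_riemann_hypothesis \<longleftrightarrow>
     (\<forall>q \<psi> L s. dirichlet_character q \<psi> \<and> dirichlet_L_function \<psi> L \<and>
        0 < Re s \<and> Re s < 1 \<and> L s = 0 \<longrightarrow> Re s = 1 / 2)"

end

theory Submission
  imports Defs "HOL-Number_Theory.Number_Theory"
begin

text \<open>
  Since \<open>m\<^sup>2\<close> is a fourth power modulo a prime \<open>p \<equiv> 3 (mod 4)\<close>, the query \<open>(n, m\<^sup>2)\<close> returns the
  product of the Legendre symbols \<open>(m/p)\<close> over the primes \<open>p \<equiv> 1 (mod 4)\<close> of \<open>n\<close>, with multiplicity.
  If \<open>w = (2u+1)\<^sup>2 + (2v)\<^sup>2\<close> is coprime to an odd \<open>N\<close>, then by reciprocity the query \<open>(w, N\<^sup>2)\<close>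
  returns the full Jacobi symbol of \<open>w\<close> modulo \<open>N\<close>. So the answers to \<open>(N, w\<^sup>2)\<close> and \<open>(w, N\<^sup>2)\<close> differ
  iff the part of this symbol that comes from the primes \<open>p \<equiv> 3 (mod 4)\<close> of \<open>N\<close> is \<open>-1\<close>. That part is a
  character modulo \<open>N\<close>, trivial iff all these primes have even exponent, that is, iff \<open>N\<close> is a
  sum of two squares.

  Once the small prime factors of \<open>N\<close> are removed by trial division, a random pair \<open>(u, v)\<close> is
  a witness for a nontrivial character with a probability bounded below. Under ERH, Borel-Caratheodory and
  Cauchy's estimate control the Taylor coefficients of \<open>L'/L\<close> at 3; if the character were 1 at all
  small primes \<open>p \<equiv> 1 (mod 4)\<close>, these coefficients would have the size that the pole of \<open>\<zeta>\<close> forces.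
  Hence some prime \<open>w \<equiv> 1 (mod 4)\<close> below a fixed power of \<open>log N\<close> is a witness.
\<close>

subsection \<open>Dirichlet series\<close>

text \<open>The hypothesis speaks of the open critical strip only, so non-vanishing on the line Re s
  = 1 is proved by the classical arguments. Zeros are never counted; everything is read off at the
  single point 3, whose distance to the pole at 1 is 2 and to the line Re s = 1/2 is 5/2. In the
  \<open>k\<close>-th Taylor coefficient the pole contributes \<open>1 / 2 ^ Suc k\<close>, and the
  analytic rest, bounded on the radius 9/4 in between, only a multiple of \<open>(11/24) ^ k\<close>
  times the logarithm of the modulus. With \<open>k\<close> of order \<open>ln (ln Q)\<close> the
  pole wins, and for such \<open>k\<close> the weights
  \<open>ln n ^ k / fact k * n powr (-3)\<close> see only \<open>n\<close> up to a power of
  \<open>ln Q\<close>. The nonnegative weight \<open>(1 + \<epsilon> n) * (1 - \<eta> n)\<close>,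
  with \<epsilon> the character modulo 4 and \<eta> the one to be detected, picks out the wanted
  primes. On the machine side, a query outside the promise may return an arbitrarily large integer,
  which would ruin every bound on register sizes; hence the gcd before the queries.\<close>

definition abs_convergent :: "(nat \<Rightarrow> complex) \<Rightarrow> bool" where
  "abs_convergent a \<longleftrightarrow> (\<forall>\<sigma>>1. summable (\<lambda>n. norm (a n) * real n powr (-\<sigma>)))"

text \<open>The sum may start at 0 because \<open>0 powr z = 0\<close>; so functions with any value
  at 0, such as the constant 1, fit without a shift of the index.\<close>

definition dirichlet_series :: "(nat \<Rightarrow> complex) \<Rightarrow> complex \<Rightarrow> complex" where
  "dirichlet_series a s = (\<Sum>n. a n * of_nat n powr (-s))"

lemma norm_of_nat_powr: "norm (of_nat n powr s :: complex) = real n powr Re s"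
  by (subst norm_powr_real_powr) auto

lemma summable_dirichlet_series:
  assumes "abs_convergent a" "Re s > 1"
  shows "summable (\<lambda>n. norm (a n * of_nat n powr (-s)))"
  using assms by (auto simp: abs_convergent_def norm_mult norm_of_nat_powr)

lemma dirichlet_series_sums:
  assumes "abs_convergent a" "Re s > 1"
  shows "(\<lambda>n. a n * of_nat n powr (-s)) sums dirichlet_series a s"
  unfolding dirichlet_series_def
  by (intro summable_sums summable_norm_cancel[OF summable_dirichlet_series] assms)

lemma dirichlet_series_has_sum:
  assumes "abs_convergent a" "Re s > 1"
  shows "((\<lambda>n. a n * of_nat n powr (-s)) has_sum dirichlet_series a s) UNIV"
  by (intro norm_summable_imp_has_sum summable_dirichlet_series dirichlet_series_sums assms)

lemma deriv_of_nat_powr: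
  fixes c s :: complex
  shows "((\<lambda>s. c * of_nat n powr (-s)) has_field_derivative c * (-of_real (ln (real n))) * of_nat n powr (-s)) (at s)"
proof (cases "n = 0")
  case False
  have "(\<lambda>s. c * of_nat n powr (-s)) = (\<lambda>s. c * exp (-s * of_real (ln (real n))))"
    using False by (simp add: powr_def)
  moreover have "((\<lambda>s. c * exp (-s * of_real (ln (real n)))) has_field_derivative
      c * (-of_real (ln (real n))) * exp (-s * of_real (ln (real n)))) (at s)"
    by (auto intro!: derivative_eq_intros)
  ultimately show ?thesis using False by (simp add: powr_def)
qed simp

lemma higher_deriv_dirichlet_polynomial:
  fixes a :: "nat \<Rightarrow> complex"
  shows "(deriv ^^ k) (\<lambda>s. \<Sum>i<n. a i * of_nat i powr (-s)) =
     (\<lambda>s. \<Sum>i<n. a i * (-of_real (ln (real i))) ^ k * of_nat i powr (-s))"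
proof (induction k)
  case (Suc k)
  have "deriv (\<lambda>s. \<Sum>i<n. a i * (-of_real (ln (real i))) ^ k * of_nat i powr (-s)) s =
      (\<Sum>i<n. a i * (-of_real (ln (real i))) ^ k * (-of_real (ln (real i))) * of_nat i powr (-s))" for s
    by (intro DERIV_imp_deriv DERIV_sum deriv_of_nat_powr)
  thus ?case by (simp add: Suc.IH fun_eq_iff mult_ac)
qed auto

lemma open_halfplane: "open {s. Re s > c}"
  by (simp add: open_halfspace_Re_gt)

lemma uniform_limit_dirichlet_series:
  assumes "abs_convergent a" "\<sigma> > 1"
  shows "uniform_limit {s. Re s > \<sigma>} (\<lambda>n s. \<Sum>i<n. a i * of_nat i powr (-s)) (dirichlet_series a) sequentially"
proof -
  have "uniform_limit {s. Re s > \<sigma>} (\<lambda>n s. \<Sum>i<n. a i * of_nat i powr (-s))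
          (\<lambda>s. \<Sum>i. a i * of_nat i powr (-s)) sequentially"
  proof (rule Weierstrass_m_test)
    show "summable (\<lambda>n. norm (a n) * real n powr (-\<sigma>))"
      using assms by (auto simp: abs_convergent_def)
    fix n s assume "s \<in> {s. Re s > \<sigma>}"
    hence "real n powr (-Re s) \<le> real n powr (-\<sigma>)"
      by (cases "n = 0") (auto intro!: powr_mono)
    thus "norm (a n * of_nat n powr (-s)) \<le> norm (a n) * real n powr (-\<sigma>)"
      by (auto simp: norm_mult norm_of_nat_powr intro!: mult_left_mono)
  qed
  thus ?thesis by (simp add: dirichlet_series_def[abs_def])
qed

lemma holomorphic_dirichlet_polynomial:
  "(\<lambda>s. \<Sum>i<n. a i * of_nat i powr (-s)) holomorphic_on A"
  by (intro holomorphic_on_sum)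
     (auto simp: holomorphic_on_def field_differentiable_def intro: has_field_derivative_at_within deriv_of_nat_powr)

lemma dirichlet_series_holomorphic:
  assumes "abs_convergent a"
  shows "dirichlet_series a holomorphic_on {s. Re s > 1}"
proof (rule holomorphic_uniform_sequence[OF open_halfplane holomorphic_dirichlet_polynomial])
  fix s :: complex assume s: "s \<in> {s. Re s > 1}"
  define r where "r = (Re s - 1) / 4"
  have r: "r > 0" "\<And>z. z \<in> cball s r \<Longrightarrow> z \<in> {z. Re z > 1 + r}"
  proof -
    fix z assume "z \<in> cball s r"
    hence "\<bar>Re (s - z)\<bar> \<le> r" using abs_Re_le_cmod[of "s - z"] by (auto simp: dist_norm)
    hence "Re s - r \<le> Re z" by (auto simp: abs_le_iff)
    thus "z \<in> {z. Re z > 1 + r}" using s by (auto simp: r_def field_simps)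
  qed (use s in \<open>auto simp: r_def\<close>)
  thus "\<exists>d>0. cball s d \<subseteq> {s. 1 < Re s} \<and> uniform_limit (cball s d)
           (\<lambda>n s. \<Sum>i<n. a i * of_nat i powr (-s)) (dirichlet_series a) sequentially"
    using uniform_limit_on_subset[OF uniform_limit_dirichlet_series[OF assms, of "1+r"], of "cball s r"]
    by (intro exI[of _ r]) (auto dest!: r(2))
qed

text \<open>Locally uniform limits of holomorphic functions commute with all derivatives, so the
  formula for finite sums passes to the limit.\<close>

lemma higher_deriv_dirichlet_series:
  assumes "abs_convergent a" "Re s > 1"
  shows "(\<lambda>n. a n * (-of_real (ln (real n))) ^ k * of_nat n powr (-s)) sums (deriv ^^ k) (dirichlet_series a) s"
proof -
  obtain \<sigma> where \<sigma>: "\<sigma> > 1" "Re s > \<sigma>" using dense assms(2) by blast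
  have "(\<lambda>n. (deriv ^^ k) (\<lambda>s. \<Sum>i<n. a i * of_nat i powr (-s)) s) \<longlonglongrightarrow> (deriv ^^ k) (dirichlet_series a) s"
    by (rule higher_deriv_complex_uniform_limit[OF uniform_limit_dirichlet_series[OF assms(1) \<sigma>(1)]])
       (use \<sigma> in \<open>auto intro!: always_eventually holomorphic_dirichlet_polynomial open_halfplane\<close>)
  thus ?thesis by (simp add: higher_deriv_dirichlet_polynomial sums_def)
qed

text \<open>Unordered sums are used because they can be regrouped freely: pairs
  \<open>(d, e)\<close> become \<open>(d * e, d)\<close> and are then summed over each fibre
  \<open>d * e = n\<close>. Convergence of the series of \<open>c\<close> is part of the conclusion,
  so that the next lemma can apply this one to absolute values.\<close>

lemma dirichlet_convolution_has_sum:
  assumes a: "abs_convergent a" and b: "abs_convergent b" and s: "Re s > 1"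
    and conv: "\<And>n. n > 0 \<Longrightarrow> c n = (\<Sum>d | d dvd n. a d * b (n div d))"
  shows "((\<lambda>n. c n * of_nat n powr (-s)) has_sum dirichlet_series a s * dirichlet_series b s) UNIV"
proof -
  define f where "f = (\<lambda>n. a n * of_nat n powr (-s))"
  define g where "g = (\<lambda>n. b n * of_nat n powr (-s))"
  have fs: "(\<lambda>n. norm (f n)) summable_on UNIV" and gs: "(\<lambda>n. norm (g n)) summable_on UNIV"
    using summable_dirichlet_series[OF a s] summable_dirichlet_series[OF b s]
    by (auto simp: f_def g_def intro!: norm_summable_imp_summable_on)
  have fg: "((\<lambda>(m,n). f m * g n) has_sum dirichlet_series a s * dirichlet_series b s) (UNIV \<times> UNIV)"
  proof -
    have "(\<lambda>x. norm (case x of (m,n) \<Rightarrow> f m * g n)) summable_on (UNIV \<times> UNIV)"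
      by (subst Infinite_Sum.abs_summable_on_Sigma_iff)
         (use fs gs in \<open>auto simp: norm_mult infsum_cmult_right' abs_mult intro!: summable_on_cmult_right summable_on_cmult_left\<close>)
    hence sm: "(\<lambda>(m,n). f m * g n) summable_on (UNIV \<times> UNIV)"
      by (rule Infinite_Sum.abs_summable_summable)
    have "(\<Sum>\<^sub>\<infinity>(m,n)\<in>UNIV\<times>UNIV. f m * g n) = (\<Sum>\<^sub>\<infinity>m. \<Sum>\<^sub>\<infinity>n. f m * g n)"
      using infsum_Sigma_banach[OF sm] by simp
    also have "\<dots> = dirichlet_series a s * dirichlet_series b s"
      using dirichlet_series_has_sum[OF a s] dirichlet_series_has_sum[OF b s]
      by (simp add: infsum_cmult_right' infsum_cmult_left' infsumI f_def g_def)
    finally show ?thesis using sm by (simp add: has_sum_infsum summable_iff_has_sum_infsum)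
  qed
  \<comment> \<open>Pairs with an entry 0 vanish and are dropped: 0 has infinitely many divisors, so
    its fibre would not be finite.\<close>
  have z: "f 0 = 0" "g 0 = 0" by (auto simp: f_def g_def)
  have "((\<lambda>(m,n). f m * g n) has_sum dirichlet_series a s * dirichlet_series b s) ({0<..} \<times> {0<..})"
    by (rule iffD1[OF has_sum_cong_neutral fg]) (auto simp: z intro!: Nat.gr0I)
  also have "?this \<longleftrightarrow> ((\<lambda>(n,d). f d * g (n div d)) has_sum dirichlet_series a s * dirichlet_series b s)
      (SIGMA n:{0<..}. {d. d dvd n})"
    by (rule has_sum_reindex_bij_witness[of _ "\<lambda>(n,d). (d, n div d)" "\<lambda>(d,e). (d * e, d)"])
       (auto simp: dvd_div_eq_0_iff intro!: Nat.gr0I)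
  finally have *: "((\<lambda>(n,d). f d * g (n div d)) has_sum dirichlet_series a s * dirichlet_series b s)
      (SIGMA n:{0<..}. {d. d dvd n})" .
  have "((\<lambda>n. c n * of_nat n powr (-s)) has_sum dirichlet_series a s * dirichlet_series b s) {0<..}"
  proof (rule has_sum_SigmaD[OF *])
    fix n :: nat assume n: "n \<in> {0<..}"
    have "(\<Sum>d | d dvd n. f d * g (n div d)) = c n * of_nat n powr (-s)"
    proof -
      have "f d * g (n div d) = a d * b (n div d) * of_nat n powr (-s)" if "d dvd n" for d
      proof -
        from that obtain e where e: "n = d * e" by auto
        with n have "d > 0" "e > 0" by auto
        have "(of_nat n :: complex) powr (-s) = of_nat d powr (-s) * of_nat e powr (-s)"
          unfolding e of_nat_mult by (rule powr_times_real) auto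
        thus ?thesis using e \<open>d > 0\<close> by (simp add: f_def g_def)
      qed
      thus ?thesis using n by (simp add: conv sum_distrib_right)
    qed
    thus "((\<lambda>d. case (n,d) of (n,d) \<Rightarrow> f d * g (n div d)) has_sum c n * of_nat n powr (-s)) {d. d dvd n}"
      using n by (auto intro!: has_sum_finiteI)
  qed
  thus ?thesis
    by (rule iffD1[OF has_sum_cong_neutral, rotated -1]) auto
qed

text \<open>The convolution of the absolute values majorises \<open>c\<close>. It converges by the
  preceding lemma, and for complex series unordered summability is already absolute.\<close>

lemma abs_convergent_convolution:
  assumes a: "abs_convergent a" and b: "abs_convergent b"
    and conv: "\<And>n. n > 0 \<Longrightarrow> c n = (\<Sum>d | d dvd n. a d * b (n div d))"
  shows "abs_convergent c"
  unfolding abs_convergent_def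
proof (intro allI impI)
  fix \<sigma> :: real assume "\<sigma> > 1"
  define a' b' :: "nat \<Rightarrow> complex" where "a' = (\<lambda>n. of_real (norm (a n)))" and "b' = (\<lambda>n. of_real (norm (b n)))"
  define c' where "c' = (\<lambda>n. \<Sum>d | d dvd n. a' d * b' (n div d))"
  have "abs_convergent a'" "abs_convergent b'"
    using a b by (auto simp: abs_convergent_def a'_def b'_def)
  hence "(\<lambda>n. c' n * of_nat n powr (-of_real \<sigma>)) summable_on UNIV"
    using dirichlet_convolution_has_sum[of a' b' "of_real \<sigma>" c'] \<open>\<sigma> > 1\<close>
    by (auto simp: c'_def summable_on_def)
  hence "(\<lambda>n. norm (c' n * of_nat n powr (-of_real \<sigma>))) summable_on UNIV"
    by (simp add: summable_on_iff_abs_summable_on_complex)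
  hence "summable (\<lambda>n. norm (c' n * of_nat n powr (-of_real \<sigma>)))"
    by (rule summable_on_imp_summable)
  thus "summable (\<lambda>n. norm (c n) * real n powr (-\<sigma>))"
  proof (rule summable_comparison_test'[of _ 0])
    fix n :: nat
    show "norm (norm (c n) * real n powr (-\<sigma>)) \<le> norm (c' n * of_nat n powr (-of_real \<sigma>))"
    proof (cases "n = 0")
      case False
      have "norm (c n) \<le> (\<Sum>d | d dvd n. norm (a d) * norm (b (n div d)))"
        using False by (simp add: conv sum_norm_le norm_mult)
      also have "\<dots> = norm (c' n)"
      proof -
        have "c' n = of_real (\<Sum>d | d dvd n. norm (a d) * norm (b (n div d)))"
          by (simp add: c'_def a'_def b'_def)
        thus ?thesis by (simp only: norm_of_real) (simp add: sum_nonneg)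
      qed
      finally show ?thesis by (simp add: norm_mult norm_of_nat_powr mult_right_mono)
    qed auto
  qed
qed

lemma dirichlet_series_mult:
  assumes "abs_convergent a" "abs_convergent b" "Re s > 1"
    and "\<And>n. n > 0 \<Longrightarrow> c n = (\<Sum>d | d dvd n. a d * b (n div d))"
  shows "dirichlet_series c s = dirichlet_series a s * dirichlet_series b s"
  using dirichlet_series_has_sum[OF abs_convergent_convolution[of a b c] assms(3)]
    dirichlet_convolution_has_sum[of a b s c] assms has_sum_unique by blast

lemma abs_convergent_bounded:
  assumes "\<And>n. norm (a n) \<le> 1"
  shows "abs_convergent a"
  unfolding abs_convergent_def
proof (intro allI impI)
  fix \<sigma> :: real assume "\<sigma> > 1"
  show "summable (\<lambda>n. norm (a n) * real n powr (-\<sigma>))"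
    by (rule summable_comparison_test'[of "\<lambda>n. real n powr (-\<sigma>)" 0])
       (use \<open>\<sigma> > 1\<close> assms in \<open>auto simp: summable_real_powr_iff intro!: mult_left_le_one_le\<close>)
qed

lemma abs_convergent_log:
  assumes "\<And>n. norm (a n) \<le> ln (real n)" "a 0 = 0"
  shows "abs_convergent a"
  unfolding abs_convergent_def
proof (intro allI impI)
  fix \<sigma> :: real assume \<sigma>: "\<sigma> > 1"
  \<comment> \<open>Half of the excess of \<sigma> over 1 pays for the logarithm, the other half for
    convergence.\<close>
  define e where "e = (\<sigma> - 1) / 2"
  have e: "e > 0" "e - \<sigma> < -1" using \<sigma> by (auto simp: e_def field_simps)
  show "summable (\<lambda>n. norm (a n) * real n powr (-\<sigma>))"
  proof (rule summable_comparison_test'[of "\<lambda>n. real n powr (e - \<sigma>) / e" 0])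
    show "summable (\<lambda>n. real n powr (e - \<sigma>) / e)"
      using e by (intro summable_divide) (auto simp: summable_real_powr_iff)
    fix n :: nat
    show "norm (norm (a n) * real n powr (-\<sigma>)) \<le> real n powr (e - \<sigma>) / e"
    proof (cases "n = 0")
      case False
      have "norm (a n) \<le> real n powr e / e"
        using assms(1)[of n] ln_powr_bound[of "real n" e] e False by simp
      hence "norm (a n) * real n powr (-\<sigma>) \<le> real n powr e / e * real n powr (-\<sigma>)"
        by (intro mult_right_mono) auto
      also have "\<dots> = real n powr (e - \<sigma>) / e" using False by (simp add: powr_diff powr_minus field_simps)
      finally show ?thesis by simp
    qed (use assms(2) in auto)
  qed
qed

lemma mangoldt_le_ln: "(mangoldt n :: real) \<le> ln (real n)"
proof (cases "n = 0")
  case False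
  have "mangoldt n \<le> (\<Sum>d | d dvd n. mangoldt d :: real)"
    using False by (intro member_le_sum) (auto simp: mangoldt_nonneg)
  thus ?thesis using mangoldt_sum[of n, where 'a = real] False by simp
qed simp

text \<open>Mean value inequality along a segment. The gain of one power of \<open>n\<close> is what
  moves convergence from Re s > 1 to Re s > 0.\<close>

lemma of_real_powr_diff_bound:
  assumes "n > 0" "x \<in> {real n..real n + 1}" "Re s > 0"
  shows "norm (of_real x powr (-s) - of_nat n powr (-s)) \<le> norm s * real n powr (-Re s - 1)"
proof -
  define S where "S = closed_segment (of_real (real n)) (of_real (real n + 1) :: complex)"
  have S: "z \<in> S \<longleftrightarrow> (\<exists>y\<in>{real n..real n + 1}. z = of_real y)" for z
    unfolding S_def closed_segment_of_real by (auto simp: closed_segment_eq_real_ivl)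
  have "norm (of_real x powr (-s) - of_nat n powr (-s)) \<le>
      norm s * real n powr (-Re s - 1) * norm (of_real x - of_nat n :: complex)"
  proof (rule field_differentiable_bound[where S = S and f' = "\<lambda>z. -s * z powr (-s - 1)"])
    show "convex S" by (simp add: S_def)
  next
    fix z assume "z \<in> S"
    then obtain y where y: "y \<ge> real n" "z = of_real y" using S by auto
    have y0: "y > 0" using y assms(1) by simp
    hence "z \<notin> \<real>\<^sub>\<le>\<^sub>0" using y by auto
    thus "((\<lambda>z. z powr (-s)) has_field_derivative -s * z powr (-s - 1)) (at z within S)"
      by (auto intro!: derivative_eq_intros)
    have "norm (z powr (-s-1)) = y powr (-Re s - 1)"
      unfolding y by (subst norm_powr_real_powr) (use y0 in auto)
    also have "\<dots> \<le> real n powr (-Re s - 1)"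
      using y assms by (intro powr_mono2') auto
    finally show "norm (-s * z powr (-s-1)) \<le> norm s * real n powr (-Re s - 1)"
      by (simp add: norm_mult mult_left_mono)
  next
    show "of_real x \<in> S" unfolding S by (rule bexI[of _ x]) (use assms in auto)
    show "of_nat n \<in> S" unfolding S by (rule bexI[of _ "real n"]) auto
  qed
  also have "norm (of_real x - of_nat n :: complex) \<le> 1"
  proof -
    have "of_real x - of_nat n = (of_real (x - real n) :: complex)" by simp
    thus ?thesis using assms by (simp only: norm_of_real) auto
  qed
  finally show ?thesis by (simp add: mult_left_mono mult.assoc mult_left_le)
qed

text \<open>The expression is \<open>s - 1\<close> times the difference of
  \<open>n powr (-s)\<close> and the integral of \<open>x powr (-s)\<close> over
  \<open>[n, n + 1]\<close>, multiplied out so that it makes sense at \<open>s = 1\<close>.\<close>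

lemma zeta_term_bound:
  assumes "n > 0" "Re s > 0"
  shows "norm ((s - 1) * of_nat n powr (-s) + of_nat (Suc n) powr (1 - s) - of_nat n powr (1 - s))
           \<le> norm (s - 1) * norm s * real n powr (-Re s - 1)"
proof -
  define S where "S = closed_segment (of_real (real n)) (of_real (real n + 1) :: complex)"
  have S: "z \<in> S \<longleftrightarrow> (\<exists>y\<in>{real n..real n + 1}. z = of_real y)" for z
    unfolding S_def closed_segment_of_real by (auto simp: closed_segment_eq_real_ivl)
  \<comment> \<open>The linear term makes the derivative of \<open>g\<close> a multiple of
    \<open>z powr (-s) - n powr (-s)\<close>, which the previous lemma bounds.\<close>
  define g where "g = (\<lambda>z. z powr (1 - s) - (1 - s) * z * of_nat n powr (-s))"
  have "norm (g (of_nat (Suc n)) - g (of_nat n)) \<le>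
      norm (s - 1) * norm s * real n powr (-Re s - 1) * norm (of_nat (Suc n) - of_nat n :: complex)"
  proof (rule field_differentiable_bound[where S = S and f' = "\<lambda>z. (1 - s) * (z powr (-s) - of_nat n powr (-s))"])
    show "convex S" by (simp add: S_def)
  next
    fix z assume "z \<in> S"
    then obtain y where y: "y \<ge> real n" "y \<le> real n + 1" "z = of_real y" using S by auto
    hence "z \<notin> \<real>\<^sub>\<le>\<^sub>0" using assms(1) by auto
    thus "(g has_field_derivative (1 - s) * (z powr (-s) - of_nat n powr (-s))) (at z within S)"
      unfolding g_def by (auto intro!: derivative_eq_intros simp: algebra_simps)
    show "norm ((1 - s) * (z powr (-s) - of_nat n powr (-s))) \<le> norm (s - 1) * norm s * real n powr (-Re s - 1)"
      using of_real_powr_diff_bound[of n y s] y assms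
      by (auto simp: norm_mult norm_minus_commute mult.assoc intro!: mult_left_mono)
  next
    show "of_nat (Suc n) \<in> S" unfolding S by (rule bexI[of _ "real n + 1"]) auto
    show "of_nat n \<in> S" unfolding S by (rule bexI[of _ "real n"]) auto
  qed
  moreover have "g (of_nat (Suc n)) - g (of_nat n) =
      (s - 1) * of_nat n powr (-s) + of_nat (Suc n) powr (1 - s) - of_nat n powr (1 - s)"
    by (simp add: g_def algebra_simps)
  ultimately show ?thesis by simp
qed

text \<open>The value \<zeta>(3/2), the sum of the majorants below at the edge Re s = 1/2.\<close>

definition three_halves_sum :: real where
  "three_halves_sum = (\<Sum>n. real (Suc n) powr (-3/2))"

lemma summable_Suc_powr: "r > 0 \<Longrightarrow> summable (\<lambda>n. real (Suc n) powr (-r - 1))"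
  using summable_Suc_iff[of "\<lambda>n. real n powr (-r-1)"] by (simp add: summable_real_powr_iff del: of_nat_Suc)

text \<open>Serves both continuations: summation by parts for characters and comparison with an
  integral for zeta each leave terms with this extra decay. The explicit bound on Re s \<ge> 1/2 is
  what Borel-Caratheodory later uses.\<close>

lemma halfplane_series:
  fixes t :: "nat \<Rightarrow> complex \<Rightarrow> complex"
  assumes hol: "\<And>n. t n holomorphic_on {s. Re s > 0}"
    and le: "\<And>n s. Re s > 0 \<Longrightarrow> norm (t n s) \<le> C * (norm s + 1)\<^sup>2 * real (Suc n) powr (-Re s - 1)"
    and C: "C \<ge> 0"
  shows "(\<lambda>s. \<Sum>n. t n s) holomorphic_on {s. Re s > 0}"
    and "Re s > 0 \<Longrightarrow> summable (\<lambda>n. t n s)"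
    and "Re s \<ge> 1/2 \<Longrightarrow> norm (\<Sum>n. t n s) \<le> C * (norm s + 1)\<^sup>2 * three_halves_sum"
proof -
  show "(\<lambda>s. \<Sum>n. t n s) holomorphic_on {s. Re s > 0}"
  proof (rule holomorphic_uniform_sequence[OF open_halfplane, where f = "\<lambda>n s. \<Sum>i<n. t i s"])
    fix s :: complex assume s: "s \<in> {s. Re s > 0}"
    define r where "r = Re s / 2"
    have r: "r > 0" using s by (auto simp: r_def)
    have z: "Re z \<ge> r" "norm z \<le> norm s + r" if "z \<in> cball s r" for z
    proof -
      have "\<bar>Re (s - z)\<bar> \<le> r" using that abs_Re_le_cmod[of "s - z"] by (auto simp: dist_norm)
      hence "Re s - Re z \<le> r" using abs_ge_self[of "Re s - Re z"] by simp
      thus "Re z \<ge> r" by (simp add: r_def field_simps)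
      show "norm z \<le> norm s + r" using that norm_triangle_ineq2[of z s]
        by (auto simp: dist_norm norm_minus_commute)
    qed
    have "uniform_limit (cball s r) (\<lambda>n s. \<Sum>i<n. t i s) (\<lambda>s. \<Sum>n. t n s) sequentially"
    proof (rule Weierstrass_m_test)
      show "summable (\<lambda>n. C * (norm s + r + 1)\<^sup>2 * real (Suc n) powr (-r - 1))"
        by (intro summable_mult summable_Suc_powr r)
      fix n z assume zin: "z \<in> cball s r"
      have "norm (t n z) \<le> C * (norm z + 1)\<^sup>2 * real (Suc n) powr (-Re z - 1)"
        using z[OF zin] r by (intro le) auto
      also have "\<dots> \<le> C * (norm s + r + 1)\<^sup>2 * real (Suc n) powr (-r - 1)"
        using z[OF zin] r C by (intro mult_mono power_mono powr_mono) auto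
      finally show "norm (t n z) \<le> C * (norm s + r + 1)\<^sup>2 * real (Suc n) powr (-r - 1)" .
    qed
    moreover have "cball s r \<subseteq> {s. Re s > 0}" using z r by force
    ultimately show "\<exists>d>0. cball s d \<subseteq> {s. 0 < Re s} \<and> uniform_limit (cball s d)
        (\<lambda>n s. \<Sum>i<n. t i s) (\<lambda>s. \<Sum>n. t n s) sequentially" using r by blast
  qed (auto intro!: holomorphic_on_sum hol)
  have sm: "summable (\<lambda>n. norm (t n s))" if "Re s > 0" for s
    by (rule summable_comparison_test'[OF summable_mult[OF summable_Suc_powr[OF that]], of 0 _ "C * (norm s + 1)\<^sup>2"])
       (use le[OF that] in auto)
  thus "Re s > 0 \<Longrightarrow> summable (\<lambda>n. t n s)" by (rule summable_norm_cancel)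
  show "norm (\<Sum>n. t n s) \<le> C * (norm s + 1)\<^sup>2 * three_halves_sum" if "Re s \<ge> 1/2"
  proof -
    have "norm (\<Sum>n. t n s) \<le> (\<Sum>n. norm (t n s))"
      using that by (intro summable_norm sm) auto
    also have "\<dots> \<le> (\<Sum>n. C * (norm s + 1)\<^sup>2 * real (Suc n) powr (-3/2))"
    proof (rule suminf_le)
      fix n
      have "norm (t n s) \<le> C * (norm s + 1)\<^sup>2 * real (Suc n) powr (-Re s - 1)" using that by (intro le) auto
      also have "\<dots> \<le> C * (norm s + 1)\<^sup>2 * real (Suc n) powr (-3/2)"
        using that C by (intro mult_left_mono powr_mono) auto
      finally show "norm (t n s) \<le> C * (norm s + 1)\<^sup>2 * real (Suc n) powr (-3/2)" .
    qed (use that summable_Suc_powr[of "1/2"] in \<open>auto intro!: sm summable_mult\<close>)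
    also have "\<dots> = C * (norm s + 1)\<^sup>2 * three_halves_sum"
      unfolding three_halves_sum_def using summable_Suc_powr[of "1/2"] by (intro suminf_mult) auto
    finally show ?thesis .
  qed
qed

subsection \<open>Real characters and their L-functions\<close>

definition real_character :: "nat \<Rightarrow> (nat \<Rightarrow> complex) \<Rightarrow> bool" where
  "real_character q \<psi> \<longleftrightarrow> dirichlet_character q \<psi> \<and> (\<forall>n. \<psi> n \<in> {-1, 0, 1})"

definition nonprincipal :: "nat \<Rightarrow> (nat \<Rightarrow> complex) \<Rightarrow> bool" where
  "nonprincipal q \<psi> \<longleftrightarrow> (\<exists>b. coprime b q \<and> \<psi> b \<noteq> 1)"

lemma dirichlet_character_mod:
  assumes "dirichlet_character q \<psi>"
  shows "\<psi> (n mod q) = \<psi> n"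
proof -
  have "\<psi> (m + k * q) = \<psi> m" for m k
    using assms by (induction k) (auto simp: dirichlet_character_def algebra_simps, metis add.assoc add.commute)
  from this[of "n mod q" "n div q"] show ?thesis by simp
qed

lemma nonprincipal_modulus_gt_1:
  assumes "dirichlet_character q \<psi>" "nonprincipal q \<psi>"
  shows "q > 1"
proof (rule ccontr)
  assume "\<not> q > 1"
  hence "q = 1" using assms by (auto simp: dirichlet_character_def)
  hence "\<psi> n = 1" for n
    using dirichlet_character_mod[OF assms(1), of n] dirichlet_character_mod[OF assms(1), of 1] assms(1)
    by (auto simp: dirichlet_character_def)
  thus False using assms(2) by (auto simp: nonprincipal_def)
qed

text \<open>Multiplication by \<open>b\<close> permutes the residues and multiplies the sum by
  \<open>\<psi> b \<noteq> 1\<close>.\<close>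

lemma sum_character_period:
  assumes "dirichlet_character q \<psi>" "nonprincipal q \<psi>"
  shows "(\<Sum>n<q. \<psi> n) = 0"
proof -
  obtain b where b: "coprime b q" "\<psi> b \<noteq> 1" using assms(2) by (auto simp: nonprincipal_def)
  have q: "q > 0" using assms(1) by (auto simp: dirichlet_character_def)
  have inj: "inj_on (\<lambda>n. b * n mod q) {..<q}"
  proof (rule inj_onI)
    fix x y assume xy: "x \<in> {..<q}" "y \<in> {..<q}" "b * x mod q = b * y mod q"
    hence "[b * x = b * y] (mod q)" by (simp add: unique_euclidean_semiring_class.cong_def)
    hence "[x = y] (mod q)" using b(1) cong_mult_lcancel_nat by blast
    thus "x = y" using xy by (simp add: unique_euclidean_semiring_class.cong_def)
  qed
  have "(\<lambda>n. b * n mod q) ` {..<q} = {..<q}"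
    by (rule endo_inj_surj[OF _ _ inj]) (use q in auto)
  hence "bij_betw (\<lambda>n. b * n mod q) {..<q} {..<q}" using inj by (simp add: bij_betw_def)
  hence "(\<Sum>n<q. \<psi> n) = (\<Sum>n<q. \<psi> (b * n mod q))"
    by (rule sum.reindex_bij_betw[symmetric])
  also have "\<dots> = \<psi> b * (\<Sum>n<q. \<psi> n)"
    using assms(1) by (simp add: dirichlet_character_mod[OF assms(1)] sum_distrib_left dirichlet_character_def)
  finally have "(1 - \<psi> b) * (\<Sum>n<q. \<psi> n) = 0" by (simp add: algebra_simps)
  thus ?thesis using b by auto
qed

lemma norm_real_character_le: "real_character q \<psi> \<Longrightarrow> norm (\<psi> n) \<le> 1"
  by (auto simp: real_character_def dest: spec[of _ n])

text \<open>Whole periods cancel, which leaves fewer than \<open>q\<close> terms.\<close>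

lemma partial_sums_character_bound:
  assumes "real_character q \<psi>" "nonprincipal q \<psi>"
  shows "norm (\<Sum>n<m. \<psi> n) \<le> real q"
proof (induction m rule: less_induct)
  case (less m)
  have dc: "dirichlet_character q \<psi>" using assms by (simp add: real_character_def)
  show ?case
  proof (cases "m < q")
    case True
    have "norm (\<Sum>n<m. \<psi> n) \<le> (\<Sum>n<m. 1)"
      by (intro sum_norm_le norm_real_character_le[OF assms(1)])
    thus ?thesis using True by simp
  next
    case False
    define k where "k = m - q"
    have split: "(\<Sum>n<j + q. f n) = (\<Sum>n<q. f n) + (\<Sum>n<j. f (n + q))" for j and f :: "nat \<Rightarrow> complex"
      by (induction j) (auto simp: add_ac)
    have "q > 0" using dc by (simp add: dirichlet_character_def)
    hence "k < m" using False by (simp add: k_def)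
    moreover have "(\<Sum>n<m. \<psi> n) = (\<Sum>n<k. \<psi> n)"
      using split[of \<psi> k] False sum_character_period[OF dc assms(2)] dc
      by (simp add: k_def dirichlet_character_def)
    ultimately show ?thesis using less by simp
  qed
qed

lemma powr_holomorphic: "(\<lambda>s. of_nat n powr (c - s)) holomorphic_on A"
proof (cases "n = 0")
  case False
  hence "(\<lambda>s. of_nat n powr (c - s)) = (\<lambda>s::complex. exp ((c - s) * Ln (of_nat n)))" by (simp add: powr_def)
  thus ?thesis by (auto intro!: holomorphic_intros)
qed auto

text \<open>Summation by parts against the bounded partial sums of the character. That the bound is
  explicit and linear in \<open>q\<close> matters: its logarithm becomes the factor
  \<open>1 + ln q\<close> in the bound on moments.\<close>

lemma L_function_continuation:
  assumes \<psi>: "real_character q \<psi>" "nonprincipal q \<psi>"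
  shows "\<exists>L. L holomorphic_on {s. Re s > 0} \<and> (\<forall>s. Re s > 1 \<longrightarrow> L s = dirichlet_series \<psi> s) \<and>
    (\<forall>s. Re s \<ge> 1/2 \<longrightarrow> norm (L s) \<le> real q * (norm s + 1)\<^sup>2 * three_halves_sum)"
proof -
  define A where "A = (\<lambda>m. \<Sum>i<Suc m. \<psi> i)"
  have dc: "dirichlet_character q \<psi>" using \<psi> by (simp add: real_character_def)
  have "\<psi> 0 = 0" using nonprincipal_modulus_gt_1[OF dc \<psi>(2)] dc
    unfolding dirichlet_character_def by (metis coprime_0_left_iff nat_dvd_1_iff_1 less_irrefl)
  have A0: "A 0 = 0" by (simp add: A_def \<open>\<psi> 0 = 0\<close>)
  have Abd: "norm (A m) \<le> real q" for m
    unfolding A_def by (rule partial_sums_character_bound[OF \<psi>])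
  define t :: "nat \<Rightarrow> complex \<Rightarrow> complex" where "t = (\<lambda>n s. A (Suc n) * (of_nat (Suc n) powr (-s) - of_nat (Suc (Suc n)) powr (-s)))"
  have t_hol: "t n holomorphic_on {s. Re s > 0}" for n
    unfolding t_def using powr_holomorphic[where c = 0]
    by (intro holomorphic_intros) (auto simp del: of_nat_Suc)
  have t_le: "norm (t n s) \<le> real q * (norm s + 1)\<^sup>2 * real (Suc n) powr (-Re s - 1)" if "Re s > 0" for n s
  proof -
    have "norm (t n s) \<le> real q * (norm s * real (Suc n) powr (-Re s - 1))"
      using of_real_powr_diff_bound[of "Suc n" "real (Suc (Suc n))" s] that unfolding t_def norm_mult
      by (intro mult_mono Abd) (auto simp: norm_minus_commute)
    also have "norm s \<le> (norm s + 1)\<^sup>2" using zero_le_power2[of "norm s"] norm_ge_zero[of s] by (simp add: power2_sum)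
    finally show ?thesis by (simp add: mult_left_mono mult_right_mono mult.assoc)
  qed
  note * = halfplane_series[OF t_hol t_le, simplified]
  have "(\<Sum>n. t n s) = dirichlet_series \<psi> s" if s: "Re s > 1" for s
  proof -
    have parts: "(\<Sum>n<m. \<psi> (Suc n) * of_nat (Suc n) powr (-s)) =
        (\<Sum>n<m. t n s) + A m * of_nat (Suc m) powr (-s)" for m
    proof (induction m)
      case (Suc m)
      have "A (Suc m) = A m + \<psi> (Suc m)" by (simp add: A_def)
      thus ?case using Suc by (simp add: t_def algebra_simps del: of_nat_Suc)
    qed (simp add: A0)
    have "(\<lambda>m. real q * real (Suc m) powr (-Re s)) \<longlonglongrightarrow> real q * 0"
      using s by (intro tendsto_mult tendsto_const LIMSEQ_Suc[of "\<lambda>m. real m powr (-Re s)"] tendsto_neg_powr filterlim_real_sequentially) auto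
    moreover have nb: "norm (A m * of_nat (Suc m) powr (-s)) \<le> real q * real (Suc m) powr (-Re s)" for m
      unfolding norm_mult norm_of_nat_powr uminus_complex.sel by (rule mult_right_mono[OF Abd]) simp
    ultimately have "(\<lambda>m. A m * of_nat (Suc m) powr (-s)) \<longlonglongrightarrow> 0"
      using Lim_null_comparison[OF always_eventually[OF allI[OF nb]]] by simp
    moreover have "(\<lambda>m. \<Sum>n<m. t n s) \<longlonglongrightarrow> (\<Sum>n. t n s)"
      using *(2)[of s] s by (simp add: summable_LIMSEQ)
    ultimately have "(\<lambda>m. (\<Sum>n<m. t n s) + A m * of_nat (Suc m) powr (-s)) \<longlonglongrightarrow> (\<Sum>n. t n s) + 0"
      by (intro tendsto_add)
    hence "(\<lambda>n. \<psi> (Suc n) * of_nat (Suc n) powr (-s)) sums (\<Sum>n. t n s)"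
      unfolding sums_def parts by simp
    moreover have "(\<lambda>n. \<psi> (Suc n) * of_nat (Suc n) powr (-s)) sums dirichlet_series \<psi> s"
      using dirichlet_series_sums[OF abs_convergent_bounded[OF norm_real_character_le[OF \<psi>(1)]] s]
      by (subst sums_Suc_iff) simp
    ultimately show ?thesis by (rule sums_unique2)
  qed
  thus ?thesis using * by (intro exI[of _ "\<lambda>s. \<Sum>n. t n s"]) auto
qed

text \<open>\<open>Z s\<close> is \<open>(s - 1) * \<zeta>(s)\<close>, a function without a pole. At
  \<open>s = 1\<close> all terms \<open>t n\<close> vanish, which leaves the summand 1 of
  \<open>Z\<close>.\<close>

lemma zeta_continuation:
  "\<exists>Z. Z holomorphic_on {s. Re s > 0} \<and> (\<forall>s. Re s > 1 \<longrightarrow> Z s = (s - 1) * dirichlet_series (\<lambda>_. 1) s) \<and>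
    (\<forall>s. Re s \<ge> 1/2 \<longrightarrow> norm (Z s) \<le> 1 + (norm s + 1)\<^sup>2 * three_halves_sum) \<and> Z 1 = 1"
proof -
  define t :: "nat \<Rightarrow> complex \<Rightarrow> complex" where "t = (\<lambda>n s. (s - 1) * of_nat (Suc n) powr (-s) + of_nat (Suc (Suc n)) powr (1 - s) - of_nat (Suc n) powr (1 - s))"
  have t_hol: "t n holomorphic_on {s. Re s > 0}" for n
    unfolding t_def using powr_holomorphic[where c = 0] powr_holomorphic[where c = 1]
    by (intro holomorphic_intros) (auto simp del: of_nat_Suc)
  have t_le: "norm (t n s) \<le> 1 * (norm s + 1)\<^sup>2 * real (Suc n) powr (-Re s - 1)" if "Re s > 0" for n s
  proof -
    have "norm (t n s) \<le> norm (s - 1) * norm s * real (Suc n) powr (-Re s - 1)"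
      unfolding t_def by (rule zeta_term_bound) (use that in auto)
    also have "norm (s - 1) * norm s \<le> (norm s + 1) * (norm s + 1)"
      using norm_triangle_ineq4[of s 1] by (intro mult_mono) auto
    finally show ?thesis by (simp add: mult_right_mono power2_eq_square)
  qed
  note * = halfplane_series[OF t_hol t_le, simplified]
  define Z where "Z = (\<lambda>s. 1 + (\<Sum>n. t n s))"
  have "Z s = (s - 1) * dirichlet_series (\<lambda>_. 1) s" if s: "Re s > 1" for s
  proof -
    have "(\<lambda>m. real (Suc m) powr (1 - Re s)) \<longlonglongrightarrow> 0"
      using s by (intro LIMSEQ_Suc[of "\<lambda>m. real m powr (1-Re s)"] tendsto_neg_powr filterlim_real_sequentially) auto
    hence lim: "(\<lambda>m. of_nat (Suc m) powr (1 - s) :: complex) \<longlonglongrightarrow> 0"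
      by (intro tendsto_norm_zero_cancel[of "\<lambda>m. of_nat (Suc m) powr (1 - s) :: complex"]) (simp add: norm_of_nat_powr del: of_nat_Suc)
    \<comment> \<open>The powers telescope to -1, which cancels against the summand 1 in the
      definition of \<open>Z\<close>.\<close>
    have "(\<lambda>m. of_nat (Suc (Suc m)) powr (1 - s) - of_nat (Suc m) powr (1 - s) :: complex) sums (-1)"
      using telescope_sums[OF lim] by simp
    moreover have "(\<lambda>n. 1 * of_nat (Suc n) powr (-s)) sums dirichlet_series (\<lambda>_. 1) s"
      using dirichlet_series_sums[OF abs_convergent_bounded s, of "\<lambda>_. 1"]
      by (subst sums_Suc_iff) simp
    ultimately have "(\<lambda>n. (s - 1) * (1 * of_nat (Suc n) powr (-s)) +
        (of_nat (Suc (Suc n)) powr (1 - s) - of_nat (Suc n) powr (1 - s))) sums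
        ((s - 1) * dirichlet_series (\<lambda>_. 1) s + (-1))"
      by (intro sums_add sums_mult)
    hence "(\<lambda>n. t n s) sums ((s - 1) * dirichlet_series (\<lambda>_. 1) s - 1)"
      by (simp add: t_def algebra_simps del: of_nat_Suc) 
    thus ?thesis by (simp add: Z_def sums_iff)
  qed
  moreover have "Z 1 = 1"
    unfolding Z_def t_def by (simp del: of_nat_Suc)
  moreover have "norm (Z s) \<le> 1 + (norm s + 1)\<^sup>2 * three_halves_sum" if "Re s \<ge> 1/2" for s
    unfolding Z_def using *(3)[of s] that norm_triangle_ineq[of 1 "\<Sum>n. t n s"] by simp
  moreover have "Z holomorphic_on {s. Re s > 0}"
    unfolding Z_def using *(1) by (intro holomorphic_intros)
  ultimately show ?thesis by blast
qed

text \<open>Provides the lower bound at the centre 3 for Borel-Caratheodory. The tail is at most 1/2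
  since \<open>1 / n ^ 3\<close> is at most half of \<open>1 / (n - 1) - 1 / n\<close>, which
  telescopes.\<close>

lemma dirichlet_series_3_ge:
  assumes le: "\<And>n. norm (a n) \<le> 1" and a1: "a 1 = 1"
  shows "norm (dirichlet_series a 3) \<ge> 1 / 2"
proof -
  define f where "f = (\<lambda>n. a n * of_nat n powr (-3 :: complex))"
  have "f sums dirichlet_series a 3"
    using dirichlet_series_sums[OF abs_convergent_bounded[OF le], of 3] by (simp add: f_def)
  hence f: "(\<lambda>n. f (n + 2)) sums (dirichlet_series a 3 - (\<Sum>n<2. f n))"
    by (rule sums_split_initial_segment)
  have f2: "(\<Sum>n<2. f n) = 1" by (simp add: f_def a1 numeral_2_eq_2 a1[simplified])
  have "(\<lambda>n. 1 / real (Suc n)) \<longlonglongrightarrow> 0" by (rule LIMSEQ_Suc[OF lim_1_over_n])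
  from telescope_sums'[OF this] have tel: "(\<lambda>n. 1 / real (Suc n) - 1 / real (Suc (Suc n))) sums 1"
    by simp
  have nf: "norm (f (n + 2)) \<le> (1 / real (Suc n) - 1 / real (Suc (Suc n))) / 2" for n
  proof -
    define x where "x = real n + 1"
    have x: "x \<ge> 1" by (simp add: x_def)
    have "real (n + 2) = x + 1" by (simp add: x_def)
    have "norm (f (n + 2)) \<le> 1 * real (n + 2) powr (-3)"
      unfolding f_def norm_mult norm_of_nat_powr using le by (intro mult_mono) auto
    also have "\<dots> = 1 / (x + 1) ^ 3"
      unfolding \<open>real (n + 2) = x + 1\<close> using x by (simp add: powr_minus_divide)
    also have "\<dots> \<le> 1 / (2 * x * (x + 1))"
    proof (rule divide_left_mono)
      have "(x + 1) ^ 3 - 2 * x * (x + 1) = (x + 1) * (x\<^sup>2 + 1)"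
        by (simp add: power2_eq_square power3_eq_cube algebra_simps)
      moreover have "(x + 1) * (x\<^sup>2 + 1) \<ge> 0" using x by simp
      ultimately show "2 * x * (x + 1) \<le> (x + 1) ^ 3" by linarith
    qed (use x in auto)
    also have "\<dots> = (1 / x - 1 / (x + 1)) / 2" using x by (simp add: field_simps)
    finally show ?thesis by (simp add: x_def add_ac)
  qed
  have smn: "summable (\<lambda>n. norm (f (n + 2)))"
    by (rule summable_comparison_test'[OF sums_summable[OF sums_divide[OF tel, of 2]], of 0]) (use nf in auto)
  have "norm (dirichlet_series a 3 - 1) = norm (\<Sum>n. f (n + 2))"
    using f f2 by (simp add: sums_iff)
  also have "\<dots> \<le> (\<Sum>n. norm (f (n + 2)))" by (rule summable_norm[OF smn])
  also have "\<dots> \<le> 1 / 2"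
    using suminf_le[OF nf smn sums_summable[OF sums_divide[OF tel, of 2]]] sums_unique[OF sums_divide[OF tel, of 2]] by simp
  finally show ?thesis
    using norm_triangle_ineq2[of 1 "1 - dirichlet_series a 3"] by (simp add: norm_minus_commute)
qed

subsection \<open>Logarithmic derivatives\<close>

text \<open>This is the series of \<open>-L'/L\<close>, derived from \<open>ln n\<close> being the
  sum of \<open>mangoldt\<close> over the divisors of \<open>n\<close>. It is stated without
  division because non-vanishing of the series is itself deduced from it.\<close>

lemma deriv_completely_multiplicative_series:
  assumes le: "\<And>n. norm (\<psi> n) \<le> 1" and mult: "\<And>m n. \<psi> (m * n) = \<psi> m * \<psi> n" and s: "Re s > 1"
  shows "deriv (dirichlet_series \<psi>) s = - dirichlet_series (\<lambda>n. \<psi> n * mangoldt n) s * dirichlet_series \<psi> s"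
proof -
  define a where "a = (\<lambda>n. \<psi> n * of_real (ln (real n)))"
  have ac: "abs_convergent a" "abs_convergent (\<lambda>n. \<psi> n * mangoldt n)" "abs_convergent \<psi>"
  proof -
    have *: "norm (\<psi> n) * y \<le> ln (real n)" if "0 \<le> y" "y \<le> ln (real n)" for n y
      using mult_mono[OF le that(2)] that by simp
    show "abs_convergent a"
    proof (rule abs_convergent_log)
      fix n show "norm (a n) \<le> ln (real n)"
        unfolding a_def norm_mult norm_of_real by (cases "n = 0") (auto intro!: *)
    qed (auto simp: a_def)
    show "abs_convergent (\<lambda>n. \<psi> n * mangoldt n)"
      by (rule abs_convergent_log) (auto simp: norm_mult intro!: * mangoldt_nonneg mangoldt_le_ln)
  qed (rule abs_convergent_bounded[OF le])
  have "(\<lambda>n. \<psi> n * (-of_real (ln (real n))) ^ 1 * of_nat n powr (-s)) sums (deriv ^^ 1) (dirichlet_series \<psi>) s"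
    by (rule higher_deriv_dirichlet_series[OF ac(3) s])
  moreover have "(\<lambda>n. - (a n * of_nat n powr (-s))) sums (- dirichlet_series a s)"
    by (intro sums_minus dirichlet_series_sums[OF ac(1) s])
  ultimately have "deriv (dirichlet_series \<psi>) s = - dirichlet_series a s"
    by (simp add: a_def sums_iff)
  also have "dirichlet_series a s = dirichlet_series (\<lambda>n. \<psi> n * mangoldt n) s * dirichlet_series \<psi> s"
  proof (rule dirichlet_series_mult[OF ac(2,3) s])
    fix n :: nat assume n: "n > 0"
    have "(\<Sum>d | d dvd n. \<psi> d * mangoldt d * \<psi> (n div d)) = (\<Sum>d | d dvd n. \<psi> n * mangoldt d)"
    proof (rule sum.cong)
      fix d assume "d \<in> {d. d dvd n}"
      thus "\<psi> d * mangoldt d * \<psi> (n div d) = \<psi> n * mangoldt d"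
        using mult[of d "n div d"] by simp
    qed auto
    also have "\<dots> = a n" using n by (simp add: a_def mangoldt_sum flip: sum_distrib_left)
    finally show "a n = (\<Sum>d | d dvd n. \<psi> d * mangoldt d * \<psi> (n div d))" ..
  qed
  finally show ?thesis by simp
qed

lemma abs_convergent_mangoldt:
  assumes le: "\<And>n. norm (\<psi> n) \<le> 1"
  shows "abs_convergent (\<lambda>n. \<psi> n * mangoldt n)"
proof (rule abs_convergent_log)
  fix n show "norm (\<psi> n * mangoldt n) \<le> ln (real n)"
    using mult_mono[OF le[of n] mangoldt_le_ln[of n]] by (simp add: norm_mult mangoldt_nonneg)
qed auto

text \<open>Multiplication by \<open>exp (- h)\<close>, with \<open>h\<close> a primitive of
  \<open>g\<close>, turns \<open>f\<close> into a constant.\<close>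

lemma linear_ode_no_zero:
  fixes f g :: "complex \<Rightarrow> complex"
  assumes S: "convex S" "open S" and f: "f holomorphic_on S" and g: "g holomorphic_on S"
    and ode: "\<And>z. z \<in> S \<Longrightarrow> deriv f z = g z * f z"
    and z: "z \<in> S" "f z = 0" and w: "w \<in> S"
  shows "f w = 0"
proof -
  obtain h where h: "\<And>x. x \<in> S \<Longrightarrow> (h has_field_derivative g x) (at x within S)"
    using holomorphic_convex_primitive'[OF S g] by blast
  have "((\<lambda>z. f z * exp (- h z)) has_field_derivative 0) (at x within S)" if "x \<in> S" for x
  proof -
    have "(f has_field_derivative g x * f x) (at x within S)"
      using holomorphic_derivI[OF f S(2) that, of S] ode[OF that] by simp
    from this and h[OF that] show ?thesis by (auto intro!: derivative_eq_intros)
  qed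
  then obtain c where "\<And>x. x \<in> S \<Longrightarrow> f x * exp (- h x) = c"
    using has_field_derivative_zero_constant[OF S(1), of "\<lambda>z. f z * exp (- h z)"] by blast
  from this[OF z(1)] this[OF w] z(2) show ?thesis by simp
qed

lemma convex_Re_gt: "convex {s. Re s > c}"
  by (simp add: convex_halfspace_Re_gt)

text \<open>Takes the place of the Euler product: by the differential equation for the series, one
  zero in the half plane would force a zero at 3.\<close>

lemma completely_multiplicative_series_nonzero:
  assumes le: "\<And>n. norm (\<psi> n) \<le> 1" and mult: "\<And>m n. \<psi> (m * n) = \<psi> m * \<psi> n" and "\<psi> 1 = 1" and s: "Re s > 1"
  shows "dirichlet_series \<psi> s \<noteq> 0"
proof
  assume z: "dirichlet_series \<psi> s = 0"
  have "dirichlet_series \<psi> 3 = 0"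
  proof (rule linear_ode_no_zero[OF convex_Re_gt[of 1] open_halfplane, where f = "dirichlet_series \<psi>" and z = s])
    show "(\<lambda>s. - dirichlet_series (\<lambda>n. \<psi> n * mangoldt n) s) holomorphic_on {s. Re s > 1}"
      by (intro holomorphic_intros dirichlet_series_holomorphic abs_convergent_mangoldt le)
  qed (use z s le in \<open>auto intro!: dirichlet_series_holomorphic abs_convergent_bounded
         deriv_completely_multiplicative_series[OF le mult, simplified]\<close>)
  thus False using dirichlet_series_3_ge[of \<psi>, OF le] assms(3) by simp
qed

text \<open>\<open>n\<close> is the order of vanishing of \<open>W\<close> at \<open>z0\<close>,
  that is, the residue of its logarithmic derivative. The point \<open>z1\<close> excludes that
  \<open>W\<close> vanishes identically.\<close>

lemma log_deriv_limit:
  assumes W: "W holomorphic_on {s. Re s > 0}" and nz: "W z1 \<noteq> 0" "Re z1 > 0" and z0: "Re z0 = 1"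
  obtains n :: nat where
    "((\<lambda>x. of_real x * (deriv W (z0 + of_real x) / W (z0 + of_real x))) \<longlongrightarrow> of_nat n) (at_right 0)"
    "W z0 = 0 \<longleftrightarrow> n > 0"
proof (cases "W z0 = 0")
  case False
  have lim: "((\<lambda>x. z0 + of_real x) \<longlongrightarrow> z0) (at_right 0)"
    by (auto intro!: tendsto_eq_intros)
  have "isCont W z0" "isCont (deriv W) z0"
    using holomorphic_on_imp_continuous_on[OF W] holomorphic_on_imp_continuous_on[OF holomorphic_deriv[OF W open_halfplane]] z0
    by (auto simp: continuous_on_eq_continuous_at[OF open_halfplane])
  hence "((\<lambda>x. of_real x * (deriv W (z0 + of_real x) / W (z0 + of_real x))) \<longlongrightarrow> of_real 0 * (deriv W z0 / W z0)) (at_right 0)"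
    using False lim by (intro tendsto_intros isCont_tendsto_compose[of _ W] isCont_tendsto_compose[of _ "deriv W"]) auto
  thus ?thesis using False by (intro that[of 0]) auto
next
  case True
  have nc: "\<not> W constant_on {s. Re s > 0}"
    using True nz z0 unfolding constant_on_def by (metis (mono_tags, lifting) mem_Collect_eq zero_less_one)
  obtain g r n where r: "0 < n" "0 < r" "ball z0 r \<subseteq> {s. Re s > 0}" "g holomorphic_on ball z0 r"
      "\<And>w. w \<in> ball z0 r \<Longrightarrow> W w = (w - z0) ^ n * g w" "\<And>w. w \<in> ball z0 r \<Longrightarrow> g w \<noteq> 0"
    using holomorphic_factor_zero_nonconstant[OF W open_halfplane convex_connected[OF convex_Re_gt] _ True nc] z0
    by (metis (mono_tags, lifting) mem_Collect_eq zero_less_one)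
  have lim: "((\<lambda>x. z0 + of_real x) \<longlongrightarrow> z0) (at_right 0)"
    by (auto intro!: tendsto_eq_intros)
  have "isCont g z0" "isCont (deriv g) z0"
    using holomorphic_on_imp_continuous_on[OF r(4)] holomorphic_on_imp_continuous_on[OF holomorphic_deriv[OF r(4)]] r(2)
    by (auto simp: continuous_on_eq_continuous_at)
  hence L: "((\<lambda>x. of_nat n + of_real x * (deriv g (z0 + of_real x) / g (z0 + of_real x))) \<longlongrightarrow>
      of_nat n + of_real 0 * (deriv g z0 / g z0)) (at_right 0)"
    using r lim by (intro tendsto_intros isCont_tendsto_compose[of _ g] isCont_tendsto_compose[of _ "deriv g"]) auto
  have ev: "\<forall>\<^sub>F x in at_right 0. of_nat n + of_real x * (deriv g (z0 + of_real x) / g (z0 + of_real x)) =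
      of_real x * (deriv W (z0 + of_real x) / W (z0 + of_real x))"
    using eventually_at_right_less[of 0] eventually_at_right_real[OF r(2)]
  proof eventually_elim
    case (elim x)
    define w where "w = z0 + of_real x"
    have w: "w \<in> ball z0 r" "w - z0 = of_real x" using elim by (auto simp: w_def dist_norm)
    have "(W has_field_derivative (of_nat n * (w - z0) ^ (n - 1) * g w + (w - z0) ^ n * deriv g w)) (at w)"
    proof (rule has_field_derivative_transform_within_open[of "\<lambda>w. (w - z0) ^ n * g w" _ _ "ball z0 r"])
      have "(g has_field_derivative deriv g w) (at w)"
        using holomorphic_derivI[OF r(4) open_ball w(1)] .
      thus "((\<lambda>w. (w - z0) ^ n * g w) has_field_derivative
           (of_nat n * (w - z0) ^ (n - 1) * g w + (w - z0) ^ n * deriv g w)) (at w)"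
        by (auto intro!: derivative_eq_intros)
    qed (use w r in auto)
    hence d: "deriv W w = of_nat n * of_real x ^ (n - 1) * g w + of_real x ^ n * deriv g w"
      unfolding w(2) by (rule DERIV_imp_deriv)
    have Ww: "W w = of_real x ^ n * g w" using r(5)[OF w(1)] w(2) by simp
    obtain m where m: "n = Suc m" using r(1) by (cases n) auto
    show ?case using elim r(6)[OF w(1)] unfolding w_def[symmetric] d Ww m
      by (simp add: divide_simps) (simp add: algebra_simps)
  qed
  show ?thesis
    by (rule that[of n]) (use Lim_transform_eventually[OF L ev] True r(1) in auto)
qed

section \<open>Non-vanishing on the line Re s = 1 off the real axis\<close>

lemma Re_of_nat_powr: "Re (of_nat n powr (-Complex \<sigma> t)) = real n powr (-\<sigma>) * cos (t * ln (real n))"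
proof (cases "n = 0")
  case False
  thus ?thesis by (simp add: powr_def Re_exp mult_ac)
qed auto

text \<open>With \<open>c\<close> the cosine, the weight is \<open>2 * (y + c)\<^sup>2\<close> for
  \<open>y = 1\<close> or \<open>y = -1\<close>, and \<open>2 + 2 * c\<^sup>2\<close> for
  \<open>y = 0\<close>. So the third series can be taken without a character even where \<psi>
  vanishes.\<close>

lemma three_four_one:
  assumes \<psi>: "\<And>n. \<psi> n \<in> {-1, 0, 1 :: complex}" and x: "x > 0"
  shows "3 * Re (dirichlet_series mangoldt (Complex (1 + x) 0)) +
      4 * Re (dirichlet_series (\<lambda>n. \<psi> n * mangoldt n) (Complex (1 + x) t)) +
      Re (dirichlet_series mangoldt (Complex (1 + x) (2 * t))) \<ge> 0"
proof -
  have le: "norm (\<psi> n) \<le> 1" for n using \<psi>[of n] by auto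
  have acm: "abs_convergent mangoldt" using abs_convergent_mangoldt[of "\<lambda>_. 1"] by simp
  define b where "b = (\<lambda>n. 3 * Re (mangoldt n * of_nat n powr (-Complex (1 + x) 0)) +
      4 * Re (\<psi> n * mangoldt n * of_nat n powr (-Complex (1 + x) t)) +
      Re (mangoldt n * of_nat n powr (-Complex (1 + x) (2 * t))))"
  have "b sums (3 * Re (dirichlet_series mangoldt (Complex (1 + x) 0)) +
      4 * Re (dirichlet_series (\<lambda>n. \<psi> n * mangoldt n) (Complex (1 + x) t)) +
      Re (dirichlet_series mangoldt (Complex (1 + x) (2 * t))))"
    unfolding b_def using x
    by (intro sums_add sums_mult sums_Re dirichlet_series_sums acm abs_convergent_mangoldt le) auto
  moreover have "b n \<ge> 0" for n
  proof -
    define c where "c = cos (t * ln (real n))"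
    obtain y :: real where y: "\<psi> n = of_real y" "y \<in> {-1, 0, 1}" 
    proof -
      from \<psi>[of n] have "\<psi> n = of_real (Re (\<psi> n))" "Re (\<psi> n) \<in> {-1, 0, 1}" by (auto simp: complex_eq_iff)
      thus ?thesis by (rule that)
    qed
    have c2: "cos (2 * t * ln (real n)) = 2 * c\<^sup>2 - 1"
      unfolding c_def using cos_double_cos[of "t * ln (real n)"] by (simp add: mult.assoc)
    have R: "Re (of_real u * mangoldt n * of_nat n powr (-Complex (1+x) v)) =
        u * mangoldt n * (real n powr (-(1+x)) * cos (v * ln (real n)))" for u v
    proof -
      have "of_real u * mangoldt n * of_nat n powr (-Complex (1+x) v) =
          of_real (u * mangoldt n) * of_nat n powr (-Complex (1+x) v)" by simp
      thus ?thesis by (simp only: Re_complex_of_real Re_of_nat_powr times_complex.sel Im_complex_of_real)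
    qed
    have R1: "Re (mangoldt n * of_nat n powr (-Complex (1+x) v)) =
        mangoldt n * (real n powr (-(1+x)) * cos (v * ln (real n)))" for v
      using R[of 1 v] by (simp only: of_real_1 mult_1)
    have "b n = mangoldt n * real n powr (-(1+x)) * (3 + 4 * y * c + (2 * c\<^sup>2 - 1))"
      unfolding b_def y R R1 c2 c_def[symmetric] by (simp add: algebra_simps)
    moreover have "3 + 4 * y * c + (2 * c\<^sup>2 - 1) \<ge> 0"
    proof (cases "y = 0")
      case False
      hence "y\<^sup>2 = 1" using y(2) by auto
      hence "3 + 4 * y * c + (2 * c\<^sup>2 - 1) = 2 * (y + c)\<^sup>2" by (simp add: power2_sum)
      thus ?thesis by simp
    qed auto
    ultimately show ?thesis by (simp add: mangoldt_nonneg)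
  qed
  ultimately show ?thesis by (metis sums_le sums_zero)
qed

text \<open>Multiply the inequality at \<open>1 + x\<close> by \<open>x\<close> and let
  \<open>x\<close> tend to 0: the limit is \<open>3 - 4 * n - m\<close>, with \<open>n\<close> the
  order of \<open>W\<close> at 1 + it and \<open>m\<close> that of \<open>Z\<close> at 1 + 2it, and
  it is negative as soon as \<open>n > 0\<close>. The parameter \<open>c\<close> lets the lemma
  cover zeta itself (\<open>c = 1\<close>) as well as L-functions (\<open>c = 0\<close>).\<close>

lemma nonzero_on_line:
  assumes Z: "Z holomorphic_on {s. Re s > 0}" "Z 1 = 1"
      "\<And>s. Re s > 1 \<Longrightarrow> dirichlet_series mangoldt s = 1 / (s - 1) - deriv Z s / Z s"
    and W: "W holomorphic_on {s. Re s > 0}" "W 3 \<noteq> 0"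
      "\<And>s. Re s > 1 \<Longrightarrow> dirichlet_series (\<lambda>n. \<psi> n * mangoldt n) s = c / (s - 1) - deriv W s / W s"
    and \<psi>: "\<And>n. \<psi> n \<in> {-1, 0, 1 :: complex}" and t: "t \<noteq> 0"
  shows "W (Complex 1 t) \<noteq> 0"
proof
  assume zero: "W (Complex 1 t) = 0"
  obtain n where n: "((\<lambda>x. of_real x * (deriv W (Complex 1 t + of_real x) / W (Complex 1 t + of_real x))) \<longlongrightarrow> of_nat n) (at_right 0)" "n > 0"
    using log_deriv_limit[OF W(1,2), of "Complex 1 t"] zero by auto
  obtain m where m: "((\<lambda>x. of_real x * (deriv Z (Complex 1 (2*t) + of_real x) / Z (Complex 1 (2*t) + of_real x))) \<longlongrightarrow> of_nat m) (at_right 0)"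
    using log_deriv_limit[OF Z(1), of 1 "Complex 1 (2*t)"] Z(2) by auto
  obtain k where k: "((\<lambda>x. of_real x * (deriv Z (1 + of_real x) / Z (1 + of_real x))) \<longlongrightarrow> of_nat k) (at_right 0)" "k = 0"
    using log_deriv_limit[OF Z(1), of 1 1] Z(2) by auto
  have lim0: "((\<lambda>x. of_real x * (d / (Complex 1 u + of_real x - 1))) \<longlongrightarrow> 0) (at_right 0)" if "u \<noteq> 0" for u d
  proof -
    have "Complex 1 u + of_real 0 - 1 \<noteq> 0" using that by (simp add: complex_eq_iff)
    hence "((\<lambda>x. of_real x * (d / (Complex 1 u + of_real x - 1))) \<longlongrightarrow> of_real 0 * (d / (Complex 1 u + of_real 0 - 1))) (at_right 0)"
      by (intro tendsto_intros) auto
    thus ?thesis by simp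
  qed
  have l1: "((\<lambda>x. of_real x * dirichlet_series (\<lambda>n. \<psi> n * mangoldt n) (Complex 1 t + of_real x)) \<longlongrightarrow> 0 - of_nat n) (at_right 0)"
  proof (rule Lim_transform_eventually[OF tendsto_diff[OF lim0[OF t, of c] n(1)]])
    show "\<forall>\<^sub>F x in at_right 0. of_real x * (c / (Complex 1 t + of_real x - 1)) - of_real x * (deriv W (Complex 1 t + of_real x) / W (Complex 1 t + of_real x)) =
        of_real x * dirichlet_series (\<lambda>n. \<psi> n * mangoldt n) (Complex 1 t + of_real x)"
      using eventually_at_right_less[of 0] by eventually_elim (subst W(3), auto simp: algebra_simps)
  qed
  have l2: "((\<lambda>x. of_real x * dirichlet_series mangoldt (Complex 1 (2*t) + of_real x)) \<longlongrightarrow> 0 - of_nat m) (at_right 0)"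
  proof (rule Lim_transform_eventually[OF tendsto_diff[OF lim0[of "2*t" 1] m]])
    show "\<forall>\<^sub>F x in at_right 0. of_real x * (1 / (Complex 1 (2*t) + of_real x - 1)) - of_real x * (deriv Z (Complex 1 (2*t) + of_real x) / Z (Complex 1 (2*t) + of_real x)) =
        of_real x * dirichlet_series mangoldt (Complex 1 (2*t) + of_real x)"
      using eventually_at_right_less[of 0] by eventually_elim (subst Z(3), auto simp: algebra_simps)
  qed (use t in auto)
  have l3: "((\<lambda>x. of_real x * dirichlet_series mangoldt (1 + of_real x)) \<longlongrightarrow> 1 - of_nat k) (at_right 0)"
  proof (rule Lim_transform_eventually[OF tendsto_diff[OF tendsto_const k(1)]])
    show "\<forall>\<^sub>F x in at_right 0. 1 - of_real x * (deriv Z (1 + of_real x) / Z (1 + of_real x)) =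
        of_real x * dirichlet_series mangoldt (1 + of_real x)"
      using eventually_at_right_less[of 0] by eventually_elim (subst Z(3), auto simp: algebra_simps)
  qed
  have "((\<lambda>x. 3 * Re (of_real x * dirichlet_series mangoldt (1 + of_real x)) +
      4 * Re (of_real x * dirichlet_series (\<lambda>n. \<psi> n * mangoldt n) (Complex 1 t + of_real x)) +
      Re (of_real x * dirichlet_series mangoldt (Complex 1 (2*t) + of_real x))) \<longlongrightarrow>
      3 * Re (1 - of_nat k) + 4 * Re (0 - of_nat n) + Re (0 - of_nat m)) (at_right 0)"
    by (intro tendsto_intros l1 l2 l3)
  moreover have "\<forall>\<^sub>F x in at_right 0. 0 \<le> 3 * Re (of_real x * dirichlet_series mangoldt (1 + of_real x)) +
      4 * Re (of_real x * dirichlet_series (\<lambda>n. \<psi> n * mangoldt n) (Complex 1 t + of_real x)) +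
      Re (of_real x * dirichlet_series mangoldt (Complex 1 (2*t) + of_real x))"
    using eventually_at_right_less[of 0]
  proof eventually_elim
    case (elim x)
    have e: "1 + of_real x = Complex (1 + x) 0" "Complex 1 u + of_real x = Complex (1 + x) u" for u
      by (auto simp: complex_eq_iff)
    have "x * (3 * Re (dirichlet_series mangoldt (Complex (1 + x) 0)) +
      4 * Re (dirichlet_series (\<lambda>n. \<psi> n * mangoldt n) (Complex (1 + x) t)) +
      Re (dirichlet_series mangoldt (Complex (1 + x) (2 * t)))) \<ge> 0"
      using three_four_one[where \<psi> = \<psi> and t = t, OF \<psi> elim] elim by simp
    thus ?case unfolding e by (simp add: algebra_simps)
  qed
  ultimately have "3 * Re (1 - of_nat k) + 4 * Re (0 - of_nat n) + Re (0 - of_nat m) \<ge> 0"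
    by (rule tendsto_lowerbound) auto
  thus False using n(2) k(2) by simp
qed

section \<open>Taylor coefficients of logarithmic derivatives\<close>

text \<open>The Moebius map \<open>g / (2 * M - g)\<close> sends the half plane
  \<open>Re g < M\<close> into the unit disc and fixes 0, so Schwarz's lemma applies after rescaling
  the disc.\<close>

lemma borel_caratheodory:
  assumes g: "g holomorphic_on ball z R" "g z = 0" and lt: "\<And>w. w \<in> ball z R \<Longrightarrow> Re (g w) < M"
    and r: "0 < r" "r < R" and w: "w \<in> cball z r"
  shows "norm (g w) \<le> 2 * M * r / (R - r)"
proof -
  have R: "R > 0" using r by simp
  have M: "M > 0" using lt[of z] g(2) R by simp
  define \<phi> where "\<phi> = (\<lambda>\<zeta>. g (z + of_real R * \<zeta>) / (2 * of_real M - g (z + of_real R * \<zeta>)))"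
  have inb: "z + of_real R * \<zeta> \<in> ball z R" if "norm \<zeta> < 1" for \<zeta>
    using that R by (simp add: dist_norm norm_mult)
  have nz: "2 * of_real M - g (z + of_real R * \<zeta>) \<noteq> 0" if "norm \<zeta> < 1" for \<zeta>
  proof
    assume "2 * of_real M - g (z + of_real R * \<zeta>) = 0"
    hence "Re (g (z + of_real R * \<zeta>)) = 2 * M" by (metis Re_complex_of_real eq_iff_diff_eq_0 of_real_mult of_real_numeral)
    thus False using lt[OF inb[OF that]] M by simp
  qed
  have "\<phi> holomorphic_on ball 0 1"
    unfolding \<phi>_def using nz
    by (intro holomorphic_intros holomorphic_on_compose_gen[OF _ g(1), unfolded o_def]) (auto intro: inb[simplified])
  moreover have "\<phi> 0 = 0" by (simp add: \<phi>_def g)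
  moreover have "norm (\<phi> \<zeta>) < 1" if "norm \<zeta> < 1" for \<zeta>
  proof -
    define u where "u = g (z + of_real R * \<zeta>)"
    have "Re u < M" unfolding u_def by (rule lt[OF inb[OF that]])
    hence "(norm u)\<^sup>2 < (norm (2 * of_real M - u))\<^sup>2"
      using mult_strict_left_mono[OF _ M, of "Re u" M] unfolding cmod_power2
      by (simp add: power2_eq_square algebra_simps)
    hence "norm u < norm (2 * of_real M - u)" by (rule power2_less_imp_less) simp
    thus ?thesis unfolding \<phi>_def u_def[symmetric] by (simp add: norm_divide divide_less_eq_1)
  qed
  moreover define \<zeta> where "\<zeta> = (w - z) / of_real R"
  have \<zeta>: "norm \<zeta> \<le> r / R" "z + of_real R * \<zeta> = w"
    using w R by (auto simp: \<zeta>_def norm_divide dist_norm norm_minus_commute divide_right_mono)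
  have \<zeta>1: "norm \<zeta> < 1" using \<zeta>(1) r by (meson R divide_less_eq_1_pos order_le_less_trans)
  ultimately have "norm (\<phi> \<zeta>) \<le> norm \<zeta>" using Schwarz_Lemma(1)[of \<phi> \<zeta>] by blast
  hence "norm (g w) \<le> norm \<zeta> * norm (2 * of_real M - g w)"
    using nz[OF \<zeta>1] unfolding \<phi>_def \<zeta>(2) by (simp add: norm_divide divide_le_eq)
  also have "\<dots> \<le> r / R * (2 * M + norm (g w))"
    using \<zeta>(1) norm_triangle_ineq4[of "2 * of_real M" "g w"] M r R by (intro mult_mono) (auto simp: norm_mult)
  finally have "norm (g w) * (R - r) \<le> 2 * M * r" using R by (simp add: field_simps)
  thus ?thesis using r by (simp add: field_simps)
qed

text \<open>The radius 5/2 is the distance from 3 to the line Re s = 1/2. The inner radius 9/4 only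
  has to lie between 2, the distance to the pole at 1, and 5/2. Borel-Caratheodory gives the
  constant \<open>18 = 2 * (9/4) / (5/2 - 9/4)\<close>, and the \<open>+ 1\<close> makes the bound
  on the real part strict.\<close>

lemma log_deriv_coefficient_bound:
  assumes W: "W holomorphic_on ball 3 (5/2)" and nz: "\<And>w. w \<in> ball 3 (5/2) \<Longrightarrow> W w \<noteq> 0"
    and le: "\<And>w. w \<in> ball 3 (5/2) \<Longrightarrow> norm (W w) \<le> B * norm (W 3)"
  shows "norm ((deriv ^^ k) (\<lambda>s. deriv W s / W s) 3) \<le> fact (Suc k) * (18 * (ln B + 1)) / (9/4) ^ Suc k"
proof -
  have c: "3 \<in> ball (3::complex) (5/2)" by simp
  have B: "B > 0" using le[OF c] nz[OF c] mult_le_cancel_right[of 1 "norm (W 3)" B] by simp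
  obtain g0 where g0: "g0 holomorphic_on ball 3 (5/2)" "\<And>z. z \<in> ball 3 (5/2) \<Longrightarrow> W z = exp (g0 z)"
    using contractible_imp_holomorphic_log[OF W _ nz] by (metis convex_imp_contractible convex_ball)
  define g where "g = (\<lambda>z. g0 z - g0 3)"
  have g: "g holomorphic_on ball 3 (5/2)" "g 3 = 0" unfolding g_def using g0 by (auto intro!: holomorphic_intros)
  have Re: "Re (g w) < ln B + 1" if "w \<in> ball 3 (5/2)" for w
  proof -
    have "exp (Re (g0 w)) \<le> B * exp (Re (g0 3))" using le[OF that] g0(2)[OF that] g0(2)[OF c] by (simp add: norm_exp_eq_Re)
    hence "exp (Re (g w)) \<le> B" by (simp add: g_def exp_diff field_simps)
    hence "Re (g w) \<le> ln B" using B by (simp add: ln_ge_iff)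
    thus ?thesis by simp
  qed
  have bc: "norm (g w) \<le> 18 * (ln B + 1)" if "w \<in> cball 3 (9/4)" for w
    using borel_caratheodory[OF g Re, of "9/4" w] that by simp
  have dg: "deriv g w = deriv W w / W w" if "w \<in> ball 3 (5/2)" for w
  proof -
    have d0: "(g0 has_field_derivative deriv g0 w) (at w)" by (rule holomorphic_derivI[OF g0(1) open_ball that])
    hence "((\<lambda>w. exp (g0 w)) has_field_derivative exp (g0 w) * deriv g0 w) (at w)"
      by (rule DERIV_fun_exp)
    hence "(W has_field_derivative exp (g0 w) * deriv g0 w) (at w)"
      by (rule has_field_derivative_transform_within_open[OF _ open_ball that]) (rule g0(2)[symmetric])
    moreover have "(g has_field_derivative deriv g0 w) (at w)"
      unfolding g_def using DERIV_diff[OF d0 DERIV_const[of "g0 3"]] by simp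
    ultimately show ?thesis using g0(2)[OF that] by (simp add: DERIV_imp_deriv)
  qed
  have "(deriv ^^ k) (\<lambda>s. deriv W s / W s) 3 = (deriv ^^ k) (deriv g) 3"
    by (rule higher_deriv_cong_ev)
       (use dg eventually_nhds_in_open[OF open_ball c] in \<open>auto elim!: eventually_mono\<close>)
  also have "\<dots> = (deriv ^^ Suc k) g 3" by (simp add: funpow_swap1)
  also have "norm \<dots> \<le> fact (Suc k) * (18 * (ln B + 1)) / (9/4) ^ Suc k"
  proof (rule Cauchy_inequality)
    show "g holomorphic_on ball 3 (9/4)" by (rule holomorphic_on_subset[OF g(1)]) auto
    show "continuous_on (cball 3 (9/4)) g"
      by (rule holomorphic_on_imp_continuous_on[OF holomorphic_on_subset[OF g(1)]]) auto
  qed (use bc in \<open>auto simp: dist_norm\<close>)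
  finally show ?thesis .
qed

section \<open>Non-vanishing at s = 1\<close>

lemma sum_divisors_coprime_mult:
  fixes f :: "nat \<Rightarrow> 'a :: comm_semiring_1"
  assumes mult: "\<And>m n. f (m * n) = f m * f n" and cop: "coprime a b" and ab: "a > 0" "b > 0"
  shows "(\<Sum>d | d dvd a * b. f d) = (\<Sum>d | d dvd a. f d) * (\<Sum>d | d dvd b. f d)"
proof -
  have inj: "inj_on (\<lambda>(x,y). x * y) ({d. d dvd a} \<times> {d. d dvd b})"
  proof (rule inj_onI, clarify)
    fix x y x' y' assume *: "x dvd a" "y dvd b" "x' dvd a" "y' dvd b" "x * y = x' * y'"
    have "coprime x y'" "coprime x' y" using * cop by (meson coprime_divisors)+
    have "x dvd x' * y'" using *(5) by (metis dvd_triv_left)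
    hence "x dvd x'" using \<open>coprime x y'\<close> by (simp add: coprime_dvd_mult_left_iff)
    have "x' dvd x * y" using *(5) by (metis dvd_triv_left)
    hence "x' dvd x" using \<open>coprime x' y\<close> by (simp add: coprime_dvd_mult_left_iff)
    with \<open>x dvd x'\<close> have "x = x'" by (rule dvd_antisym)
    moreover have "x > 0" using * ab by (auto intro!: Nat.gr0I)
    ultimately show "x = x' \<and> y = y'" using *(5) by simp
  qed
  have "{d. d dvd a * b} = (\<lambda>(x,y). x * y) ` ({d. d dvd a} \<times> {d. d dvd b})"
    using division_decomp[of _ a b] by (force intro: mult_dvd_mono)
  hence "(\<Sum>d | d dvd a * b. f d) = (\<Sum>(x,y)\<in>{d. d dvd a} \<times> {d. d dvd b}. f (x * y))"
    by (simp only: sum.reindex[OF inj]) (simp add: case_prod_unfold)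
  also have "\<dots> = (\<Sum>d | d dvd a. f d) * (\<Sum>d | d dvd b. f d)"
    by (simp add: mult sum_product sum.cartesian_product)
  finally show ?thesis .
qed

text \<open>The divisor sum is multiplicative. At \<open>p ^ k\<close> it is \<open>k + 1\<close>,
  1, or the indicator of even \<open>k\<close>, according to \<open>f p = 1, 0, -1\<close>; hence it
  is never negative, and at least 1 where all exponents are even.\<close>

lemma sum_divisors_real_character:
  fixes f :: "nat \<Rightarrow> real"
  assumes mult: "\<And>m n. f (m * n) = f m * f n" and f1: "f 1 = 1" and val: "\<And>n. f n \<in> {-1, 0, 1}" and "n > 0"
  shows "(\<Sum>d | d dvd n. f d) \<ge> 0 \<and> ((\<exists>m. n = m\<^sup>2) \<longrightarrow> (\<Sum>d | d dvd n. f d) \<ge> 1)"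
  using \<open>n > 0\<close>
proof (induction n rule: less_induct)
  case (less n)
  show ?case
  proof (cases "n = 1")
    case False
    then obtain p where p: "prime p" "p dvd n" using prime_factor_nat by blast
    define k where "k = multiplicity p n"
    have "\<not> is_unit p" using p(1) not_prime_unit by blast
    moreover have "n \<noteq> 0" using less.prems by simp
    ultimately obtain m where "n = p ^ k * m" "\<not> p dvd m"
      unfolding k_def using multiplicity_decompose'[of n p] by metis
    note km = this k_def
    have "k > 0" using km(1,2) p less.prems by (auto intro!: Nat.gr0I)
    have m0: "m > 0" using km(1) less.prems by (auto intro!: Nat.gr0I)
    have "p ^ k > 1" using p(1) \<open>k > 0\<close> prime_gt_1_nat one_less_power by blast
    hence "m < n" using m0 by (subst km(1)) simp
    have "coprime (p ^ k) m" using km(2) p(1) by (simp add: prime_imp_coprime)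
    hence eq: "(\<Sum>d | d dvd n. f d) = (\<Sum>d | d dvd p ^ k. f d) * (\<Sum>d | d dvd m. f d)"
      unfolding km(1) using p(1) m0 by (intro sum_divisors_coprime_mult[OF mult]) (auto simp: prime_gt_0_nat)
    have pow: "f (p ^ i) = f p ^ i" for i by (induction i) (auto simp: mult f1[simplified])
    have "{d. d dvd p ^ k} = (\<lambda>i. p ^ i) ` {..k}"
      using divides_primepow_nat[OF p(1)] by auto
    moreover have "inj_on (\<lambda>i. p ^ i) {..k}" using prime_gt_1_nat[OF p(1)] by (auto simp: inj_on_def)
    ultimately have "(\<Sum>d | d dvd p ^ k. f d) = (\<Sum>i\<le>k. f p ^ i)"
      by (simp add: sum.reindex pow)
    moreover have "(\<Sum>i\<le>k. (-1::real) ^ i) = (if even k then 1 else 0)" for k by (induction k) auto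
    moreover have "(\<Sum>i\<le>k. (0::real) ^ i) = 1" for k by (induction k) auto
    ultimately have pk: "(\<Sum>d | d dvd p ^ k. f d) \<ge> 0" "even k \<Longrightarrow> (\<Sum>d | d dvd p ^ k. f d) \<ge> 1"
      using val[of p] by auto
    have IH: "(\<Sum>d | d dvd m. f d) \<ge> 0" "(\<exists>j. m = j\<^sup>2) \<Longrightarrow> (\<Sum>d | d dvd m. f d) \<ge> 1"
      using less.IH[OF \<open>m < n\<close> m0] by auto
    have "(\<Sum>d | d dvd n. f d) \<ge> 1" if sq: "n = j\<^sup>2" for j
    proof -
      have "j > 0" using sq less.prems by (auto intro!: Nat.gr0I)
      hence k2: "k = 2 * multiplicity p j"
        using km(3) sq p(1) by (simp add: prime_elem_multiplicity_power_distrib)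
      obtain i where i: "j = p ^ multiplicity p j * i" using multiplicity_dvd[of p j] by blast
      have "n = p ^ k * i\<^sup>2"
        unfolding sq k2 by (subst i) (simp add: power_mult_distrib power_mult[symmetric] mult.commute)
      hence "m = i\<^sup>2" using km(1) p(1) by (auto simp: prime_gt_0_nat)
      thus ?thesis unfolding eq using pk(2) IH(2) k2 mult_mono[of 1 "(\<Sum>d | d dvd p ^ k. f d)" 1 "(\<Sum>d | d dvd m. f d)"] by auto
    qed
    moreover have "(\<Sum>d | d dvd n. f d) \<ge> 0" unfolding eq using pk(1) IH(1) by simp
    ultimately show ?thesis by auto
  qed (use f1 in auto)
qed

text \<open>Landau's argument: if \<open>L(1) = 0\<close>, the Taylor series of \<open>\<zeta>(s) L(s)\<close> about 2 converges at
  \<open>s = 1/2\<close>, and its coefficients dominate those of \<open>\<zeta>(2s)\<close>.\<close>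

lemma L_1_nonzero:
  assumes \<psi>: "real_character q \<psi>"
    and L: "L holomorphic_on {s. Re s > 0}" "\<And>s. Re s > 1 \<Longrightarrow> L s = dirichlet_series \<psi> s"
  shows "L 1 \<noteq> 0"
proof
  assume L1: "L 1 = 0"
  obtain Z where Z: "Z holomorphic_on {s. Re s > 0}" "\<And>s. Re s > 1 \<Longrightarrow> Z s = (s - 1) * dirichlet_series (\<lambda>_. 1) s"
    using zeta_continuation by blast
  \<comment> \<open>The assumed zero makes \<open>V\<close> equal to \<open>L s / (s - 1)\<close>
    with the singularity removed, so \<open>h\<close> continues \<zeta>(s) L(s) across 1 without a
    pole.\<close>
  define V where "V = (\<lambda>z. if z = 1 then deriv L 1 else (L z - L 1) / (z - 1))"
  have V: "V holomorphic_on {s. Re s > 0}"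
    unfolding V_def by (rule pole_lemma[OF L(1)]) (simp add: interior_open open_halfplane)
  define h where "h = (\<lambda>s. Z s * V s)"
  have h: "h holomorphic_on {s. Re s > 0}" unfolding h_def by (intro holomorphic_intros Z V)
  define f where "f = (\<lambda>n. Re (\<psi> n))"
  have \<psi>f: "\<psi> n = of_real (f n)" "f n \<in> {-1, 0, 1}" for n
    using \<psi> by (auto simp: f_def real_character_def complex_eq_iff dest: spec[of _ n])
  have multc: "\<psi> (m * n) = \<psi> m * \<psi> n" "\<psi> 1 = 1" for m n
    using \<psi> by (auto simp: real_character_def dirichlet_character_def)
  have mult: "f (m * n) = f m * f n" "f 1 = 1" for m n
    using multc(1)[of m n] multc(2) unfolding \<psi>f by (simp_all flip: of_real_mult)
  define r where "r = (\<lambda>n. \<Sum>d | d dvd n. f d)"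
  define a where "a = (\<lambda>n. if n = 0 then 0 else complex_of_real (r n))"
  have conv: "a n = (\<Sum>d | d dvd n. \<psi> d * 1)" if "n > 0" for n
    using that by (simp add: a_def r_def \<psi>f)
  have ac: "abs_convergent \<psi>" "abs_convergent (\<lambda>_. 1)"
    by (auto intro!: abs_convergent_bounded norm_real_character_le[OF \<psi>])
  have aca: "abs_convergent a" by (rule abs_convergent_convolution[OF ac conv])
  have h_eq: "h s = dirichlet_series a s" if "Re s > 1" for s
  proof -
    have "s \<noteq> 1" using that by auto
    have "dirichlet_series a s = dirichlet_series \<psi> s * dirichlet_series (\<lambda>_. 1) s"
      by (rule dirichlet_series_mult[OF ac that conv])
    thus ?thesis using that L(2)[OF that] Z(2)[OF that] \<open>s \<noteq> 1\<close> by (simp add: h_def V_def L1)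
  qed
  \<comment> \<open>At \<open>s = 1/2\<close> the signs of \<open>(1/2 - 2) ^ k\<close> and of
    \<open>(- ln n) ^ k\<close> cancel, so every term of the double series is nonnegative.\<close>
  have coeff: "(\<lambda>n. a n * of_real (3/2 * ln (real n)) ^ k / fact k * of_nat n powr (-2)) sums
      ((deriv ^^ k) h 2 / fact k * (1/2 - 2) ^ k)" for k
  proof -
    have "(deriv ^^ k) h 2 = (deriv ^^ k) (dirichlet_series a) 2"
      by (rule higher_deriv_cong_ev)
         (use h_eq eventually_nhds_in_open[OF open_halfplane[of 1], of 2] in \<open>auto elim!: eventually_mono\<close>)
    moreover have "(\<lambda>n. a n * (-of_real (ln (real n))) ^ k * of_nat n powr (-2)) sums (deriv ^^ k) (dirichlet_series a) 2"
      by (rule higher_deriv_dirichlet_series[OF aca]) auto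
    ultimately have "(\<lambda>n. (1 / fact k * (1/2 - 2) ^ k) * (a n * (-of_real (ln (real n))) ^ k * of_nat n powr (-2))) sums
        ((1 / fact k * (1/2 - 2) ^ k) * (deriv ^^ k) h 2)"
      by (intro sums_mult) simp
    moreover have "(1/2 - 2 :: complex) ^ k * (-of_real x) ^ k = of_real (3/2 * x) ^ k" for x :: real
      unfolding power_mult_distrib[symmetric] by simp
    hence eq: "(1 / fact k * (1/2 - 2) ^ k) * (a n * (-of_real (ln (real n))) ^ k * of_nat n powr (-2)) =
        a n * of_real (3/2 * ln (real n)) ^ k / fact k * of_nat n powr (-2)" for n
      by (simp only: mult_ac times_divide_eq_left times_divide_eq_right mult_1_left) (simp add: mult_ac)
    ultimately show ?thesis unfolding eq by (simp add: mult_ac)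
  qed
  have ps: "(\<lambda>k. (deriv ^^ k) h 2 / fact k * (1/2 - 2) ^ k) sums h (1/2)"
  proof (rule holomorphic_power_series)
    have "Re z > 0" if "z \<in> ball 2 2" for z
      using that abs_Re_le_cmod[of "2 - z"] by (auto simp: dist_norm abs_le_iff)
    thus "h holomorphic_on ball 2 2" by (intro holomorphic_on_subset[OF h]) auto
  qed (simp add: dist_norm)
  define b where "b = (\<lambda>n k. (if n = 0 then 0 else r n) * (3/2 * ln (real n)) ^ k / fact k * real n powr (-2))"
  have b_eq: "a n * of_real (3/2 * ln (real n)) ^ k / fact k * of_nat n powr (-2) = of_real (b n k)" for n k
  proof -
    have "(of_nat n :: complex) powr (-2) = of_real (real n powr (-2))"
      using powr_of_real[of "real n" "-2"] by simp
    thus ?thesis by (simp add: b_def a_def)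
  qed
  have r0: "r n \<ge> 0" if "n > 0" for n
    using sum_divisors_real_character[OF mult \<psi>f(2) that] by (simp add: r_def)
  have b0: "b n k \<ge> 0" for n k
    unfolding b_def using r0[of n] by (cases "n = 0") (auto intro!: mult_nonneg_nonneg divide_nonneg_nonneg)
  have bs: "b n sums (if n = 0 then 0 else r n * real n powr (-1/2))" for n
  proof (cases "n = 0")
    case False
    \<comment> \<open>Summing over \<open>k\<close> first turns \<open>n powr (-2)\<close> into
      \<open>n powr (-1/2)\<close>, as in the Dirichlet series at 1/2.\<close>
    have "(\<lambda>k. (3/2 * ln (real n)) ^ k /\<^sub>R fact k) sums exp (3/2 * ln (real n))" by (rule exp_converges)
    hence "(\<lambda>k. (r n * real n powr (-2)) * ((3/2 * ln (real n)) ^ k /\<^sub>R fact k)) sums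
        ((r n * real n powr (-2)) * exp (3/2 * ln (real n)))" by (rule sums_mult)
    moreover have "exp (3/2 * ln (real n)) = real n powr (3/2)" using False by (simp add: powr_def)
    moreover have "real n powr (-2) * real n powr (3/2) = real n powr (-1/2)"
      by (simp flip: powr_add)
    ultimately show ?thesis using False by (simp add: b_def field_simps) 
  qed (simp add: b_def[abs_def])
  have bound: "(\<Sum>n<M. if n = 0 then 0 else r n * real n powr (-1/2)) \<le> Re (h (1/2))" for M
  proof -
    have "(\<lambda>k. \<Sum>n<M. b n k) sums (\<Sum>n<M. if n = 0 then 0 else r n * real n powr (-1/2))"
      by (intro sums_sum bs)
    moreover have "(\<lambda>k. Re ((deriv ^^ k) h 2 / fact k * (1/2 - 2) ^ k)) sums Re (h (1/2))"
      by (rule sums_Re[OF ps])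
    moreover have "(\<Sum>n<M. b n k) \<le> Re ((deriv ^^ k) h 2 / fact k * (1/2 - 2) ^ k)" for k
    proof -
      have "(\<lambda>n. b n k) sums Re ((deriv ^^ k) h 2 / fact k * (1/2 - 2) ^ k)"
        using sums_Re[OF coeff[of k]] unfolding b_eq by simp
      thus ?thesis using b0 by (intro sum_le_suminf[of "\<lambda>n. b n k", THEN order.trans]) (auto simp: sums_iff)
    qed
    ultimately show ?thesis by (rule sums_le[rotated])
  qed
  \<comment> \<open>The squares alone contribute the harmonic series, which is unbounded.\<close>
  have "(\<Sum>m=1..M. 1 / real m) \<le> Re (h (1/2))" for M
  proof -
    have "(\<Sum>m=1..M. 1 / real m) \<le> (\<Sum>m=1..M. (\<lambda>n. if n = 0 then 0 else r n * real n powr (-1/2)) (m\<^sup>2))"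
    proof (rule sum_mono)
      fix m assume m: "m \<in> {1..M}"
      hence "r (m\<^sup>2) \<ge> 1" using sum_divisors_real_character[OF mult \<psi>f(2), of "m\<^sup>2"] by (auto simp: r_def)
      moreover have "real (m\<^sup>2) powr (-1/2) = 1 / real m"
      proof -
        have "real (m\<^sup>2) = real m powr 2" using m by simp
        hence "real (m\<^sup>2) powr (-1/2) = real m powr (-1)" by (simp only: powr_powr) simp
        thus ?thesis using m by (simp add: powr_minus_divide)
      qed
      ultimately show "1 / real m \<le> (if m\<^sup>2 = 0 then 0 else r (m\<^sup>2) * real (m\<^sup>2) powr (-1/2))"
        using m by (simp add: divide_right_mono)
    qed
    also have "\<dots> = (\<Sum>n\<in>(\<lambda>m. m\<^sup>2) ` {1..M}. if n = 0 then 0 else r n * real n powr (-1/2))"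
      by (subst sum.reindex) (auto simp: inj_on_def)
    also have "\<dots> \<le> (\<Sum>n<Suc (M\<^sup>2). if n = 0 then 0 else r n * real n powr (-1/2))"
      by (rule sum_mono2) (auto simp: less_Suc_eq_le power_mono r0)
    also have "\<dots> \<le> Re (h (1/2))" by (rule bound)
    finally show ?thesis .
  qed
  hence "harm M \<le> Re (h (1/2))" for M by (simp add: harm_def inverse_eq_divide)
  moreover have "filterlim (harm :: nat \<Rightarrow> real) at_top sequentially" by (rule harm_at_top)
  then obtain M where "harm M > Re (h (1/2))"
    by (metis (no_types, lifting) eventually_at_top_linorder filterlim_at_top_dense order_refl)
  ultimately show False by (meson not_le)
qed

subsection \<open>Moments of the von Mangoldt function\<close>

text \<open>Up to sign, the \<open>k\<close>-th Taylor coefficient at 3 of the series with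
  coefficients \<open>f n * mangoldt n\<close>. The weight has its mass near
  \<open>ln n = k / 2\<close>, so a \<open>k\<close> of order \<open>ln (ln Q)\<close> sees primes
  up to a power of \<open>ln Q\<close>.\<close>

definition vm_moment :: "nat \<Rightarrow> (nat \<Rightarrow> real) \<Rightarrow> real" where
  "vm_moment k f = (\<Sum>n. f n * mangoldt n * ln (real n) ^ k / fact k * real n powr (-3))"

lemma vm_moment_sums:
  assumes le: "\<And>n. \<bar>f n\<bar> \<le> 1"
  shows "(\<lambda>n. f n * mangoldt n * ln (real n) ^ k / fact k * real n powr (-3)) sums vm_moment k f"
    and "of_real (vm_moment k f) = (-1) ^ k * (deriv ^^ k) (dirichlet_series (\<lambda>n. of_real (f n) * mangoldt n)) 3 / fact k"
proof -
  have "abs_convergent (\<lambda>n. of_real (f n) * mangoldt n)"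
    by (rule abs_convergent_mangoldt) (use le in auto)
  from higher_deriv_dirichlet_series[OF this, of 3 k]
  have "(\<lambda>n. (-1) ^ k / fact k * (of_real (f n) * mangoldt n * (-of_real (ln (real n))) ^ k * of_nat n powr (-3))) sums
     ((-1) ^ k / fact k * (deriv ^^ k) (dirichlet_series (\<lambda>n. of_real (f n) * mangoldt n)) 3)"
    by (intro sums_mult) simp
  moreover have eq: "(-1) ^ k / fact k * (of_real (f n) * mangoldt n * (-of_real (ln (real n))) ^ k * of_nat n powr (-3)) =
      complex_of_real (f n * mangoldt n * ln (real n) ^ k / fact k * real n powr (-3))" for n
  proof -
    have "(of_nat n :: complex) powr (-3) = of_real (real n powr (-3))"
      using powr_of_real[of "real n" "-3"] by simp
    moreover have "(-1) ^ k * (-of_real (ln (real n))) ^ k = (of_real (ln (real n)) ^ k :: complex)"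
      unfolding power_mult_distrib[symmetric] by simp
    ultimately show ?thesis by (simp add: field_simps)
  qed
  ultimately have *: "(\<lambda>n. complex_of_real (f n * mangoldt n * ln (real n) ^ k / fact k * real n powr (-3))) sums
     ((-1) ^ k * (deriv ^^ k) (dirichlet_series (\<lambda>n. of_real (f n) * mangoldt n)) 3 / fact k)" (is "_ sums ?S")
    unfolding eq by simp
  from sums_Re[OF this] show s: "(\<lambda>n. f n * mangoldt n * ln (real n) ^ k / fact k * real n powr (-3)) sums vm_moment k f"
    unfolding Re_complex_of_real vm_moment_def by (simp add: sums_iff)
  from sums_of_real[OF this] * show "of_real (vm_moment k f) = ?S" by (rule sums_unique2)
qed

lemma higher_deriv_simple_pole:
  assumes "Re z > 1"
  shows "(deriv ^^ k) (\<lambda>s. c / (s - 1)) z = c * (-1) ^ k * fact k / (z - 1) ^ Suc k"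
  using assms
proof (induction k arbitrary: z)
  case (Suc k)
  have nz: "z \<noteq> 1" using Suc.prems by auto
  have "deriv ((deriv ^^ k) (\<lambda>s. c / (s - 1))) z = deriv (\<lambda>z. c * (-1) ^ k * fact k / (z - 1) ^ Suc k) z"
    by (rule deriv_cong_ev)
       (use Suc.IH eventually_nhds_in_open[OF open_halfplane[of 1], of z] Suc.prems in \<open>auto elim!: eventually_mono\<close>)
  also have "\<dots> = c * (-1) ^ Suc k * fact (Suc k) / (z - 1) ^ Suc (Suc k)"
  proof (rule DERIV_imp_deriv)
    have "((\<lambda>z. c * (-1) ^ k * fact k / (z - 1) ^ Suc k) has_field_derivative
        (0 * (z - 1) ^ Suc k - c * (-1) ^ k * fact k * (of_nat (Suc k) * (z - 1) ^ k)) / ((z - 1) ^ Suc k * (z - 1) ^ Suc k)) (at z)"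
    proof (intro DERIV_divide DERIV_const)
      have "((\<lambda>z. z - 1) has_field_derivative 1) (at z)" by (auto intro!: derivative_eq_intros)
      from DERIV_power[OF this, where n = "Suc k"]
      show "((\<lambda>z. (z - 1) ^ Suc k) has_field_derivative of_nat (Suc k) * (z - 1) ^ k) (at z)" by simp
    qed (use nz in auto)
    also have "(0 * (z - 1) ^ Suc k - c * (-1) ^ k * fact k * (of_nat (Suc k) * (z - 1) ^ k)) / ((z - 1) ^ Suc k * (z - 1) ^ Suc k)
        = c * (-1) ^ Suc k * fact (Suc k) / (z - 1) ^ Suc (Suc k)"
      using nz by (simp add: divide_simps)
    finally show "((\<lambda>z. c * (-1) ^ k * fact k / (z - 1) ^ Suc k) has_field_derivative
        c * (-1) ^ Suc k * fact (Suc k) / (z - 1) ^ Suc (Suc k)) (at z)" .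
  qed
  finally show ?case by simp
qed simp

lemma ball_3_halfplane: "z \<in> ball 3 (5/2) \<Longrightarrow> Re z > 1/2" "z \<in> ball (3::complex) (5/2) \<Longrightarrow> norm z \<le> 6"
proof -
  assume z: "z \<in> ball 3 (5/2)"
  have "\<bar>Re (3 - z)\<bar> < 5/2" using z abs_Re_le_cmod[of "3 - z"] by (simp add: dist_norm)
  hence "Re (3 - z) < 5/2" using abs_ge_self[of "Re (3 - z)"] by (rule order.strict_trans1[rotated])
  thus "Re z > 1/2" by simp
  have "norm (z - 3) < 5/2" using z by (simp add: dist_norm norm_minus_commute)
  thus "norm z \<le> 6" using norm_triangle_ineq2[of z 3] by simp
qed

text \<open>The pole contributes \<open>c / 2 ^ Suc k\<close>, since 1 has distance 2 from the
  centre; the rest is controlled by the zero-free disc. The factor 2 in \<open>ln (2 * B)\<close>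
  comes from \<open>norm (W 3) \<ge> 1/2\<close>, which makes \<open>2 * B\<close> a bound for the
  ratio to the value at the centre.\<close>

lemma vm_moment_bound:
  assumes W: "W holomorphic_on {s. Re s > 0}" and nz: "\<And>s. Re s > 1/2 \<Longrightarrow> W s \<noteq> 0"
    and le: "\<And>s. Re s \<ge> 1/2 \<Longrightarrow> norm s \<le> 6 \<Longrightarrow> norm (W s) \<le> B" and W3: "norm (W 3) \<ge> 1/2"
    and eq: "\<And>s. Re s > 1 \<Longrightarrow> dirichlet_series (\<lambda>n. of_real (f n) * mangoldt n) s = of_real c / (s - 1) - deriv W s / W s"
    and f: "\<And>n. \<bar>f n\<bar> \<le> 1"
  shows "\<bar>vm_moment k f - c / 2 ^ Suc k\<bar> \<le> 18 * (ln (2 * B) + 1) * (real k + 1) * (4/9) ^ k"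
proof -
  define H where "H = (\<lambda>s. deriv W s / W s)"
  have "norm (W 3) \<le> B" by (rule le) auto
  hence B: "B \<ge> 0" using W3 by linarith
  have "H holomorphic_on {s. Re s > 1}"
  proof -
    have "W holomorphic_on {s. Re s > 1}" by (rule holomorphic_on_subset[OF W]) auto
    thus ?thesis unfolding H_def using nz by (intro holomorphic_intros holomorphic_deriv open_halfplane) auto
  qed
  have "(deriv ^^ k) (dirichlet_series (\<lambda>n. of_real (f n) * mangoldt n)) 3 =
      (deriv ^^ k) (\<lambda>s. of_real c / (s - 1) - H s) 3"
    by (rule higher_deriv_cong_ev)
       (use eq eventually_nhds_in_open[OF open_halfplane[of 1], of 3] in \<open>auto elim!: eventually_mono simp: H_def\<close>)
  also have "\<dots> = (deriv ^^ k) (\<lambda>s. of_real c / (s - 1)) 3 - (deriv ^^ k) H 3"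
    by (rule higher_deriv_diff[OF _ \<open>H holomorphic_on _\<close> open_halfplane]) (auto intro!: holomorphic_intros)
  also have "(deriv ^^ k) (\<lambda>s. of_real c / (s - 1)) 3 = complex_of_real c * (-1) ^ k * fact k / 2 ^ Suc k"
    by (subst higher_deriv_simple_pole) auto
  finally have d: "(deriv ^^ k) (dirichlet_series (\<lambda>n. of_real (f n) * mangoldt n)) 3 =
      of_real c * (-1) ^ k * fact k / 2 ^ Suc k - (deriv ^^ k) H 3" .
  have "complex_of_real (vm_moment k f - c / 2 ^ Suc k) = - ((-1) ^ k * (deriv ^^ k) H 3 / fact k)"
  proof -
    have "(-1) ^ k * (of_real c * (-1) ^ k * fact k / 2 ^ Suc k - (deriv ^^ k) H 3) / fact k =
       ((-1) ^ k * (-1) ^ k) * of_real c / 2 ^ Suc k - (-1) ^ k * (deriv ^^ k) H 3 / fact k"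
      by (simp add: field_simps)
    also have "((-1) ^ k * (-1) ^ k :: complex) = 1" by (simp flip: power_mult_distrib)
    finally show ?thesis using vm_moment_sums(2)[OF f, of k] d by simp
  qed
  hence "norm (complex_of_real (vm_moment k f - c / 2 ^ Suc k)) = norm ((deriv ^^ k) H 3) / fact k"
    by (simp only: norm_minus_cancel norm_divide norm_mult norm_power norm_fact) simp
  hence "\<bar>vm_moment k f - c / 2 ^ Suc k\<bar> = norm ((deriv ^^ k) H 3) / fact k"
    by (simp only: norm_of_real)
  also have "\<dots> \<le> (fact (Suc k) * (18 * (ln (2 * B) + 1)) / (9/4) ^ Suc k) / fact k"
  proof (rule divide_right_mono)
    show "norm ((deriv ^^ k) H 3) \<le> fact (Suc k) * (18 * (ln (2 * B) + 1)) / (9/4) ^ Suc k"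
      unfolding H_def
    proof (rule log_deriv_coefficient_bound)
      show "W holomorphic_on ball 3 (5/2)"
        by (rule holomorphic_on_subset[OF W]) (use ball_3_halfplane(1) in force)
      show "W w \<noteq> 0" if "w \<in> ball 3 (5/2)" for w using ball_3_halfplane[OF that] nz by auto
      fix w :: complex assume "w \<in> ball 3 (5/2)"
      hence "norm (W w) \<le> B" using ball_3_halfplane[of w] le[of w] by simp
      also have "B \<le> 2 * B * norm (W 3)" using mult_left_mono[OF W3 B] by simp
      finally show "norm (W w) \<le> 2 * B * norm (W 3)" .
    qed
  qed simp
  also have "\<dots> = 18 * (ln (2 * B) + 1) * (real k + 1) * (4/9) ^ Suc k"
    by (simp add: field_simps power_divide)
  also have "\<dots> \<le> 18 * (ln (2 * B) + 1) * (real k + 1) * (4/9) ^ k"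
  proof (rule mult_left_mono)
    have "1/2 \<le> B" using \<open>norm (W 3) \<le> B\<close> W3 by linarith
    thus "0 \<le> 18 * (ln (2 * B) + 1) * (real k + 1)" by simp
  qed simp
  finally show ?thesis .
qed

lemma three_halves_sum_ge_1: "three_halves_sum \<ge> 1"
proof -
  have "(\<Sum>n\<in>{0}. real (Suc n) powr (-3/2)) \<le> three_halves_sum"
    unfolding three_halves_sum_def
    by (rule sum_le_suminf) (use summable_Suc_powr[of "1/2"] in auto)
  thus ?thesis by simp
qed

lemma L_function_sums_iff:
  "(\<lambda>n. \<psi> (Suc n) / of_nat (Suc n) powr s) sums S \<longleftrightarrow> (\<lambda>n. \<psi> n * of_nat n powr (-s)) sums (S :: complex)"
  using sums_Suc_iff[of "\<lambda>n. \<psi> n * of_nat n powr (-s)" S]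
  by (simp add: powr_minus_divide del: of_nat_Suc)

text \<open>The base 33/32 turns the rate 4/9 into \<open>33/32 * 4/9 = 11/24\<close>, which is
  still below 1/2.\<close>

lemma linear_le_geometric: "real k + 1 \<le> 32 * (33/32) ^ k"
  using Bernoulli_inequality[of "1/32 :: real" k] by simp

lemma vm_moment_bound_geometric:
  assumes "x \<le> A * (real k + 1) * (4/9) ^ k" "A \<ge> 0"
  shows "x \<le> 32 * A * (11/24) ^ k"
proof -
  have "A * (real k + 1) * (4/9) ^ k \<le> A * (32 * (33/32) ^ k) * (4/9) ^ k"
    by (intro mult_right_mono mult_left_mono linear_le_geometric assms) auto
  also have "\<dots> = 32 * A * ((33/32) * (4/9)) ^ k" unfolding power_mult_distrib by simp
  finally show ?thesis using assms(1) by simp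
qed

section \<open>Moments under the Extended Riemann Hypothesis\<close>

context
  assumes ERH: extended_riemann_hypothesis
begin

text \<open>Three regions are combined: the Dirichlet series for Re s > 1, the inequality with 3, 4,
  1 and the value \<open>Z 1 = 1\<close> on the line, and the hypothesis in the open strip. The
  constant 49 is \<open>(6 + 1)\<^sup>2\<close>, from \<open>norm s \<le> 6\<close>.\<close>

lemma zeta_function_facts:
  obtains Z where "Z holomorphic_on {s. Re s > 0}" "Z 1 = 1" "\<And>s. Re s > 1/2 \<Longrightarrow> Z s \<noteq> 0"
    "\<And>s. Re s > 1 \<Longrightarrow> dirichlet_series mangoldt s = 1 / (s - 1) - deriv Z s / Z s"
    "norm (Z 3) \<ge> 1/2"
    "\<And>s. Re s \<ge> 1/2 \<Longrightarrow> norm s \<le> 6 \<Longrightarrow> norm (Z s) \<le> 1 + 49 * three_halves_sum"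
proof -
  obtain Z where Z: "Z holomorphic_on {s. Re s > 0}" "\<And>s. Re s > 1 \<Longrightarrow> Z s = (s - 1) * dirichlet_series (\<lambda>_. 1) s"
    "\<And>s. Re s \<ge> 1/2 \<Longrightarrow> norm (Z s) \<le> 1 + (norm s + 1)\<^sup>2 * three_halves_sum" "Z 1 = 1"
    using zeta_continuation by blast
  define \<zeta> where "\<zeta> = dirichlet_series (\<lambda>_. 1)"
  have ac: "abs_convergent (\<lambda>_. 1)" by (rule abs_convergent_bounded) auto
  have \<zeta>nz: "\<zeta> s \<noteq> 0" if "Re s > 1" for s
    unfolding \<zeta>_def by (rule completely_multiplicative_series_nonzero) (use that in auto)
  have Zeq: "dirichlet_series mangoldt s = 1 / (s - 1) - deriv Z s / Z s" if s: "Re s > 1" for s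
  proof -
    have s1: "s \<noteq> 1" using s by auto
    have "(\<zeta> has_field_derivative deriv \<zeta> s) (at s)"
      unfolding \<zeta>_def by (rule holomorphic_derivI[OF dirichlet_series_holomorphic[OF ac] open_halfplane]) (use s in auto)
    hence "((\<lambda>s. (s - 1) * \<zeta> s) has_field_derivative (\<zeta> s + (s - 1) * deriv \<zeta> s)) (at s)"
      by (auto intro!: derivative_eq_intros)
    hence "(Z has_field_derivative (\<zeta> s + (s - 1) * deriv \<zeta> s)) (at s)"
      by (rule has_field_derivative_transform_within_open[OF _ open_halfplane[of 1]]) (use s Z(2) in \<open>auto simp: \<zeta>_def\<close>)
    hence "deriv Z s = \<zeta> s + (s - 1) * deriv \<zeta> s" by (rule DERIV_imp_deriv)
    moreover have "deriv \<zeta> s = - dirichlet_series mangoldt s * \<zeta> s"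
      unfolding \<zeta>_def using deriv_completely_multiplicative_series[of "\<lambda>_. 1" s] s by simp
    ultimately have "deriv Z s = (1 - (s - 1) * dirichlet_series mangoldt s) * \<zeta> s" by (simp add: algebra_simps)
    moreover have "Z s = (s - 1) * \<zeta> s" using Z(2)[OF s] by (simp add: \<zeta>_def)
    ultimately have "deriv Z s / Z s = (1 - (s - 1) * dirichlet_series mangoldt s) / (s - 1)"
      using \<zeta>nz[OF s] by simp
    thus ?thesis using s1 by (simp add: diff_divide_distrib)
  qed
  have Z3: "Z 3 = 2 * \<zeta> 3" using Z(2)[of 3] by (simp add: \<zeta>_def)
  have n3: "norm (\<zeta> 3) \<ge> 1/2" unfolding \<zeta>_def by (rule dirichlet_series_3_ge) auto
  have nz: "Z s \<noteq> 0" if s: "Re s > 1/2" for s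
  proof (cases "Re s" "1::real" rule: linorder_cases)
    case greater
    thus ?thesis using Z(2)[OF greater] \<zeta>nz[OF greater] by (auto simp: \<zeta>_def)
  next
    case equal
    show ?thesis
    proof (cases "Im s = 0")
      case True
      hence "s = 1" using equal by (simp add: complex_eq_iff)
      thus ?thesis using Z(4) by simp
    next
      case False
      have "Z (Complex 1 (Im s)) \<noteq> 0"
        by (rule nonzero_on_line[OF Z(1,4) Zeq Z(1), where \<psi> = "\<lambda>_. 1" and c = 1])
           (use Zeq Z3 n3 False in auto)
      moreover have "Complex 1 (Im s) = s" using equal by (simp add: complex_eq_iff)
      ultimately show ?thesis by simp
    qed
  next
    case less
    \<comment> \<open>Dividing by \<open>s - 1\<close> gives the L-function of the character modulo
      1; the point 1 is excluded from the domain on which the hypothesis wants it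
      holomorphic.\<close>
    define L where "L = (\<lambda>s. Z s / (s - 1))"
    have "dirichlet_character 1 (\<lambda>_. 1)" by (simp add: dirichlet_character_def)
    moreover have "dirichlet_L_function (\<lambda>_. 1) L"
      unfolding dirichlet_L_function_def
    proof (intro conjI allI impI)
      show "L holomorphic_on {s. 0 < Re s} - {1}"
        unfolding L_def by (intro holomorphic_intros holomorphic_on_subset[OF Z(1)]) auto
      fix s assume s: "Re s > 1"
      have "s \<noteq> 1" using s by auto
      hence "L s = \<zeta> s" using Z(2)[OF s] by (simp add: L_def \<zeta>_def)
      thus "(\<lambda>n. 1 / of_nat (Suc n) powr s) sums L s"
        unfolding \<zeta>_def L_function_sums_iff[of "\<lambda>_. 1"] using dirichlet_series_sums[OF ac s] by simp
    qed
    ultimately have "L s \<noteq> 0"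
      using ERH s less unfolding extended_riemann_hypothesis_def by force
    thus ?thesis by (auto simp: L_def)
  qed
  have "norm (Z s) \<le> 1 + 49 * three_halves_sum" if "Re s \<ge> 1/2" "norm s \<le> 6" for s
  proof -
    have "(norm s + 1)\<^sup>2 \<le> 7\<^sup>2" using that by (intro power_mono) auto
    hence "(norm s + 1)\<^sup>2 * three_halves_sum \<le> 49 * three_halves_sum"
      using three_halves_sum_ge_1 by (intro mult_right_mono) auto
    thus ?thesis using Z(3)[OF that(1)] by linarith
  qed
  thus ?thesis using that[OF Z(1,4) nz Zeq] Z3 n3 by (simp add: norm_mult)
qed

lemma zeta_moment:
  "\<exists>C\<ge>0. \<forall>k. \<bar>vm_moment k (\<lambda>_. 1) - 1 / 2 ^ Suc k\<bar> \<le> C * (11/24) ^ k"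
proof -
  obtain Z where Z: "Z holomorphic_on {s. Re s > 0}" "Z 1 = 1" "\<And>s. Re s > 1/2 \<Longrightarrow> Z s \<noteq> 0"
    "\<And>s. Re s > 1 \<Longrightarrow> dirichlet_series mangoldt s = 1 / (s - 1) - deriv Z s / Z s"
    "norm (Z 3) \<ge> 1/2"
    "\<And>s. Re s \<ge> 1/2 \<Longrightarrow> norm s \<le> 6 \<Longrightarrow> norm (Z s) \<le> 1 + 49 * three_halves_sum"
    by (rule zeta_function_facts) blast
  define A where "A = 18 * (ln (2 * (1 + 49 * three_halves_sum)) + 1)"
  have A: "A \<ge> 0" unfolding A_def using three_halves_sum_ge_1 by (auto intro!: add_nonneg_nonneg ln_ge_zero)
  have "\<bar>vm_moment k (\<lambda>_. 1) - 1 / 2 ^ Suc k\<bar> \<le> A * (real k + 1) * (4/9) ^ k" for k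
    unfolding A_def by (rule vm_moment_bound[OF Z(1,3,6,5)]) (use Z(4) in auto)
  thus ?thesis using A by (intro exI[of _ "32 * A"]) (auto intro!: vm_moment_bound_geometric)
qed

text \<open>The constant must not depend on the character; the modulus enters only through
  \<open>ln q\<close>, from the bound on the L-function. There is no pole and hence no main term. On
  the line Re s = 1, the point 1 is covered by Landau's argument.\<close>

lemma character_moment:
  "\<exists>C\<ge>0. \<forall>q \<psi> k. real_character q \<psi> \<and> nonprincipal q \<psi> \<longrightarrow>
     \<bar>vm_moment k (\<lambda>n. Re (\<psi> n))\<bar> \<le> C * (1 + ln (real q)) * (11/24) ^ k"
proof -
  obtain Z where Z: "Z holomorphic_on {s. Re s > 0}" "Z 1 = 1"
    "\<And>s. Re s > 1 \<Longrightarrow> dirichlet_series mangoldt s = 1 / (s - 1) - deriv Z s / Z s"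
    by (rule zeta_function_facts) blast
  define a where "a = ln (98 * three_halves_sum)"
  have a: "a \<ge> 0" unfolding a_def using three_halves_sum_ge_1 by (intro ln_ge_zero) auto
  have "\<bar>vm_moment k (\<lambda>n. Re (\<psi> n))\<bar> \<le> 32 * (18 * (a + 1)) * (1 + ln (real q)) * (11/24) ^ k"
    if \<psi>: "real_character q \<psi>" "nonprincipal q \<psi>" for q \<psi> k
  proof -
    obtain L where L: "L holomorphic_on {s. Re s > 0}" "\<And>s. Re s > 1 \<Longrightarrow> L s = dirichlet_series \<psi> s"
      "\<And>s. Re s \<ge> 1/2 \<Longrightarrow> norm (L s) \<le> real q * (norm s + 1)\<^sup>2 * three_halves_sum"
      using L_function_continuation[OF \<psi>] by blast
    have dc: "dirichlet_character q \<psi>" and val: "\<And>n. \<psi> n \<in> {-1, 0, 1}" using \<psi> by (auto simp: real_character_def)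
    have mult: "\<psi> (m * n) = \<psi> m * \<psi> n" "\<psi> 1 = 1" for m n using dc by (auto simp: dirichlet_character_def)
    have q: "q > 1" by (rule nonprincipal_modulus_gt_1[OF dc \<psi>(2)])
    have le1: "norm (\<psi> n) \<le> 1" for n by (rule norm_real_character_le[OF \<psi>(1)])
    have ac: "abs_convergent \<psi>" by (rule abs_convergent_bounded[OF le1])
    have Lnz: "L s \<noteq> 0" if "Re s > 1" for s
      using completely_multiplicative_series_nonzero[OF le1 mult that] L(2)[OF that] by simp
    have Leq: "dirichlet_series (\<lambda>n. \<psi> n * mangoldt n) s = 0 / (s - 1) - deriv L s / L s" if s: "Re s > 1" for s
    proof -
      have "deriv L s = deriv (dirichlet_series \<psi>) s"
        by (rule deriv_cong_ev)
           (use L(2) eventually_nhds_in_open[OF open_halfplane[of 1], of s] s in \<open>auto elim!: eventually_mono\<close>)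
      also have "\<dots> = - dirichlet_series (\<lambda>n. \<psi> n * mangoldt n) s * L s"
        using deriv_completely_multiplicative_series[OF le1 mult(1) s] L(2)[OF s] by simp
      finally show ?thesis using Lnz[OF s] by simp
    qed
    have L3: "norm (L 3) \<ge> 1/2" using dirichlet_series_3_ge[of \<psi>, OF le1 mult(2)] L(2)[of 3] by simp
    have nz: "L s \<noteq> 0" if s: "Re s > 1/2" for s
    proof (cases "Re s" "1::real" rule: linorder_cases)
      case greater
      thus ?thesis by (rule Lnz)
    next
      case equal
      show ?thesis
      proof (cases "Im s = 0")
        case True
        hence "s = 1" using equal by (simp add: complex_eq_iff)
        thus ?thesis using L_1_nonzero[OF \<psi>(1) L(1,2)] by simp
      next
        case False
        have "L (Complex 1 (Im s)) \<noteq> 0"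
          by (rule nonzero_on_line[OF Z L(1) _ Leq]) (use val False L3 in auto)
        moreover have "Complex 1 (Im s) = s" using equal by (simp add: complex_eq_iff)
        ultimately show ?thesis by simp
      qed
    next
      case less
      have "dirichlet_L_function \<psi> L"
        unfolding dirichlet_L_function_def L_function_sums_iff
        using L(1,2) dirichlet_series_sums[OF ac] by (auto intro!: holomorphic_on_subset[OF L(1)])
      thus ?thesis using ERH dc s less unfolding extended_riemann_hypothesis_def by force
    qed
    have le: "norm (L s) \<le> real q * 49 * three_halves_sum" if "Re s \<ge> 1/2" "norm s \<le> 6" for s
    proof -
      have "(norm s + 1)\<^sup>2 \<le> 7\<^sup>2" using that by (intro power_mono) auto
      hence "real q * (norm s + 1)\<^sup>2 * three_halves_sum \<le> real q * 49 * three_halves_sum"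
        using three_halves_sum_ge_1 by (intro mult_right_mono mult_left_mono) auto
      thus ?thesis using L(3)[OF that(1)] by linarith
    qed
    have real: "of_real (Re (\<psi> n)) = \<psi> n" for n using val[of n] by (auto simp: complex_eq_iff)
    have "\<bar>vm_moment k (\<lambda>n. Re (\<psi> n)) - 0 / 2 ^ Suc k\<bar> \<le>
        18 * (ln (2 * (real q * 49 * three_halves_sum)) + 1) * (real k + 1) * (4/9) ^ k"
    proof (rule vm_moment_bound[OF L(1) nz le L3])
      show "dirichlet_series (\<lambda>n. of_real (Re (\<psi> n)) * mangoldt n) s = of_real 0 / (s - 1) - deriv L s / L s"
        if "Re s > 1" for s using Leq[OF that] by (simp add: real)
      show "\<bar>Re (\<psi> n)\<bar> \<le> 1" for n using val[of n] by auto
    qed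
    also have "ln (2 * (real q * 49 * three_halves_sum)) = ln (real q) + a"
    proof -
      have "2 * (real q * 49 * three_halves_sum) = real q * (98 * three_halves_sum)" by simp
      thus ?thesis unfolding a_def using q three_halves_sum_ge_1 by (simp only: ln_mult_pos) 
    qed
    also have "18 * (ln (real q) + a + 1) * (real k + 1) * (4/9) ^ k \<le>
        18 * (a + 1) * (1 + ln (real q)) * (real k + 1) * (4/9) ^ k"
    proof (intro mult_right_mono)
      have "0 \<le> a * ln (real q)" using a q by simp
      thus "18 * (ln (real q) + a + 1) \<le> 18 * (a + 1) * (1 + ln (real q))" by (simp add: algebra_simps)
    qed auto
    finally have "\<bar>vm_moment k (\<lambda>n. Re (\<psi> n))\<bar> \<le> 32 * (18 * (a + 1) * (1 + ln (real q))) * (11/24) ^ k"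
      using a q by (intro vm_moment_bound_geometric) auto
    thus ?thesis by (simp add: mult_ac)
  qed
  thus ?thesis using a by (intro exI[of _ "32 * (18 * (a + 1))"]) auto
qed

end

section \<open>A small prime with prescribed character values\<close>

text \<open>Bounds the weight of the powers of one prime dividing the modulus, where the characters
  give no information. With \<open>x = p powr (-1/2) \<le> 3/4\<close> the geometric series
  \<open>x / (1 - x)\<close> is at most 3.\<close>

lemma prime_power_sum:
  assumes p: "prime p"
  defines "g \<equiv> (\<lambda>n. if \<exists>j. n = p ^ Suc j then ln (real p) * real n powr (-1/2) else 0)"
  shows "summable g" "suminf g \<le> 3 * ln (real p)"
proof -
  define x where "x = real p powr (-1/2)"
  have p2: "real p \<ge> 2" using prime_ge_2_nat[OF p] by simp
  have "x = 1 / sqrt (real p)" using p2 by (simp add: x_def powr_minus_divide powr_half_sqrt)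
  moreover have "4/3 \<le> sqrt (real p)" using p2 by (intro real_le_rsqrt) (simp add: power2_eq_square)
  moreover from this have "1 / sqrt (real p) \<le> 1 / (4/3)" using p2 by (intro divide_left_mono) auto
  ultimately have x: "0 < x" "x \<le> 3/4" using p2 by auto
  have inj: "inj (\<lambda>j. p ^ Suc j)" using prime_gt_1_nat[OF p] by (auto simp: inj_def)
  have pw: "real (p ^ j) powr (-1/2) = x ^ j" for j
    using p2 by (induction j) (auto simp: x_def powr_mult)
  have "(\<lambda>j. x ^ j) sums (1 / (1 - x))" using x by (intro geometric_sums) auto
  hence "(\<lambda>j. ln (real p) * x * x ^ j) sums (ln (real p) * x * (1 / (1 - x)))" by (rule sums_mult)
  hence "((\<lambda>j. ln (real p) * x * x ^ j) has_sum (ln (real p) * x * (1 / (1 - x)))) UNIV"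
    using x p2 by (intro sums_nonneg_imp_has_sum) auto
  also have "(\<lambda>j. ln (real p) * x * x ^ j) = g \<circ> (\<lambda>j. p ^ Suc j)"
    using pw[of "Suc _"] by (auto simp: g_def fun_eq_iff)
  finally have "(g has_sum (ln (real p) * x * (1 / (1 - x)))) (range (\<lambda>j. p ^ Suc j))"
    by (subst has_sum_reindex[OF inj])
  hence "(g has_sum (ln (real p) * x * (1 / (1 - x)))) UNIV"
    by (rule iffD1[OF has_sum_cong_neutral, rotated -1]) (auto simp: g_def)
  hence s: "g sums (ln (real p) * x * (1 / (1 - x)))" by (rule has_sum_imp_sums)
  thus "summable g" by (rule sums_summable)
  have "x * (1 / (1 - x)) \<le> 3" using x by (simp add: field_simps)
  hence "ln (real p) * (x * (1 / (1 - x))) \<le> ln (real p) * 3" using p2 by (intro mult_left_mono) auto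
  thus "suminf g \<le> 3 * ln (real p)" using s by (simp add: sums_iff)
qed

lemma sum_ln_prime_factors_le:
  assumes "Q > 0"
  shows "(\<Sum>p\<in>prime_factors Q. ln (real p)) \<le> ln (real Q)"
proof -
  have pos: "real p > 0" if "p \<in> prime_factors Q" for p
    using that by (auto dest: in_prime_factors_imp_prime prime_gt_0_nat)
  have "(\<Prod>p\<in>prime_factors Q. p) \<le> (\<Prod>p\<in>prime_factors Q. p ^ multiplicity p Q)"
  proof (rule prod_mono)
    fix p assume p: "p \<in> prime_factors Q"
    hence "multiplicity p Q > 0" using assms by (auto simp: prime_factors_multiplicity)
    thus "0 \<le> p \<and> p \<le> p ^ multiplicity p Q" using p
      by (auto intro!: self_le_power dest: in_prime_factors_imp_prime prime_ge_1_nat)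
  qed
  also have "\<dots> = Q" using prime_factorization_nat[of Q] assms by simp
  finally have "real (\<Prod>p\<in>prime_factors Q. p) \<le> real Q" by (simp only: of_nat_le_iff)
  hence "ln (\<Prod>p\<in>prime_factors Q. real p) \<le> ln (real Q)"
    unfolding of_nat_prod using pos by (intro ln_mono) (auto intro!: prod_pos)
  thus ?thesis using pos by (subst ln_prod[symmetric]) force+
qed

text \<open>A single term of the exponential series of \<open>a * ln n\<close>. The free
  \<open>a\<close> trades decay in \<open>k\<close> against growth in \<open>n\<close>.\<close>

lemma ln_power_div_fact_le:
  assumes "n > 0" "a > 0"
  shows "ln (real n) ^ k / fact k \<le> real n powr a / a ^ k"
proof -
  have l: "ln (real n) \<ge> 0" using assms by simp
  have "(a * ln (real n)) ^ k /\<^sub>R fact k \<le> (\<Sum>k. (a * ln (real n)) ^ k /\<^sub>R fact k)"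
    using sum_le_suminf[OF summable_exp_generic[of "a * ln (real n)"], of "{k}"] l assms by auto
  also have "\<dots> = real n powr a"
    using assms sums_unique[OF exp_converges[of "a * ln (real n)"]] by (simp add: powr_def)
  finally show ?thesis using assms by (simp add: field_simps power_mult_distrib)
qed

text \<open>The exponent \<open>a = 24/11\<close> gives the rate 11/24 of the analytic error and
  serves the prime powers not coprime to \<open>Q\<close>. The exponent \<open>a = 1\<close> gives
  up the decay in \<open>k\<close> and serves the tail of large \<open>n\<close>.\<close>

lemma kernel_bounds:
  assumes "n > 0"
  shows "ln (real n) ^ k / fact k * real n powr (-3) \<le> (11/24) ^ k * real n powr (-1/2)"
    and "ln (real n) ^ k / fact k * real n powr (-3) \<le> real n powr (-2)"
proof -
  have n: "real n \<ge> 1" using assms by simp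
  have "ln (real n) ^ k / fact k * real n powr (-3) \<le> real n powr (24/11) / (24/11) ^ k * real n powr (-3)"
    by (intro mult_right_mono ln_power_div_fact_le assms) auto
  also have "\<dots> = (11/24) ^ k * real n powr (24/11 - 3)"
  proof -
    have "real n powr (24/11) * real n powr (-3) = real n powr (24/11 - 3)" by (simp flip: powr_add)
    thus ?thesis by (simp add: power_divide)
  qed
  also have "\<dots> \<le> (11/24) ^ k * real n powr (-1/2)"
    using n by (intro mult_left_mono powr_mono) auto
  finally show "ln (real n) ^ k / fact k * real n powr (-3) \<le> (11/24) ^ k * real n powr (-1/2)" .
  have "ln (real n) ^ k / fact k * real n powr (-3) \<le> real n powr 1 / 1 ^ k * real n powr (-3)"
    by (intro mult_right_mono ln_power_div_fact_le assms) auto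
  also have "\<dots> = real n powr (1 + -3)" by (simp only: powr_add power_one div_by_1)
  finally show "ln (real n) ^ k / fact k * real n powr (-3) \<le> real n powr (-2)" by simp
qed

lemma summable_mangoldt_three_halves: "summable (\<lambda>n. mangoldt n * real n powr (-3/2))"
  using abs_convergent_mangoldt[of "\<lambda>_. 1"] unfolding abs_convergent_def
  by (auto dest!: spec[of _ "3/2"])

text \<open>Prime powers fall into three classes: those sharing a factor with \<open>Q\<close> cost
  a multiple of \<open>ln Q\<close>, those coprime to \<open>Q\<close> and at most \<open>y\<close>
  contribute nothing, and the rest is a tail of size \<open>y powr (-1/2)\<close>. The factor 4
  bounds \<open>f\<close>, and \<open>12 = 4 * 3\<close> by \<open>prime_power_sum\<close>.\<close>

lemma moment_comparison:
  fixes f :: "nat \<Rightarrow> real"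
  assumes f: "\<And>n. 0 \<le> f n \<and> f n \<le> 4" and Q: "Q > 0" and y: "y > 0"
    and zero: "\<And>n. primepow n \<Longrightarrow> coprime n Q \<Longrightarrow> real n \<le> y \<Longrightarrow> f n = 0"
    and sums: "(\<lambda>n. f n * mangoldt n * ln (real n) ^ k / fact k * real n powr (-3)) sums S"
  shows "S \<le> 12 * ln (real Q) * (11/24) ^ k + 4 * (\<Sum>n. mangoldt n * real n powr (-3/2)) * y powr (-1/2)"
proof -
  define g where "g = (\<lambda>p n. if \<exists>j. n = p ^ Suc j then ln (real p) * real n powr (-1/2) else 0)"
  define h where "h = (\<lambda>n. 4 * (11/24) ^ k * (\<Sum>p\<in>prime_factors Q. g p n) +
      4 * y powr (-1/2) * (mangoldt n * real n powr (-3/2)))"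
  have g0: "g p n \<ge> 0" if "p \<in> prime_factors Q" for p n
    using that by (auto simp: g_def dest!: in_prime_factors_imp_prime prime_ge_1_nat)
  have gs: "summable (g p)" "suminf (g p) \<le> 3 * ln (real p)" if "p \<in> prime_factors Q" for p
    using prime_power_sum[of p] that by (auto simp: g_def dest!: in_prime_factors_imp_prime)
  have hs: "h sums (4 * (11/24) ^ k * (\<Sum>p\<in>prime_factors Q. suminf (g p)) +
      4 * y powr (-1/2) * (\<Sum>n. mangoldt n * real n powr (-3/2)))"
    unfolding h_def using gs(1) summable_mangoldt_three_halves
    by (intro sums_add sums_mult sums_sum) (auto simp: summable_sums)
  have "S \<le> 4 * (11/24) ^ k * (\<Sum>p\<in>prime_factors Q. suminf (g p)) +
      4 * y powr (-1/2) * (\<Sum>n. mangoldt n * real n powr (-3/2))"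
  proof (rule sums_le[OF _ sums hs])
    fix n
    have G0: "(\<Sum>p\<in>prime_factors Q. g p n) \<ge> 0" by (intro sum_nonneg g0)
    have h0: "h n \<ge> 0" unfolding h_def using G0 by (auto intro!: add_nonneg_nonneg mult_nonneg_nonneg mangoldt_nonneg)
    show "f n * mangoldt n * ln (real n) ^ k / fact k * real n powr (-3) \<le> h n"
    proof (cases "primepow n")
      case False
      thus ?thesis using h0 by (simp add: mangoldt_def)
    next
      case True
      then obtain p j where pj: "prime p" "j > 0" "n = p ^ j" by (auto simp: primepow_def)
      have n: "n > 0" using True primepow_gt_0_nat by blast
      have mn: "(mangoldt n :: real) = ln (real p)" using pj by simp
      define K where "K = ln (real n) ^ k / fact k * real n powr (-3)"
      have K0: "K \<ge> 0" using n by (simp add: K_def)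
      have lhs: "f n * mangoldt n * ln (real n) ^ k / fact k * real n powr (-3) = f n * (mangoldt n * K)"
        by (simp add: K_def)
      have le4: "f n * (mangoldt n * K) \<le> 4 * (mangoldt n * K)"
        using f[of n] K0 by (intro mult_right_mono) (auto simp: mangoldt_nonneg)
      show ?thesis
      proof (cases "coprime n Q")
        case False
        hence "p dvd Q" using pj by (meson coprime_power_left_iff prime_imp_coprime)
        hence pQ: "p \<in> prime_factors Q" using pj Q by (auto simp: prime_factors_dvd)
        have "\<exists>i. n = p ^ Suc i" using pj by (metis Suc_pred)
        hence gp: "g p n = mangoldt n * real n powr (-1/2)" by (simp add: g_def mn)
        have "g p n \<le> (\<Sum>p\<in>prime_factors Q. g p n)"
          by (rule member_le_sum[OF pQ]) (auto intro: g0)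
        have "mangoldt n * K \<le> mangoldt n * ((11/24) ^ k * real n powr (-1/2))"
          unfolding K_def by (intro mult_left_mono kernel_bounds n mangoldt_nonneg)
        also have "\<dots> = (11/24) ^ k * g p n" by (simp add: gp)
        also have "\<dots> \<le> (11/24) ^ k * (\<Sum>p\<in>prime_factors Q. g p n)"
          by (intro mult_left_mono \<open>g p n \<le> _\<close>) auto
        finally have "4 * (mangoldt n * K) \<le> 4 * (11/24) ^ k * (\<Sum>p\<in>prime_factors Q. g p n)" by simp
        also have "\<dots> \<le> h n" unfolding h_def using mangoldt_nonneg[of n] by simp
        finally show ?thesis unfolding lhs using le4 by linarith
      next
        case cop: True
        show ?thesis
        proof (cases "real n \<le> y")
          case True
          thus ?thesis using zero[OF \<open>primepow n\<close> cop True] h0 by simp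
        next
          case False
          have "K \<le> real n powr (-2)" unfolding K_def by (rule kernel_bounds[OF n])
          also have "\<dots> = real n powr (-1/2) * real n powr (-3/2)" by (simp flip: powr_add)
          also have "\<dots> \<le> y powr (-1/2) * real n powr (-3/2)"
            using False y by (intro mult_right_mono powr_mono2') auto
          finally have "mangoldt n * K \<le> mangoldt n * (y powr (-1/2) * real n powr (-3/2))"
            by (intro mult_left_mono mangoldt_nonneg)
          also have "4 * \<dots> \<le> h n" unfolding h_def using G0 by simp
          finally show ?thesis unfolding lhs using le4 by linarith
        qed
      qed
    qed
  qed
  also have "(\<Sum>p\<in>prime_factors Q. suminf (g p)) \<le> (\<Sum>p\<in>prime_factors Q. 3 * ln (real p))"
    by (intro sum_mono gs)
  also have "\<dots> \<le> 3 * ln (real Q)"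
    using sum_ln_prime_factors_le[OF Q] by (simp flip: sum_distrib_left)
  finally show ?thesis by (simp add: mult_ac)
qed

text \<open>At even powers \<open>c\<close> is 1; at odd powers both characters take their values at
  \<open>p\<close>. So higher prime powers need no separate estimate: the weight vanishes at them as
  soon as it vanishes at \<open>p\<close>.\<close>

lemma primepow_character_value:
  fixes e c :: "nat \<Rightarrow> real"
  assumes e: "\<And>m n. e (m * n) = e m * e n" "e 1 = 1" and c: "\<And>m n. c (m * n) = c m * c n" "c 1 = 1"
    and p: "prime p" "e p \<in> {-1, 1}" "c p \<in> {-1, 1}" "\<not> (e p = 1 \<and> c p = -1)"
  shows "(1 + e (p ^ j)) * (1 - c (p ^ j)) = 0"
proof -
  have "e (p ^ j) = e p ^ j" by (induction j) (use e in auto)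
  moreover have "c (p ^ j) = c p ^ j" by (induction j) (use c in auto)
  ultimately show ?thesis using p(2-4) by (cases "even j") auto
qed

text \<open>The base 12/11 is the ratio of 1/2 to 11/24, so \<open>k\<close> measures when the pole
  exceeds the error by the factor \<open>x\<close>. Since \<open>(12/11) ^ 8 \<ge> 2\<close>, the
  power \<open>2 ^ k\<close> stays polynomial in \<open>x\<close>.\<close>

lemma geometric_threshold:
  fixes x :: real
  assumes "x \<ge> 1"
  obtains k where "(12/11) ^ k \<ge> x" "2 ^ k \<le> (2 * x) ^ 8" 
proof -
  define k where "k = (LEAST k. (12/11 :: real) ^ k \<ge> x)"
  have "\<exists>k. (12/11 :: real) ^ k \<ge> x" using real_arch_pow[of "12/11" x] by (auto intro: less_imp_le)
  hence k: "(12/11) ^ k \<ge> x" unfolding k_def by (rule LeastI_ex)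
  have "(12/11 :: real) ^ k \<le> 2 * x"
  proof (cases k)
    case (Suc j)
    hence "\<not> (12/11 :: real) ^ j \<ge> x" unfolding k_def using not_less_Least by (metis lessI)
    thus ?thesis using Suc assms by simp
  qed (use assms in auto)
  have "(2::real) ^ k \<le> ((12/11) ^ 8) ^ k" by (intro power_mono) (simp_all add: power_divide)
  also have "\<dots> = ((12/11) ^ k) ^ 8" by (simp add: power_mult[symmetric] mult.commute)
  also have "\<dots> \<le> (2 * x) ^ 8" by (intro power_mono \<open>(12/11) ^ k \<le> 2 * x\<close>) auto
  finally show ?thesis using that[OF k] by simp
qed

text \<open>The weight \<open>(1 + \<epsilon>) * (1 - \<eta>)\<close> expands into
  \<open>1 + \<epsilon> - \<eta> - \<epsilon> * \<eta>\<close>. The moment of 1 is about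
  \<open>1 / 2 ^ Suc k\<close> because of the pole, and the others are errors, as all three
  characters are nonprincipal. If no prime below the bound had the required values,
  \<open>moment_comparison\<close> would make the total smaller than this. The exponent 16 is the 8
  of \<open>geometric_threshold\<close>, doubled because \<open>y\<close> is a square.\<close>

lemma small_prime_with_character_values:
  assumes ERH: extended_riemann_hypothesis
  shows "\<exists>C>0. \<forall>Q q1 q2 q3 \<epsilon> \<eta>. 
    real_character q1 \<epsilon> \<and> nonprincipal q1 \<epsilon> \<and> real_character q2 \<eta> \<and> nonprincipal q2 \<eta> \<and>
    real_character q3 (\<lambda>n. \<epsilon> n * \<eta> n) \<and> nonprincipal q3 (\<lambda>n. \<epsilon> n * \<eta> n) \<and>
    q1 \<le> Q \<and> q2 \<le> Q \<and> q3 \<le> Q \<and> (\<forall>p. prime p \<and> \<epsilon> p * \<eta> p = 0 \<longrightarrow> p dvd Q) \<longrightarrow>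
    (\<exists>p. prime p \<and> \<epsilon> p = 1 \<and> \<eta> p = -1 \<and> real p \<le> C * (1 + ln (real Q)) ^ 16)"
proof -
  obtain C1 where C1: "C1 \<ge> 0" "\<And>k. \<bar>vm_moment k (\<lambda>_. 1) - 1 / 2 ^ Suc k\<bar> \<le> C1 * (11/24) ^ k"
    using zeta_moment[OF ERH] by blast
  obtain C2 where C2: "C2 \<ge> 0" "\<And>q \<psi> k. real_character q \<psi> \<Longrightarrow> nonprincipal q \<psi> \<Longrightarrow>
      \<bar>vm_moment k (\<lambda>n. Re (\<psi> n))\<bar> \<le> C2 * (1 + ln (real q)) * (11/24) ^ k"
    using character_moment[OF ERH] by blast
  define A where "A = (\<Sum>n. mangoldt n * real n powr (-3/2) :: real)"
  have A: "A \<ge> 0" unfolding A_def by (intro suminf_nonneg summable_mangoldt_three_halves) (simp add: mangoldt_nonneg)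
  \<comment> \<open>One share for zeta, one for each of the three characters, and 12 for the primes
    dividing \<open>Q\<close>.\<close>
  define D where "D = C1 + 3 * C2 + 12"
  define C where "C = (16 * A * (8 * D) ^ 8 + 1)\<^sup>2"
  have D: "D \<ge> 12" unfolding D_def using C1 C2 by simp
  have C: "C > 0" unfolding C_def using A D by (intro zero_less_power add_nonneg_pos) auto
  have main: "\<exists>p. prime p \<and> \<epsilon> p = 1 \<and> \<eta> p = -1 \<and> real p \<le> C * (1 + ln (real Q)) ^ 16"
    if \<epsilon>: "real_character q1 \<epsilon>" "nonprincipal q1 \<epsilon>" and \<eta>: "real_character q2 \<eta>" "nonprincipal q2 \<eta>"
      and \<epsilon>\<eta>: "real_character q3 (\<lambda>n. \<epsilon> n * \<eta> n)" "nonprincipal q3 (\<lambda>n. \<epsilon> n * \<eta> n)"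
      and qs: "q1 \<le> Q" "q2 \<le> Q" "q3 \<le> Q" and supp: "\<forall>p. prime p \<and> \<epsilon> p * \<eta> p = 0 \<longrightarrow> p dvd Q"
    for Q q1 q2 q3 \<epsilon> \<eta>
  proof (rule ccontr)
    assume contra: "\<not> ?thesis"
    define M where "M = 1 + ln (real Q)"
    have qpos: "q1 > 1" "q2 > 1" "q3 > 1"
      using nonprincipal_modulus_gt_1 \<epsilon> \<eta> \<epsilon>\<eta> by (auto simp: real_character_def)
    have Q: "Q > 1" using qpos qs by simp
    have M: "M \<ge> 1" unfolding M_def using Q by simp
    obtain k where k: "(12/11) ^ k \<ge> 4 * D * M" "2 ^ k \<le> (2 * (4 * D * M)) ^ 8"
    proof (rule geometric_threshold)
      have "1 * 1 \<le> D * M" using D M by (intro mult_mono) auto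
      thus "4 * D * M \<ge> 1" by simp
    qed
    \<comment> \<open>Chosen so that the tail \<open>4 * A * y powr (-1/2)\<close> is strictly below
      \<open>1 / 4 / 2 ^ k\<close>. The choice of \<open>k\<close> leaves at most another
      \<open>1 / 4 / 2 ^ k\<close> for all remaining errors, and together they would have to reach
      \<open>1 / 2 ^ Suc k\<close>.\<close>
    define y where "y = (16 * A * 2 ^ k + 1)\<^sup>2"
    have y0: "y > 0" unfolding y_def using A by (intro zero_less_power add_nonneg_pos) auto
    have yle: "y \<le> C * M ^ 16"
    proof -
      have "16 * A * 2 ^ k + 1 \<le> 16 * A * (2 * (4 * D * M)) ^ 8 + 1"
        using k(2) A by (intro add_right_mono mult_left_mono) auto
      also have "\<dots> \<le> 16 * A * (2 * (4 * D * M)) ^ 8 + M ^ 8"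
        using M by (intro add_left_mono one_le_power)
      also have "\<dots> = (16 * A * (8 * D) ^ 8 + 1) * M ^ 8"
        by (simp add: power_mult_distrib algebra_simps)
      finally have "y \<le> ((16 * A * (8 * D) ^ 8 + 1) * M ^ 8)\<^sup>2"
        unfolding y_def using A by (intro power_mono) auto
      also have "\<dots> = C * M ^ 16" unfolding C_def power_mult_distrib by (simp flip: power_mult)
      finally show ?thesis .
    qed
    define e c where "e = (\<lambda>n. Re (\<epsilon> n))" and "c = (\<lambda>n. Re (\<eta> n))"
    have val: "\<epsilon> n \<in> {-1,0,1}" "\<eta> n \<in> {-1,0,1}" for n using \<epsilon> \<eta> by (auto simp: real_character_def)
    have eq: "\<epsilon> n = of_real (e n)" "\<eta> n = of_real (c n)" "e n \<in> {-1,0,1}" "c n \<in> {-1,0,1}" for n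
      using val[of n] by (auto simp: e_def c_def complex_eq_iff)
    have ec: "Re (\<epsilon> n * \<eta> n) = e n * c n" for n unfolding eq by simp
    have "\<epsilon> (m * n) = \<epsilon> m * \<epsilon> n" "\<epsilon> 1 = 1" for m n
      using \<epsilon> by (auto simp: real_character_def dirichlet_character_def)
    hence em: "e (m * n) = e m * e n" "e 1 = 1" for m n
      unfolding eq by (simp_all flip: of_real_mult)
    have "\<eta> (m * n) = \<eta> m * \<eta> n" "\<eta> 1 = 1" for m n
      using \<eta> by (auto simp: real_character_def dirichlet_character_def)
    hence cm: "c (m * n) = c m * c n" "c 1 = 1" for m n
      unfolding eq by (simp_all flip: of_real_mult)
    define f where "f = (\<lambda>n. (1 + e n) * (1 - c n))"
    have f4: "0 \<le> f n \<and> f n \<le> 4" for n using eq(3,4)[of n] by (auto simp: f_def)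
    have zero: "f n = 0" if "primepow n" "coprime n Q" "real n \<le> y" for n
    proof -
      from that(1) obtain p j where pj: "prime p" "j > 0" "n = p ^ j" by (auto simp: primepow_def)
      have "p dvd n" using pj by simp
      have "\<not> p dvd Q"
        using that(2) \<open>p dvd n\<close> pj(1) by (meson coprime_common_divisor not_prime_unit)
      hence nz: "\<epsilon> p * \<eta> p \<noteq> 0" using supp pj(1) by blast
      have "p \<le> n" using \<open>p dvd n\<close> that(1) by (intro dvd_imp_le) (auto simp: primepow_gt_0_nat)
      hence "real p \<le> C * M ^ 16" using that(3) yle by linarith
      hence "\<not> (e p = 1 \<and> c p = -1)" using contra pj(1) eq(1,2)[of p] by (auto simp: M_def)
      moreover have "e p \<in> {-1, 1}" "c p \<in> {-1, 1}" using nz eq[of p] by auto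
      ultimately show ?thesis unfolding f_def pj(3)
        by (intro primepow_character_value[OF em cm pj(1)]) auto
    qed
    define T where "T = (\<lambda>(u::nat\<Rightarrow>real) n. u n * mangoldt n * ln (real n) ^ k / fact k * real n powr (-3))"
    have ts: "T u sums vm_moment k u" if "\<And>n. \<bar>u n\<bar> \<le> 1" for u
      using vm_moment_sums(1)[where k = k, OF that] by (simp add: T_def)
    have "(\<lambda>n. T (\<lambda>_. 1) n + T e n - T c n - T (\<lambda>n. e n * c n) n) sums
        (vm_moment k (\<lambda>_. 1) + vm_moment k e - vm_moment k c - vm_moment k (\<lambda>n. e n * c n))"
    proof (intro sums_diff sums_add ts)
      fix n show "\<bar>e n\<bar> \<le> 1" "\<bar>c n\<bar> \<le> 1" "\<bar>e n * c n\<bar> \<le> 1" using eq(3,4)[of n] by auto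
    qed auto
    moreover have "(\<lambda>n. T (\<lambda>_. 1) n + T e n - T c n - T (\<lambda>n. e n * c n) n) = T f"
      by (simp add: fun_eq_iff T_def f_def algebra_simps add_divide_distrib diff_divide_distrib)
    ultimately have "T f sums (vm_moment k (\<lambda>_. 1) + vm_moment k e - vm_moment k c - vm_moment k (\<lambda>n. e n * c n))" (is "_ sums ?S")
      by simp
    hence "?S \<le> 12 * ln (real Q) * (11/24) ^ k + 4 * A * y powr (-1/2)"
      unfolding T_def A_def by (intro moment_comparison[OF f4 _ y0 zero]) (use Q in auto)
    moreover have le: "\<bar>vm_moment k (\<lambda>n. Re (\<psi> n))\<bar> \<le> C2 * M * (11/24) ^ k"
      if "real_character q \<psi>" "nonprincipal q \<psi>" "q \<le> Q" "q > 1" for q \<psi>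
    proof -
      have "C2 * (1 + ln (real q)) * (11/24) ^ k \<le> C2 * M * (11/24) ^ k"
        unfolding M_def using that C2(1) by (intro mult_right_mono mult_left_mono) auto
      thus ?thesis using C2(2)[OF that(1,2), of k] by linarith
    qed
    have "\<bar>vm_moment k e\<bar> \<le> C2 * M * (11/24) ^ k" "\<bar>vm_moment k c\<bar> \<le> C2 * M * (11/24) ^ k"
      "\<bar>vm_moment k (\<lambda>n. e n * c n)\<bar> \<le> C2 * M * (11/24) ^ k"
      using le[OF \<epsilon> qs(1) qpos(1)] le[OF \<eta> qs(2) qpos(2)] le[OF \<epsilon>\<eta> qs(3) qpos(3)] 
      unfolding ec by (simp_all add: e_def c_def)
    moreover have "\<bar>vm_moment k (\<lambda>_. 1) - 1 / 2 ^ Suc k\<bar> \<le> C1 * M * (11/24) ^ k"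
    proof -
      have "C1 * (11/24) ^ k \<le> C1 * M * (11/24) ^ k"
        using C1(1) M mult_left_mono[OF M C1(1)] by (intro mult_right_mono) auto
      thus ?thesis using C1(2)[of k] by linarith
    qed
    moreover have "12 * ln (real Q) * (11/24) ^ k \<le> 12 * M * (11/24) ^ k"
      unfolding M_def by (intro mult_right_mono) auto
    ultimately have "1 / 2 ^ Suc k \<le> C1 * M * (11/24) ^ k + 3 * (C2 * M * (11/24) ^ k) + 12 * M * (11/24) ^ k + 4 * A * y powr (-1/2)"
      by (simp only: abs_le_iff) linarith
    also have "\<dots> = D * M * (11/24) ^ k + 4 * A * y powr (-1/2)" by (simp add: D_def algebra_simps)
    also have "D * M * (11/24) ^ k \<le> 1 / 4 / 2 ^ k"
    proof -
      have "(11/24 :: real) ^ k = (11/12) ^ k / 2 ^ k" by (simp flip: power_divide)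
      moreover have DM: "D * M * (11/12) ^ k \<le> 1/4"
      proof -
        have "4 * D * M * (11/12) ^ k \<le> (12/11) ^ k * (11/12) ^ k" by (intro mult_right_mono k) auto
        also have "\<dots> = 1" by (simp flip: power_mult_distrib)
        finally show ?thesis by simp
      qed
      ultimately show ?thesis using divide_right_mono[OF DM, of "2 ^ k"] by simp
    qed
    finally have "1 / 4 / 2 ^ k \<le> 4 * A * y powr (-1/2)" by (simp add: field_simps)
    moreover have "y powr (-1/2) = 1 / (16 * A * 2 ^ k + 1)"
      using A by (simp add: y_def powr_minus_divide powr_half_sqrt)
    ultimately have "1 / 4 / 2 ^ k \<le> 4 * A / (16 * A * 2 ^ k + 1)" by simp
    moreover have "16 * A * 2 ^ k + 1 > 0" using A by (intro add_nonneg_pos) auto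
    ultimately show False using A by (simp add: field_simps)
  qed
  show ?thesis using C main by (intro exI[of _ C] conjI allI impI) blast+
qed

subsection \<open>Legendre symbols\<close>

lemma Legendre_values: "Legendre a p \<in> {-1, 0, 1}"
  by (auto simp: Legendre_def)

lemma Legendre_eq_0_iff: "Legendre a p = 0 \<longleftrightarrow> p dvd a"
  by (auto simp: Legendre_def cong_0_iff)

lemma Legendre_cong: "[a = b] (mod p) \<Longrightarrow> Legendre a p = Legendre b p"
proof -
  assume ab: "[a = b] (mod p)"
  have "[a = 0] (mod p) \<longleftrightarrow> [b = 0] (mod p)" using ab cong_sym cong_trans by blast
  moreover have "QuadRes p a \<longleftrightarrow> QuadRes p b" unfolding QuadRes_def using ab cong_sym cong_trans by blast
  ultimately show ?thesis by (simp add: Legendre_def)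
qed

text \<open>Two such values differ by at most 2, less than \<open>p\<close>. This turns Euler's
  criterion from a congruence into an equality.\<close>

lemma signs_cong_imp_eq:
  assumes "x \<in> {-1, 0, 1 :: int}" "y \<in> {-1, 0, 1}" "[x = y] (mod int p)" "p > 2"
  shows "x = y"
proof (rule ccontr)
  assume "x \<noteq> y"
  have "int p dvd x - y" using assms(3) by (simp add: cong_iff_dvd_diff)
  hence "int p \<le> \<bar>x - y\<bar>" using \<open>x \<noteq> y\<close> by (intro dvd_imp_le_int[of "x - y" "int p", simplified]) auto
  thus False using assms by auto
qed

lemma Legendre_mult:
  assumes "prime p" "p > 2"
  shows "Legendre (a * b) (int p) = Legendre a (int p) * Legendre b (int p)"
proof (rule signs_cong_imp_eq[OF _ _ _ assms(2)])
  have "[Legendre a (int p) * Legendre b (int p) = a ^ ((p - 1) div 2) * b ^ ((p - 1) div 2)] (mod int p)"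
    by (intro cong_mult euler_criterion assms)
  thus "[Legendre (a * b) (int p) = Legendre a (int p) * Legendre b (int p)] (mod int p)"
    using euler_criterion[OF assms, of "a * b"] cong_sym cong_trans by (metis power_mult_distrib)
qed (use Legendre_values[of "a * b" "int p"] Legendre_values[of a "int p"] Legendre_values[of b "int p"] in auto)

lemma Legendre_1 [simp]: "prime p \<Longrightarrow> Legendre 1 (int p) = 1"
  by (auto simp: Legendre_def QuadRes_def cong_0_iff intro!: exI[of _ 1])

lemma Legendre_minus_1:
  assumes "prime p" "p > 2"
  shows "Legendre (-1) (int p) = (if p mod 4 = 1 then 1 else -1)"
proof (rule signs_cong_imp_eq[OF _ _ _ assms(2)])
  have "odd p" using assms prime_odd_nat by blast
  hence "even ((p - 1) div 2) \<longleftrightarrow> p mod 4 = 1" by presburger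
  hence "(-1 :: int) ^ ((p - 1) div 2) = (if p mod 4 = 1 then 1 else -1)" by auto
  thus "[Legendre (-1) (int p) = (if p mod 4 = 1 then 1 else -1)] (mod int p)"
    using euler_criterion[OF assms, of "-1"] by simp
qed (use Legendre_values[of "-1" "int p"] in auto)

lemma Legendre_square:
  assumes "prime p" "\<not> int p dvd a"
  shows "Legendre (a\<^sup>2) (int p) = 1"
proof -
  have "\<not> int p dvd a\<^sup>2" using assms prime_dvd_power_int[of "int p" a 2] by auto
  thus ?thesis by (auto simp: Legendre_def QuadRes_def cong_0_iff intro!: exI[of _ a])
qed

lemma reciprocity_1_mod_4:
  assumes "prime p" "p > 2" "prime r" "r mod 4 = 1" "p \<noteq> r"
  shows "Legendre (int p) (int r) = Legendre (int r) (int p)"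
proof -
  have "r > 2" using assms by (cases "r = 0 \<or> r = 1 \<or> r = 2") auto
  have "even ((r - 1) div 2)" using assms(4) by presburger
  hence "(-1 :: int) ^ ((p - 1) div 2 * ((r - 1) div 2)) = 1" by simp
  hence "Legendre (int p) (int r) * Legendre (int r) (int p) = 1"
    using Quadratic_Reciprocity[OF assms(1,2,3) \<open>r > 2\<close> assms(5)] by simp
  thus ?thesis using Legendre_values[of "int p" "int r"] Legendre_values[of "int r" "int p"] by auto
qed

lemma odd_prime_mod_4: "prime p \<Longrightarrow> p > (2::nat) \<Longrightarrow> p mod 4 = 1 \<or> p mod 4 = 3"
  using prime_odd_nat[of p] by presburger

subsection \<open>Sums of two squares\<close>

text \<open>Thue's argument: with \<open>x\<^sup>2\<close> congruent to -1, the more than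
  \<open>p\<close> pairs in \<open>{..k} \<times> {..k}\<close> cannot all have different values
  \<open>a - x * b\<close> modulo \<open>p\<close>. The difference of two colliding pairs has a sum
  of squares that is divisible by \<open>p\<close>, positive and below \<open>2 * p\<close>.\<close>

lemma prime_1_mod_4_two_squares:
  assumes "prime p" "p mod 4 = 1"
  shows "\<exists>a b :: int. int p = a\<^sup>2 + b\<^sup>2"
proof -
  have p2: "p > 2" using assms by (cases "p = 0 \<or> p = 1 \<or> p = 2") auto
  have "Legendre (-1) (int p) = 1" using Legendre_minus_1[OF assms(1) p2] assms(2) by simp
  then obtain x where x: "[x\<^sup>2 = -1] (mod int p)" by (auto simp: Legendre_def QuadRes_def split: if_splits)
  define k where "k = (LEAST k. p < (Suc k)\<^sup>2)"
  have ex: "\<exists>k. p < (Suc k)\<^sup>2" by (rule exI[of _ p]) (simp add: power2_eq_square)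
  have k1: "p < (Suc k)\<^sup>2" unfolding k_def by (rule LeastI_ex[OF ex])
  have k2: "k\<^sup>2 \<le> p"
  proof (cases k)
    case (Suc j)
    hence "\<not> p < (Suc j)\<^sup>2" unfolding k_def using not_less_Least by (metis lessI)
    thus ?thesis using Suc by simp
  qed simp
  \<comment> \<open>A prime is no square. The inequality \<open>k\<^sup>2 < p\<close> must be strict
    to keep the sum of squares below \<open>2 * p\<close>.\<close>
  have "k\<^sup>2 \<noteq> p" using assms(1) by (metis prime_power_iff numeral_eq_one_iff semiring_norm(85) zero_neq_numeral prime_power_not_one one_less_numeral_iff semiring_norm(76) less_irrefl)
  hence k2': "k\<^sup>2 < p" using k2 by simp
  define f where "f = (\<lambda>(a,b). (int a - x * int b) mod int p)"
  have "f ` ({..k} \<times> {..k}) \<subseteq> {0..<int p}" using p2 by (auto simp: f_def)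
  hence "card (f ` ({..k} \<times> {..k})) \<le> card {0..<int p}" by (intro card_mono) auto
  also have "\<dots> < card ({..k} \<times> {..k})" using k1 by (simp add: power2_eq_square)
  finally have "\<not> inj_on f ({..k} \<times> {..k})" by (rule pigeonhole)
  then obtain a b c d where abcd: "a \<le> k" "b \<le> k" "c \<le> k" "d \<le> k" "(a, b) \<noteq> (c, d)" "f (a, b) = f (c, d)"
    unfolding inj_on_def by auto
  define u where "u = int a - int c"
  define v where "v = int b - int d"
  have "[int a - x * int b = int c - x * int d] (mod int p)"
    using abcd(6) by (simp add: f_def unique_euclidean_semiring_class.cong_def)
  hence "int p dvd (int a - x * int b) - (int c - x * int d)" by (simp add: cong_iff_dvd_diff)
  hence "int p dvd u - x * v" by (simp add: u_def v_def algebra_simps)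
  hence "int p dvd (u - x * v) * (u + x * v)" by simp
  moreover have "int p dvd (x\<^sup>2 + 1) * v\<^sup>2" using x by (simp add: cong_iff_dvd_diff)
  ultimately have "int p dvd (u - x * v) * (u + x * v) + (x\<^sup>2 + 1) * v\<^sup>2" by (rule dvd_add)
  also have "(u - x * v) * (u + x * v) + (x\<^sup>2 + 1) * v\<^sup>2 = u\<^sup>2 + v\<^sup>2" by (simp add: power2_eq_square algebra_simps)
  finally obtain m where m: "u\<^sup>2 + v\<^sup>2 = int p * m" by blast
  have uv: "\<bar>u\<bar> \<le> int k" "\<bar>v\<bar> \<le> int k" using abcd by (auto simp: u_def v_def)
  have "u\<^sup>2 \<le> (int k)\<^sup>2" "v\<^sup>2 \<le> (int k)\<^sup>2" using uv by (simp_all add: abs_le_square_iff[symmetric])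
  moreover have "(int k)\<^sup>2 < int p" using k2' by (metis of_nat_less_iff of_nat_power)
  ultimately have "int p * m < int p * 2" using m by linarith
  hence "m < 2" using p2 by simp
  moreover have "u\<^sup>2 + v\<^sup>2 > 0" using abcd(5) by (auto simp: u_def v_def sum_power2_gt_zero_iff)
  hence "m > 0" using m p2 by (simp add: zero_less_mult_iff)
  ultimately have "m = 1" by simp
  thus ?thesis using m by (intro exI[of _ u] exI[of _ v]) simp
qed

lemma two_squares_mult:
  assumes "sum_of_two_squares m" "sum_of_two_squares n"
  shows "sum_of_two_squares (m * n)"
proof -
  obtain a b c d where "int m = a\<^sup>2 + b\<^sup>2" "int n = c\<^sup>2 + d\<^sup>2" using assms by (auto simp: sum_of_two_squares_def)
  hence "int (m * n) = (a * c - b * d)\<^sup>2 + (a * d + b * c)\<^sup>2" by (simp add: power2_eq_square algebra_simps)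
  thus ?thesis unfolding sum_of_two_squares_def by blast
qed

lemma prime_3_mod_4_dvd_two_squares:
  assumes "prime p" "p mod 4 = 3" "int p dvd x\<^sup>2 + y\<^sup>2"
  shows "int p dvd x \<and> int p dvd y"
proof -
  have p2: "p > 2" using assms by (cases "p = 0 \<or> p = 1 \<or> p = 2") auto
  have pi: "prime (int p)" using assms by simp
  have "int p dvd y"
  proof (rule ccontr)
    assume y: "\<not> int p dvd y"
    have "\<not> int p dvd x"
    proof
      assume "int p dvd x"
      hence "int p dvd x\<^sup>2" by (simp add: power2_eq_square)
      hence "int p dvd y\<^sup>2" using assms(3) by (simp add: dvd_add_right_iff)
      thus False using y pi prime_dvd_power by blast
    qed
    hence "1 = Legendre (x\<^sup>2) (int p)" using Legendre_square assms(1) by simp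
    also have "\<dots> = Legendre (-1 * y\<^sup>2) (int p)"
      by (rule Legendre_cong) (use assms(3) in \<open>simp add: cong_iff_dvd_diff\<close>)
    also have "\<dots> = -1" using Legendre_mult[OF assms(1) p2, of "-1" "y\<^sup>2"] Legendre_minus_1[OF assms(1) p2] Legendre_square[OF assms(1) y] assms(2) by simp
    finally show False by simp
  qed
  moreover from this have "int p dvd y\<^sup>2" by (simp add: power2_eq_square)
  hence "int p dvd x\<^sup>2" using assms(3) by (simp add: dvd_add_left_iff)
  hence "int p dvd x" using pi prime_dvd_power by blast
  ultimately show ?thesis by blast
qed

text \<open>Descent: \<open>p\<close> divides both bases, so \<open>p\<^sup>2\<close> can be divided
  out of the representation.\<close>

lemma two_squares_even_multiplicity:
  assumes "N > 0" "sum_of_two_squares N" "prime p" "p mod 4 = 3"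
  shows "even (multiplicity p N)"
  using assms(1,2)
proof (induction N rule: less_induct)
  case (less N)
  show ?case
  proof (cases "p dvd N")
    case True
    obtain x y where xy: "int N = x\<^sup>2 + y\<^sup>2" using less.prems by (auto simp: sum_of_two_squares_def)
    have "int p dvd x\<^sup>2 + y\<^sup>2" using True xy by (metis of_nat_dvd_iff)
    hence dv: "int p dvd x" "int p dvd y" using prime_3_mod_4_dvd_two_squares[OF assms(3,4)] by blast+
    obtain x' where x': "x = int p * x'" using dv(1) by (rule dvdE)
    obtain y' where y': "y = int p * y'" using dv(2) by (rule dvdE)
    note xy' = x' y'
    have e: "int N = int (p\<^sup>2) * (x'\<^sup>2 + y'\<^sup>2)" using xy xy' by (simp add: power_mult_distrib algebra_simps)
    define M where "M = nat (x'\<^sup>2 + y'\<^sup>2)"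
    have M: "int M = x'\<^sup>2 + y'\<^sup>2" by (simp add: M_def)
    hence N: "N = p\<^sup>2 * M" using e by (metis of_nat_eq_iff of_nat_mult)
    have "M > 0" using N less.prems by (auto intro!: Nat.gr0I)
    have "p\<^sup>2 > 1" by (rule one_less_power) (use prime_gt_1_nat[OF assms(3)] in auto)
    hence "M < N" using N \<open>M > 0\<close> by simp
    have "even (multiplicity p M)"
      using less.IH[OF \<open>M < N\<close> \<open>M > 0\<close>] M by (auto simp: sum_of_two_squares_def)
    moreover have "multiplicity p N = 2 + multiplicity p M"
      unfolding N using assms(3) \<open>M > 0\<close> prime_gt_0_nat[OF assms(3)]
      by (simp add: prime_elem_multiplicity_mult_distrib)
    ultimately show ?thesis by simp
  qed (simp add: not_dvd_imp_multiplicity_0)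
qed

lemma two_squares_of_even_multiplicity:
  assumes "N > 0" "\<And>p. prime p \<Longrightarrow> p mod 4 = 3 \<Longrightarrow> even (multiplicity p N)"
  shows "sum_of_two_squares N"
  using assms
proof (induction N rule: less_induct)
  case (less N)
  show ?case
  proof (cases "N = 1")
    case True
    hence "int N = 1\<^sup>2 + 0\<^sup>2" by simp
    thus ?thesis unfolding sum_of_two_squares_def by blast
  next
    case False
    then obtain p where p: "prime p" "p dvd N" using prime_factor_nat by blast
    have pg: "p > 1" by (rule prime_gt_1_nat[OF p(1)])
    show ?thesis
    proof (cases "p mod 4 = 3")
      case True
      have "multiplicity p N > 0" using p less.prems(1) by (simp add: prime_multiplicity_gt_zero_iff)
      moreover have "even (multiplicity p N)" using less.prems(2) p True by blast
      ultimately have "multiplicity p N \<ge> 2" by (auto elim!: evenE)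
      hence "p\<^sup>2 dvd N" by (rule multiplicity_dvd')
      then obtain M where M: "N = p\<^sup>2 * M" by blast
      have "M > 0" using M less.prems by (auto intro!: Nat.gr0I)
      have "p\<^sup>2 > 1" by (rule one_less_power[OF pg]) simp
      hence "M < N" using M \<open>M > 0\<close> by simp
      have "sum_of_two_squares M"
      proof (rule less.IH[OF \<open>M < N\<close> \<open>M > 0\<close>])
        fix r :: nat assume r: "prime r" "r mod 4 = 3"
        have "multiplicity r N = 2 * multiplicity r p + multiplicity r M"
          unfolding M using r(1) \<open>M > 0\<close> pg
          by (simp add: prime_elem_multiplicity_mult_distrib prime_elem_multiplicity_power_distrib)
        thus "even (multiplicity r M)" using less.prems(2)[OF r] by simp
      qed
      moreover have "int (p\<^sup>2) = (int p)\<^sup>2 + 0\<^sup>2" by simp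
      hence "sum_of_two_squares (p\<^sup>2)" unfolding sum_of_two_squares_def by blast
      ultimately show ?thesis using M two_squares_mult by simp
    next
      case False
      obtain M where M: "N = p * M" using p by blast
      have "M > 0" using M less.prems by (auto intro!: Nat.gr0I)
      hence "M < N" using M pg by simp
      have "sum_of_two_squares M"
      proof (rule less.IH[OF \<open>M < N\<close> \<open>M > 0\<close>])
        fix r :: nat assume r: "prime r" "r mod 4 = 3"
        have "r \<noteq> p" using False r by blast
        hence "multiplicity r N = multiplicity r M"
          unfolding M using r(1) p(1) \<open>M > 0\<close> pg
          by (simp add: prime_elem_multiplicity_mult_distrib prime_multiplicity_other)
        thus "even (multiplicity r M)" using less.prems(2)[OF r] by simp
      qed
      moreover have "sum_of_two_squares p"
      proof (cases "p = 2")
        case True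
        hence "int p = 1\<^sup>2 + 1\<^sup>2" by simp
        thus ?thesis unfolding sum_of_two_squares_def by blast
      next
        case False
        hence "p mod 4 = 1" using odd_prime_mod_4[OF p(1)] \<open>p mod 4 \<noteq> 3\<close> pg by auto
        thus ?thesis using prime_1_mod_4_two_squares[OF p(1)] by (auto simp: sum_of_two_squares_def)
      qed
      ultimately show ?thesis using M two_squares_mult by simp
    qed
  qed
qed

lemma two_squares_iff:
  "N > 0 \<Longrightarrow> sum_of_two_squares N \<longleftrightarrow> (\<forall>p. prime p \<and> p mod 4 = 3 \<longrightarrow> even (multiplicity p N))"
  using two_squares_even_multiplicity two_squares_of_even_multiplicity by blast

lemma two_squares_div_square:
  assumes "N > 0" "d > 0"
  shows "sum_of_two_squares (d\<^sup>2 * N) \<longleftrightarrow> sum_of_two_squares N"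
proof -
  have "multiplicity p (d\<^sup>2 * N) = 2 * multiplicity p d + multiplicity p N" if "prime p" for p
    using that assms by (simp add: prime_elem_multiplicity_mult_distrib prime_elem_multiplicity_power_distrib)
  thus ?thesis using assms by (simp add: two_squares_iff)
qed

text \<open>These are the two ways in which trial division removes a single prime. Once the square
  of \<open>d\<close> no longer divides, a prime \<open>d\<close> congruent to 3 modulo 4 settles
  the answer.\<close>

lemma two_squares_mult_prime:
  assumes "N > 0" "prime d"
  shows "d mod 4 \<noteq> 3 \<Longrightarrow> sum_of_two_squares (d * N) \<longleftrightarrow> sum_of_two_squares N"
    and "d mod 4 = 3 \<Longrightarrow> \<not> d dvd N \<Longrightarrow> \<not> sum_of_two_squares (d * N)"
proof -
  have d: "d > 0" using assms prime_gt_0_nat by blast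
  have m: "multiplicity p (d * N) = multiplicity p d + multiplicity p N" if "prime p" for p
    using that assms d by (simp add: prime_elem_multiplicity_mult_distrib)
  show "sum_of_two_squares (d * N) \<longleftrightarrow> sum_of_two_squares N" if "d mod 4 \<noteq> 3"
  proof -
    have "multiplicity p d = 0" if "prime p" "p mod 4 = 3" for p
      using \<open>d mod 4 \<noteq> 3\<close> that assms(2) by (intro prime_multiplicity_other) auto
    thus ?thesis using assms d m by (simp add: two_squares_iff)
  qed
  show "\<not> sum_of_two_squares (d * N)" if "d mod 4 = 3" "\<not> d dvd N"
  proof -
    have "multiplicity d (d * N) = 1"
      using m[OF assms(2)] that assms(2) by (simp add: not_dvd_imp_multiplicity_0)
    thus ?thesis using assms d that(1) by (subst two_squares_iff) (auto intro!: exI[of _ d])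
  qed
qed

section \<open>The quadratic character given by the primes congruent to 3 modulo 4\<close>

lemma prod_mset_signs_even:
  fixes g :: "nat \<Rightarrow> int"
  assumes "\<And>x. x \<in># M \<Longrightarrow> g x = 1 \<or> g x = -1 \<and> even (count M x)"
  shows "(\<Prod>x\<in>#M. g x) = 1"
proof -
  have "(\<Prod>x\<in>#M. g x) = (\<Prod>x\<in>set_mset M. g x ^ count M x)" by (rule image_prod_mset_multiplicity)
  also have "\<dots> = 1" by (intro prod.neutral ballI) (use assms in fastforce)
  finally show ?thesis .
qed

lemma prod_mset_signs:
  fixes g :: "nat \<Rightarrow> int"
  assumes "\<And>x. x \<in># M \<Longrightarrow> g x \<in> {-1, 1}"
  shows "(\<Prod>x\<in>#M. g x) \<in> {-1, 1}"
  using assms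
proof (induction M)
  case (add x M)
  have "g x \<in> {-1, 1}" using add.prems by simp
  moreover have "(\<Prod>x\<in>#M. g x) \<in> {-1, 1}" using add.prems by (intro add.IH) simp
  ultimately show ?case by auto
qed simp

text \<open>The Jacobi symbol modulo the part of \<open>N\<close> made up of the primes congruent to
  3 modulo 4. The Legendre symbols at the other odd primes are those that a query returns.\<close>

definition jacobi3 :: "nat \<Rightarrow> int \<Rightarrow> int" where
  "jacobi3 N a = (\<Prod>p\<in>#prime_factorization N. if p mod 4 = 3 then Legendre a (int p) else 1)"

lemma pf_odd_prime:
  fixes N p :: nat
  assumes "odd N" "p \<in># prime_factorization N"
  shows "prime p" "p dvd N" "p > 2"
proof -
  show p: "prime p" "p dvd N" using assms(2) by auto
  have "p \<noteq> 2" using assms(1) p(2) by auto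
  thus "p > 2" using prime_ge_2_nat[OF p(1)] by simp
qed

lemma jacobi3_cong:
  assumes "[a = b] (mod int N)"
  shows "jacobi3 N a = jacobi3 N b"
  unfolding jacobi3_def
proof (intro arg_cong[of _ _ prod_mset] image_mset_cong)
  fix p assume "p \<in># prime_factorization N"
  hence "int p dvd int N" by auto
  hence "[a = b] (mod int p)" using assms by (metis cong_dvd_modulus)
  from Legendre_cong[OF this]
  show "(if p mod 4 = 3 then Legendre a (int p) else 1) = (if p mod 4 = 3 then Legendre b (int p) else 1)" by simp
qed

lemma jacobi3_mult:
  assumes "odd N"
  shows "jacobi3 N (a * b) = jacobi3 N a * jacobi3 N b"
  unfolding jacobi3_def prod_mset.distrib[symmetric]
  by (intro arg_cong[of _ _ prod_mset] image_mset_cong) (auto simp: Legendre_mult pf_odd_prime[OF assms])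

lemma not_dvd_of_coprime: "coprime a (int N) \<Longrightarrow> prime p \<Longrightarrow> p dvd N \<Longrightarrow> \<not> int p dvd a"
  by (meson coprime_common_divisor not_prime_unit of_nat_dvd_iff prime_nat_int_transfer)

lemma jacobi3_signs:
  assumes "coprime a (int N)"
  shows "jacobi3 N a \<in> {-1, 1}"
  unfolding jacobi3_def
proof (rule prod_mset_signs)
  fix p assume "p \<in># prime_factorization N"
  hence "\<not> int p dvd a" using assms by (intro not_dvd_of_coprime) auto
  thus "(if p mod 4 = 3 then Legendre a (int p) else 1) \<in> {-1, 1}"
    using Legendre_values[of a "int p"] Legendre_eq_0_iff[of a "int p"] by auto
qed

lemma jacobi3_two_squares:
  assumes "N > 0" "sum_of_two_squares N" "coprime a (int N)"
  shows "jacobi3 N a = 1"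
  unfolding jacobi3_def
proof (rule prod_mset_signs_even)
  fix p assume p: "p \<in># prime_factorization N"
  hence "\<not> int p dvd a" using assms(3) by (intro not_dvd_of_coprime) auto
  hence "Legendre a (int p) \<in> {-1, 1}" using Legendre_values[of a "int p"] Legendre_eq_0_iff[of a "int p"] by auto
  moreover have "even (count (prime_factorization N) p)" if "p mod 4 = 3"
    using two_squares_even_multiplicity[OF assms(1,2) _ that] p by (simp add: count_prime_factorization)
  ultimately show "(if p mod 4 = 3 then Legendre a (int p) else 1) = 1 \<or>
      (if p mod 4 = 3 then Legendre a (int p) else 1) = -1 \<and> even (count (prime_factorization N) p)" by auto
qed

subsection \<open>Queries\<close>

text \<open>Modulo \<open>p\<close>, \<open>x ^ 4 = w\<^sup>2\<close> means
  \<open>x\<^sup>2 = w\<close> or \<open>x\<^sup>2 = - w\<close>. If \<open>p\<close> is 1 modulo 4,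
  then \<open>w\<close> and \<open>- w\<close> have the same quadratic character; if
  \<open>p\<close> is 3 modulo 4, exactly one of them is a residue, and a solution always
  exists.\<close>

lemma prime_residue_symbol_square:
  assumes "prime p" "\<not> p dvd w"
  shows "prime_residue_symbol 2 (int (w\<^sup>2)) p = (if p mod 4 = 1 then Legendre (int w) (int p) else 1)"
proof (cases "p = 2")
  case True
  hence "odd w" using assms by simp
  hence "[1 ^ (2 ^ 2) = int (w\<^sup>2)] (mod int p)" using True by (simp add: unique_euclidean_semiring_class.cong_def mod_2_eq_odd)
  hence "\<exists>x::int. [x ^ (2 ^ 2) = int (w\<^sup>2)] (mod int p)" by blast
  thus ?thesis using True by (simp add: prime_residue_symbol_def)
next
  case False
  hence p2: "p > 2" using prime_ge_2_nat[OF assms(1)] by simp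
  have nd: "\<not> int p dvd int w" using assms(2) by simp
  have pm: "Legendre (int w) (int p) \<in> {-1, 1}"
    using Legendre_values[of "int w" "int p"] Legendre_eq_0_iff[of "int w" "int p"] nd by auto
  have neg: "Legendre (- int w) (int p) = (if p mod 4 = 1 then 1 else -1) * Legendre (int w) (int p)"
    using Legendre_mult[OF assms(1) p2, of "-1" "int w"] Legendre_minus_1[OF assms(1) p2] by simp
  have four: "(2::nat) ^ 2 = 4" by simp
  have root: "\<exists>x::int. [x ^ 4 = int (w\<^sup>2)] (mod int p)" if z: "Legendre z (int p) = 1" "z = int w \<or> z = - int w" for z
  proof -
    obtain x where "[x\<^sup>2 = z] (mod int p)" using z(1) by (auto simp: Legendre_def QuadRes_def split: if_splits)
    hence "[(x\<^sup>2)\<^sup>2 = z\<^sup>2] (mod int p)" by (rule cong_pow)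
    moreover have "z\<^sup>2 = int (w\<^sup>2)" using z(2) by auto
    ultimately show ?thesis by (intro exI[of _ x]) (simp add: power_mult[symmetric])
  qed
  show ?thesis
  proof (cases "p mod 4 = 1")
    case True
    have "Legendre (int w) (int p) = 1" if x: "[x ^ 4 = int (w\<^sup>2)] (mod int p)" for x :: int
    proof -
      have "int p dvd x ^ 4 - int (w\<^sup>2)" using x by (simp add: cong_iff_dvd_diff)
      also have "x ^ 4 - int (w\<^sup>2) = (x\<^sup>2 - int w) * (x\<^sup>2 - (- int w))"
        by (simp add: algebra_simps power2_eq_square power4_eq_xxxx)
      finally have "int p dvd x\<^sup>2 - int w \<or> int p dvd x\<^sup>2 - (- int w)"
        using assms(1) prime_dvd_mult_iff[of "int p"] by (metis prime_nat_int_transfer)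
      hence "QuadRes (int p) (int w) \<or> QuadRes (int p) (- int w)"
        by (auto simp: QuadRes_def cong_iff_dvd_diff)
      hence "Legendre (int w) (int p) = 1 \<or> Legendre (- int w) (int p) = 1"
        using nd by (auto simp: Legendre_def cong_0_iff)
      thus ?thesis using neg True by auto
    qed
    thus ?thesis using True root[of "int w"] pm unfolding prime_residue_symbol_def four by auto
  next
    case False
    have "Legendre (int w) (int p) = 1 \<or> Legendre (- int w) (int p) = 1" using neg pm False by auto
    thus ?thesis using False root unfolding prime_residue_symbol_def four by auto
  qed
qed

text \<open>Squaring the argument makes the promise of the problem hold at every prime, so the
  answer of the solver is determined.\<close>

lemma query_square:
  assumes "solves_CRS 2 orc" "n > 0" "w > 0" "coprime n w"
  shows "orc n (w\<^sup>2) = (\<Prod>p\<in>#prime_factorization n. if p mod 4 = 1 then Legendre (int w) (int p) else 1)"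
proof -
  have nd: "\<not> p dvd w" if "prime p" "p dvd n" for p
    using that assms(4) by (meson coprime_common_divisor not_prime_unit)
  have "CRS_instance 2 n (w\<^sup>2)"
  proof -
    have "\<exists>x::int. [x ^ (2 ^ (2 - 1)) = int (w\<^sup>2)] (mod int p)" for p by (rule exI[of _ "int w"]) simp
    thus ?thesis using assms(2-4) unfolding CRS_instance_def prime_residue_symbol_def by simp
  qed
  hence "orc n (w\<^sup>2) = residue_symbol 2 (int (w\<^sup>2)) n"
    using assms(1) by (simp add: solves_CRS_def)
  also have "\<dots> = (\<Prod>p\<in>#prime_factorization n. if p mod 4 = 1 then Legendre (int w) (int p) else 1)"
    unfolding residue_symbol_def
    by (intro arg_cong[of _ _ prod_mset] image_mset_cong prime_residue_symbol_square nd) auto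
  finally show ?thesis .
qed

lemma Legendre_prod_pf:
  assumes "prime p" "p > 2" "n > 0"
  shows "Legendre (int n) (int p) = (\<Prod>r\<in>#prime_factorization n. Legendre (int r) (int p))"
proof -
  have "Legendre (int (\<Prod>r\<in>#M. r)) (int p) = (\<Prod>r\<in>#M. Legendre (int r) (int p))" for M :: "nat multiset"
    by (induction M) (use assms in \<open>auto simp: Legendre_mult\<close>)
  from this[of "prime_factorization n"] show ?thesis using assms(3) by (simp add: prod_mset_prime_factorization_nat)
qed

text \<open>Primes \<open>r \<equiv> 3 (mod 4)\<close> occur in \<open>w\<close> with even exponent, and for \<open>r \<equiv> 1 (mod 4)\<close> the
  reciprocity law is symmetric.\<close>

lemma two_queries:
  assumes orc: "solves_CRS 2 orc" and N: "N > 0" "odd N" and w: "w > 0" "odd w" "sum_of_two_squares w"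
    and cop: "coprime w N"
  shows "orc N (w\<^sup>2) \<in> {-1, 1}" and "orc w (N\<^sup>2) = orc N (w\<^sup>2) * jacobi3 N (int w)"
proof -
  have copi: "coprime (int w) (int N)" "coprime N w" using cop by (simp_all add: coprime_commute)
  have q1: "orc N (w\<^sup>2) = (\<Prod>p\<in>#prime_factorization N. if p mod 4 = 1 then Legendre (int w) (int p) else 1)"
    by (rule query_square[OF orc]) (use N w copi in auto)
  have q2: "orc w (N\<^sup>2) = (\<Prod>r\<in>#prime_factorization w. if r mod 4 = 1 then Legendre (int N) (int r) else 1)"
    by (rule query_square[OF orc]) (use N w cop in auto)
  show "orc N (w\<^sup>2) \<in> {-1, 1}" unfolding q1
  proof (rule prod_mset_signs)
    fix p assume "p \<in># prime_factorization N"
    hence "\<not> int p dvd int w" using copi by (intro not_dvd_of_coprime) auto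
    thus "(if p mod 4 = 1 then Legendre (int w) (int p) else 1) \<in> {-1, 1}"
      using Legendre_values[of "int w" "int p"] Legendre_eq_0_iff[of "int w" "int p"] by auto
  qed
  \<comment> \<open>Reciprocity flips each symbol of a prime of \<open>N\<close> modulo a prime
    \<open>r\<close> of \<open>w\<close>; exchanging the two products then collects, for each prime
    of \<open>N\<close>, the symbol of \<open>w\<close>.\<close>
  have "orc w (N\<^sup>2) = (\<Prod>r\<in>#prime_factorization w. \<Prod>p\<in>#prime_factorization N. if r mod 4 = 1 then Legendre (int r) (int p) else 1)"
    unfolding q2
  proof (intro arg_cong[of _ _ prod_mset] image_mset_cong)
    fix r assume r: "r \<in># prime_factorization w"
    have rp: "prime r" "r dvd w" "r > 2" using pf_odd_prime[OF w(2) r] by auto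
    show "(if r mod 4 = 1 then Legendre (int N) (int r) else 1) =
        (\<Prod>p\<in>#prime_factorization N. if r mod 4 = 1 then Legendre (int r) (int p) else 1)"
    proof (cases "r mod 4 = 1")
      case True
      have "Legendre (int N) (int r) = (\<Prod>p\<in>#prime_factorization N. Legendre (int p) (int r))"
        by (rule Legendre_prod_pf[OF rp(1,3) N(1)])
      also have "\<dots> = (\<Prod>p\<in>#prime_factorization N. Legendre (int r) (int p))"
      proof (intro arg_cong[of _ _ prod_mset] image_mset_cong reciprocity_1_mod_4)
        fix p assume p: "p \<in># prime_factorization N"
        show "prime p" "p > 2" using pf_odd_prime[OF N(2) p] by auto
        show "p \<noteq> r" using cop rp pf_odd_prime[OF N(2) p] by (metis coprime_common_divisor not_prime_unit)
      qed (use rp True in auto)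
      finally show ?thesis using True by simp
    qed auto
  qed
  also have "\<dots> = (\<Prod>p\<in>#prime_factorization N. \<Prod>r\<in>#prime_factorization w. if r mod 4 = 1 then Legendre (int r) (int p) else 1)"
    by (rule prod_mset.swap)
  also have "\<dots> = (\<Prod>p\<in>#prime_factorization N. Legendre (int w) (int p))"
  proof (intro arg_cong[of _ _ prod_mset] image_mset_cong)
    fix p assume p: "p \<in># prime_factorization N"
    have pp: "prime p" "p dvd N" "p > 2" using pf_odd_prime[OF N(2) p] by auto
    have "Legendre (int w) (int p) = (\<Prod>r\<in>#prime_factorization w. Legendre (int r) (int p))"
      by (rule Legendre_prod_pf[OF pp(1,3) w(1)])
    also have "\<dots> = (\<Prod>r\<in>#prime_factorization w. (if r mod 4 = 1 then Legendre (int r) (int p) else 1) *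
        (if r mod 4 = 3 then Legendre (int r) (int p) else 1))"
      by (intro arg_cong[of _ _ prod_mset] image_mset_cong) (use odd_prime_mod_4 pf_odd_prime[OF w(2)] in auto)
    also have "\<dots> = (\<Prod>r\<in>#prime_factorization w. if r mod 4 = 1 then Legendre (int r) (int p) else 1) *
        (\<Prod>r\<in>#prime_factorization w. if r mod 4 = 3 then Legendre (int r) (int p) else 1)"
      by (rule prod_mset.distrib)
    also have "(\<Prod>r\<in>#prime_factorization w. if r mod 4 = 3 then Legendre (int r) (int p) else 1) = 1"
    proof (rule prod_mset_signs_even)
      fix r assume r: "r \<in># prime_factorization w"
      have "prime r" "r dvd w" using pf_odd_prime[OF w(2) r] by auto
      have "\<not> p dvd r" using pp \<open>r dvd w\<close> cop by (meson coprime_common_divisor dvd_trans not_prime_unit)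
      hence "Legendre (int r) (int p) \<in> {-1, 1}"
        using Legendre_values[of "int r" "int p"] Legendre_eq_0_iff[of "int r" "int p"] by auto
      moreover have "even (count (prime_factorization w) r)" if "r mod 4 = 3"
        using two_squares_even_multiplicity[OF w(1,3) \<open>prime r\<close> that] r by (simp add: count_prime_factorization)
      ultimately show "(if r mod 4 = 3 then Legendre (int r) (int p) else 1) = 1 \<or>
          (if r mod 4 = 3 then Legendre (int r) (int p) else 1) = -1 \<and> even (count (prime_factorization w) r)" by auto
    qed
    finally show "(\<Prod>r\<in>#prime_factorization w. if r mod 4 = 1 then Legendre (int r) (int p) else 1) = Legendre (int w) (int p)" by simp
  qed
  also have "\<dots> = (\<Prod>p\<in>#prime_factorization N. (if p mod 4 = 1 then Legendre (int w) (int p) else 1) *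
      (if p mod 4 = 3 then Legendre (int w) (int p) else 1))"
    by (intro arg_cong[of _ _ prod_mset] image_mset_cong) (use odd_prime_mod_4 pf_odd_prime[OF N(2)] in auto)
  also have "\<dots> = orc N (w\<^sup>2) * jacobi3 N (int w)"
    unfolding q1 jacobi3_def by (rule prod_mset.distrib)
  finally show "orc w (N\<^sup>2) = orc N (w\<^sup>2) * jacobi3 N (int w)" .
qed

subsection \<open>Witnesses\<close>

text \<open>Such an \<open>x\<close> is visible at \<open>p\<close> only, where the sign -1 is taken
  to the odd power \<open>multiplicity p N\<close>.\<close>

lemma jacobi3_eq_minus_1:
  assumes N: "N > 0" "odd N" and p: "prime p" "p mod 4 = 3" "odd (multiplicity p N)"
    and Leg: "Legendre x (int p) = -1" and M: "N = p ^ multiplicity p N * M" and x: "[x = 1] (mod int M)"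
  shows "jacobi3 N x = -1" "coprime x (int N)"
proof -
  have pN: "p \<in># prime_factorization N" 
  proof -
    have "p dvd N" using p(3) by (rule contrapos_np) (simp add: not_dvd_imp_multiplicity_0)
    thus ?thesis using p(1) N(1) by (simp add: in_prime_factors_iff)
  qed
  have other: "[x = 1] (mod int r)" if "r \<in># prime_factorization N" "r \<noteq> p" for r
  proof -
    have "prime r" "r dvd N" using that by auto
    hence "r dvd p ^ multiplicity p N * M" using M by metis
    hence "r dvd p ^ multiplicity p N \<or> r dvd M" using prime_dvd_mult_iff \<open>prime r\<close> by blast
    moreover have "\<not> r dvd p ^ multiplicity p N"
      using \<open>prime r\<close> p(1) that(2) prime_dvd_power primes_dvd_imp_eq by blast
    ultimately have "int r dvd int M" by simp
    thus ?thesis using x cong_dvd_modulus by blast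
  qed
  have "jacobi3 N x = (\<Prod>r\<in>prime_factors N. (if r mod 4 = 3 then Legendre x (int r) else 1) ^ count (prime_factorization N) r)"
    unfolding jacobi3_def by (rule image_prod_mset_multiplicity)
  also have "\<dots> = (\<Prod>r\<in>prime_factors N. if r = p then -1 else 1)"
  proof (rule prod.cong)
    fix r assume r: "r \<in> prime_factors N"
    show "(if r mod 4 = 3 then Legendre x (int r) else 1) ^ count (prime_factorization N) r = (if r = p then -1 else 1)"
    proof (cases "r = p")
      case True
      thus ?thesis using p Leg by (simp add: count_prime_factorization)
    next
      case False
      hence "Legendre x (int r) = Legendre 1 (int r)" using other r by (intro Legendre_cong) auto
      moreover have "prime r" using r by auto
      ultimately show ?thesis using False by simp
    qed
  qed auto
  also have "\<dots> = -1" using pN by (simp add: prod.delta)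
  finally show "jacobi3 N x = -1" .
  show "coprime x (int N)"
  proof (rule ccontr)
    assume "\<not> coprime x (int N)"
    then obtain r where r: "prime r" "r dvd gcd x (int N)"
      using prime_divisor_exists[of "gcd x (int N)"] N(1) by (auto simp: is_unit_gcd)
    define r' where "r' = nat r"
    have rr': "r = int r'" using prime_ge_0_int[OF r(1)] by (simp add: r'_def)
    have "prime r'" using r(1) unfolding rr' by simp
    note r' = rr' this
    have rN: "r' \<in># prime_factorization N" using r r' N(1) by (auto simp: in_prime_factors_iff)
    show False
    proof (cases "r' = p")
      case True
      hence "Legendre x (int p) = 0" using r r' by (simp add: Legendre_eq_0_iff)
      thus False using Leg by simp
    next
      case False
      have "int r' dvd x - 1" using other[OF rN False] by (simp add: cong_iff_dvd_diff)
      moreover have "int r' dvd x" using r r' by simp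
      ultimately have "int r' dvd x - (x - 1)" using dvd_diff by blast
      thus False using r'(2) by (simp add: prime_nat_iff)
    qed
  qed
qed

text \<open>Take the least positive nonresidue \<open>m\<close>, which exists because -1 is one.
  Then \<open>m - 1\<close> is a nonzero residue, that is, congruent to a square
  \<open>a\<^sup>2\<close>.\<close>

lemma nonresidue_one_plus_square:
  assumes "prime p" "p mod 4 = 3"
  obtains a :: int where "Legendre (a\<^sup>2 + 1) (int p) = -1"
proof -
  have p2: "p > 2" using assms by (cases "p = 0 \<or> p = 1 \<or> p = 2") auto
  define P where "P = (\<lambda>m::nat. m > 0 \<and> Legendre (int m) (int p) = -1)"
  have "Legendre (int (p - 1)) (int p) = Legendre (-1) (int p)"
    by (rule Legendre_cong) (use p2 in \<open>simp add: cong_iff_dvd_diff of_nat_diff\<close>)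
  hence Pp: "P (p - 1)" using Legendre_minus_1[OF assms(1) p2] assms(2) p2 by (simp add: P_def)
  define m where "m = (LEAST m. P m)"
  have m: "P m" "m \<le> p - 1" unfolding m_def by (rule LeastI[of P, OF Pp], rule Least_le[of P, OF Pp])
  have "m \<noteq> 1" using m(1) assms(1) by (auto simp: P_def)
  hence m1: "m > 1" using m(1) by (simp add: P_def)
  have "\<not> P (m - 1)" unfolding m_def by (rule not_less_Least) (use m1 m_def in auto)
  hence "Legendre (int (m - 1)) (int p) \<noteq> -1" using m1 by (simp add: P_def)
  moreover have "\<not> p dvd m - 1" using m m1 p2 by (intro nat_dvd_not_less) auto
  hence "\<not> int p dvd int (m - 1)" by (simp only: of_nat_dvd_iff not_False_eq_True)
  ultimately have "Legendre (int (m - 1)) (int p) = 1"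
    using Legendre_values[of "int (m - 1)" "int p"] Legendre_eq_0_iff[of "int (m - 1)" "int p"] by auto
  then obtain a where "[a\<^sup>2 = int (m - 1)] (mod int p)" by (auto simp: Legendre_def QuadRes_def split: if_splits)
  hence "[a\<^sup>2 + 1 = int (m - 1) + 1] (mod int p)" by (rule cong_add) simp
  hence "[a\<^sup>2 + 1 = int m] (mod int p)" using m1 by (simp add: of_nat_diff)
  from Legendre_cong[OF this] m(1) show ?thesis by (intro that[of a]) (simp add: P_def)
qed

text \<open>The Chinese remainder theorem places a nonresidue at a prime \<open>p\<close> of odd
  multiplicity and the value 1 elsewhere. The first witness is a norm, by which pairs are multiplied
  in the counting argument. The second is 1 modulo 4 and shows that both the character and its
  product with \<open>chi4\<close> are nonprincipal.\<close>

lemma not_two_squares_witnesses: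
  assumes N: "N > 0" "odd N" "\<not> sum_of_two_squares N"
  shows "\<exists>A B :: int. jacobi3 N (A\<^sup>2 + B\<^sup>2) = -1 \<and> coprime (A\<^sup>2 + B\<^sup>2) (int N)"
    and "\<exists>b::nat. b mod 4 = 1 \<and> jacobi3 N (int b) = -1 \<and> coprime b N"
proof -
  obtain p where p: "prime p" "p mod 4 = 3" "odd (multiplicity p N)" using N two_squares_iff by blast
  have "\<not> is_unit p" "N \<noteq> 0" using p(1) N not_prime_unit by auto
  then obtain M where M: "N = p ^ multiplicity p N * M" "\<not> p dvd M" using multiplicity_decompose'[of N p] by metis
  have cop: "coprime (int p) (int M)" using M(2) p(1) by (simp add: prime_imp_coprime)
  have "odd M" using N(2) M(1) by (metis dvd_mult)
  have "odd p" using p(2) by presburger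
  obtain a where a: "Legendre (a\<^sup>2 + 1) (int p) = -1" using nonresidue_one_plus_square[OF p(1,2)] .
  \<comment> \<open>The pair \<open>(A, B)\<close> is \<open>(a, 1)\<close> modulo \<open>p\<close>
    and \<open>(1, 0)\<close> modulo \<open>M\<close>, with norms \<open>a\<^sup>2 + 1\<close> and
    1.\<close>
  obtain A where A: "[A = a] (mod int p)" "[A = 1] (mod int M)"
    using binary_chinese_remainder_int[OF cop] by blast
  obtain B where B: "[B = 1] (mod int p)" "[B = 0] (mod int M)"
    using binary_chinese_remainder_int[OF cop] by blast
  have "[A\<^sup>2 + B\<^sup>2 = a\<^sup>2 + 1\<^sup>2] (mod int p)" by (intro cong_add cong_pow A B)
  hence "Legendre (A\<^sup>2 + B\<^sup>2) (int p) = -1" using Legendre_cong a by (metis power_one)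
  moreover have "[A\<^sup>2 + B\<^sup>2 = 1\<^sup>2 + 0\<^sup>2] (mod int M)" by (intro cong_add cong_pow A B)
  hence "[A\<^sup>2 + B\<^sup>2 = 1] (mod int M)" by simp
  ultimately show "\<exists>A B :: int. jacobi3 N (A\<^sup>2 + B\<^sup>2) = -1 \<and> coprime (A\<^sup>2 + B\<^sup>2) (int N)"
    using jacobi3_eq_minus_1[OF N(1,2) p _ M(1)] by blast
  have "coprime (int p) (int (4 * M))"
  proof -
    have "coprime (int p) (2 ^ 2)" using \<open>odd p\<close> by (subst coprime_power_right_iff) (auto simp: coprime_right_2_iff_odd)
    thus ?thesis using cop by (simp add: coprime_mult_right_iff)
  qed
  then obtain x where x: "[x = a\<^sup>2 + 1] (mod int p)" "[x = 1] (mod int (4 * M))"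
    using binary_chinese_remainder_int by blast
  define b where "b = nat (x mod int (4 * N))"
  have bx: "[int b = x] (mod int (4 * N))" using N(1) by (simp add: b_def unique_euclidean_semiring_class.cong_def)
  have "int (4 * M) dvd int (4 * N)" using M(1) by (metis dvd_triv_right mult_dvd_mono dvd_refl of_nat_dvd_iff)
  hence b4M: "[int b = 1] (mod int (4 * M))" using bx x(2) cong_dvd_modulus cong_trans by blast
  have "p dvd N" using p(3) by (rule contrapos_np) (simp add: not_dvd_imp_multiplicity_0)
  hence "int p dvd int (4 * N)" by simp
  hence "[int b = a\<^sup>2 + 1] (mod int p)" using bx x(1) cong_dvd_modulus cong_trans by blast
  hence bL: "Legendre (int b) (int p) = -1" using Legendre_cong a by metis
  have "[int b = 1] (mod int M)" "[int b = 1] (mod 4)"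
    by (rule cong_dvd_modulus[OF b4M], simp)+
  moreover from this(2) have "b mod 4 = 1" by (simp add: unique_euclidean_semiring_class.cong_def) presburger
  ultimately show "\<exists>b::nat. b mod 4 = 1 \<and> jacobi3 N (int b) = -1 \<and> coprime b N"
    using jacobi3_eq_minus_1[OF N(1,2) p bL M(1)] by (intro exI[of _ b]) auto
qed

lemma floorlog_pos: "N > 0 \<Longrightarrow> floorlog 2 N > 0"
  by (rule Nat.gr0I) (simp add: floorlog_eq_zero_iff)

section \<open>Characters for the deterministic search\<close>

definition chi4 :: "nat \<Rightarrow> complex" where
  "chi4 n = (if n mod 4 = 1 then 1 else if n mod 4 = 3 then -1 else 0)"

lemma coprime_4_iff: "coprime n (4::nat) \<longleftrightarrow> odd n"
proof -
  have "coprime n ((2::nat) ^ 2) \<longleftrightarrow> odd n" by (subst coprime_power_right_iff) auto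
  thus ?thesis by simp
qed

lemma chi4_real_character: "real_character 4 chi4" "nonprincipal 4 chi4"
proof -
  have mult: "chi4 (m * n) = chi4 m * chi4 n" for m n
  proof -
    have e: "m * n mod 4 = (m mod 4) * (n mod 4) mod 4" by (simp add: mod_mult_eq)
    have "m mod 4 \<in> {0, 1, 2, 3}" "n mod 4 \<in> {0, 1, 2, 3}" by (simp, presburger)+
    thus ?thesis unfolding chi4_def e by auto
  qed
  have "chi4 n \<noteq> 0 \<longleftrightarrow> odd n" for n
  proof -
    have "n mod 4 = 1 \<or> n mod 4 = 3 \<longleftrightarrow> odd n" by presburger
    thus ?thesis by (auto simp: chi4_def)
  qed
  moreover have "chi4 n \<in> {-1, 0, 1}" "chi4 (n + 4) = chi4 n" "chi4 1 = 1" for n by (simp_all add: chi4_def)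
  ultimately show "real_character 4 chi4"
    unfolding real_character_def dirichlet_character_def coprime_4_iff using mult by simp
  show "nonprincipal 4 chi4"
    by (auto simp: nonprincipal_def coprime_4_iff chi4_def intro!: exI[of _ 3])
qed

text \<open>\<open>jacobi3\<close> does not see the primes of \<open>N\<close> congruent to 1 modulo
  4, so the zeros that a character modulo \<open>N\<close> must have at their multiples are imposed
  here.\<close>

definition jacobi3_character :: "nat \<Rightarrow> nat \<Rightarrow> complex" where
  "jacobi3_character N n = (if coprime n N then of_int (jacobi3 N (int n)) else 0)"

lemma jacobi3_1: "jacobi3 N 1 = 1"
  unfolding jacobi3_def
proof (rule prod_mset_signs_even)
  fix p assume "p \<in># prime_factorization N"
  hence "prime p" by auto
  thus "(if p mod 4 = 3 then Legendre 1 (int p) else 1) = 1 \<or>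
      (if p mod 4 = 3 then Legendre 1 (int p) else 1) = -1 \<and> even (count (prime_factorization N) p)" by simp
qed

lemma jacobi3_real_character:
  assumes "N > 0" "odd N"
  shows "real_character N (jacobi3_character N)"
proof -
  have J: "jacobi3 N (int n) \<in> {-1, 1}" if "coprime n N" for n
    by (rule jacobi3_signs) (use that in auto)
  have per: "jacobi3 N (int n + int N) = jacobi3 N (int n)" for n
    by (rule jacobi3_cong) (simp add: unique_euclidean_semiring_class.cong_def)
  have mult: "jacobi3 N (int m * int n) = jacobi3 N (int m) * jacobi3 N (int n)" for m n
    by (rule jacobi3_mult[OF assms(2)])
  have nz: "jacobi3_character N n \<noteq> 0 \<longleftrightarrow> coprime n N" for n
    using J[of n] by (auto simp: jacobi3_character_def)
  have "coprime (n + N) N \<longleftrightarrow> coprime n N" for n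
    by (metis coprime_iff_gcd_eq_1 gcd_add1)
  hence "dirichlet_character N (jacobi3_character N)"
    unfolding dirichlet_character_def using assms nz
    by (auto simp: jacobi3_character_def mult per coprime_mult_left_iff jacobi3_1[simplified] jacobi3_1)
  moreover have "jacobi3_character N n \<in> {-1, 0, 1}" for n
    using J[of n] by (auto simp: jacobi3_character_def)
  ultimately show ?thesis by (simp add: real_character_def)
qed

lemma real_character_mult:
  assumes "real_character q1 \<alpha>" "real_character q2 \<beta>"
  shows "real_character (q1 * q2) (\<lambda>n. \<alpha> n * \<beta> n)"
proof -
  have per: "\<alpha> (n + q1 * q2) = \<alpha> n" "\<beta> (n + q1 * q2) = \<beta> n" for n
    using dirichlet_character_mod[of q1 \<alpha> "n + q1 * q2"] dirichlet_character_mod[of q1 \<alpha> n]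
      dirichlet_character_mod[of q2 \<beta> "n + q1 * q2"] dirichlet_character_mod[of q2 \<beta> n] assms
    by (auto simp: real_character_def)
  show ?thesis
    unfolding real_character_def dirichlet_character_def
  proof (intro conjI allI)
    show "q1 * q2 > 0" using assms by (simp add: real_character_def dirichlet_character_def)
    show "\<alpha> 1 * \<beta> 1 = 1" using assms by (simp add: real_character_def dirichlet_character_def)
    fix a b
    show "\<alpha> (a * b) * \<beta> (a * b) = \<alpha> a * \<beta> a * (\<alpha> b * \<beta> b)"
      using assms by (simp add: real_character_def dirichlet_character_def)
    show "\<alpha> (a + q1 * q2) * \<beta> (a + q1 * q2) = \<alpha> a * \<beta> a" by (simp add: per)
    show "\<alpha> a * \<beta> a \<noteq> 0 \<longleftrightarrow> coprime a (q1 * q2)"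
      using assms by (simp add: real_character_def dirichlet_character_def coprime_mult_right_iff)
    have "\<alpha> a \<in> {-1,0,1}" "\<beta> a \<in> {-1,0,1}" using assms by (auto simp: real_character_def)
    thus "\<alpha> a * \<beta> a \<in> {-1,0,1}" by auto
  qed
qed

text \<open>An odd sum of two squares has one odd and one even base. Fixing their order loses no
  value and makes every value odd.\<close>

abbreviation (input) norm_pair :: "nat \<Rightarrow> nat \<Rightarrow> nat" where
  "norm_pair u v \<equiv> (2 * u + 1)\<^sup>2 + (2 * v)\<^sup>2"

lemma prime_1_mod_4_norm_pair:
  assumes "prime p" "p mod 4 = 1"
  obtains u v where "p = norm_pair u v"
proof -
  obtain a b where ab: "int p = a\<^sup>2 + b\<^sup>2" using prime_1_mod_4_two_squares[OF assms] by blast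
  define m where "m = nat \<bar>a\<bar>"
  define n where "n = nat \<bar>b\<bar>"
  have "int p = int (m\<^sup>2 + n\<^sup>2)" using ab by (simp add: m_def n_def)
  hence p: "p = m\<^sup>2 + n\<^sup>2" by (simp only: of_nat_eq_iff)
  have "odd p" using assms(2) by presburger
  hence "odd m \<noteq> odd n" using p by simp
  then consider "odd m" "even n" | "even m" "odd n" by blast
  thus ?thesis
  proof cases
    case 1
    from this obtain u v where "m = 2 * u + 1" "n = 2 * v" by (auto elim!: oddE evenE)
    thus ?thesis using p that by blast
  next
    case 2
    from this obtain u v where "n = 2 * u + 1" "m = 2 * v" by (auto elim!: oddE evenE)
    thus ?thesis using p that[of u v] by (simp add: add.commute)
  qed
qed

lemma ln_le_floorlog:
  assumes "N > 0"
  shows "1 + ln (real (4 * N)) \<le> 4 * real (floorlog 2 N)"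
proof -
  define L where "L = floorlog 2 N"
  have "N < 2 ^ L" "L > 0" using floorlog_bounds[of N 2] floorlog_pos[OF assms] assms by (auto simp: L_def)
  hence "real (4 * N) \<le> 4 * 2 ^ L" by (metis less_imp_le of_nat_le_iff of_nat_mult of_nat_numeral of_nat_power mult_left_mono zero_le_numeral)
  hence "ln (real (4 * N)) \<le> ln (4 * 2 ^ L)" using assms by (intro ln_mono) auto
  also have "\<dots> = (2 + real L) * ln 2"
    using ln_realpow[of 2 "L + 2"] by (simp add: power_add mult.commute)
  also have "\<dots> \<le> (2 + real L) * 1" using ln_2_less_1 by (intro mult_left_mono) auto
  finally have "ln (real (4 * N)) \<le> 2 + real L" by simp
  moreover have "real L \<ge> 1" using \<open>L > 0\<close> by simp
  ultimately show ?thesis unfolding L_def[symmetric] by linarith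
qed

text \<open>Applied with \<open>\<epsilon> = chi4\<close>,
  \<open>\<eta> = jacobi3_character N\<close> and \<open>Q = 4 * N\<close>. The prime found is 1
  modulo 4, hence of the form \<open>norm_pair u v\<close>, and \<open>u\<close> and
  \<open>v\<close> do not exceed it, which bounds the search. The witness \<open>b\<close> shows
  that \<eta> and the product are nonprincipal.\<close>

lemma small_witness:
  assumes ERH: extended_riemann_hypothesis
  shows "\<exists>C::nat. \<forall>N. N > 0 \<and> odd N \<and> \<not> sum_of_two_squares N \<longrightarrow>
    (\<exists>u v. u < C * floorlog 2 N ^ 16 \<and> v < C * floorlog 2 N ^ 16 \<and>
       coprime (norm_pair u v) N \<and> jacobi3 N (int (norm_pair u v)) = -1)"
proof -
  obtain C where C: "C > 0" "\<And>Q q1 q2 q3 \<epsilon> \<eta>.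
    real_character q1 \<epsilon> \<and> nonprincipal q1 \<epsilon> \<and> real_character q2 \<eta> \<and> nonprincipal q2 \<eta> \<and>
    real_character q3 (\<lambda>n. \<epsilon> n * \<eta> n) \<and> nonprincipal q3 (\<lambda>n. \<epsilon> n * \<eta> n) \<and>
    q1 \<le> Q \<and> q2 \<le> Q \<and> q3 \<le> Q \<and> (\<forall>p. prime p \<and> \<epsilon> p * \<eta> p = 0 \<longrightarrow> p dvd Q) \<longrightarrow>
    (\<exists>p. prime p \<and> \<epsilon> p = 1 \<and> \<eta> p = -1 \<and> real p \<le> C * (1 + ln (real Q)) ^ 16)"
    using small_prime_with_character_values[OF ERH] by blast
  define D where "D = Suc (nat \<lceil>C * 4 ^ 16\<rceil>)"
  have D: "C * 4 ^ 16 < real D" unfolding D_def by linarith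
  have "\<exists>u v. u < D * floorlog 2 N ^ 16 \<and> v < D * floorlog 2 N ^ 16 \<and>
       coprime (norm_pair u v) N \<and> jacobi3 N (int (norm_pair u v)) = -1"
    if N: "N > 0" "odd N" "\<not> sum_of_two_squares N" for N
  proof -
    define L where "L = floorlog 2 N"
    have "L > 0" using floorlog_pos[OF N(1)] by (simp add: L_def)
    obtain b where b: "b mod 4 = 1" "jacobi3 N (int b) = -1" "coprime b N"
      using not_two_squares_witnesses(2)[OF N] by blast
    have "odd b" using b(1) by presburger
    have jb: "jacobi3_character N b = -1" using b by (simp add: jacobi3_character_def)
    have c4b: "chi4 b = 1" using b by (simp add: chi4_def)
    have np: "nonprincipal N (jacobi3_character N)" using jb b(3) by (auto simp: nonprincipal_def intro!: exI[of _ b])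
    have npp: "nonprincipal (4 * N) (\<lambda>n. chi4 n * jacobi3_character N n)"
      unfolding nonprincipal_def using jb c4b b(3) \<open>odd b\<close>
      by (intro exI[of _ b]) (simp add: coprime_mult_right_iff coprime_4_iff)
    have rc: "real_character N (jacobi3_character N)" by (rule jacobi3_real_character[OF N(1,2)])
    have rcp: "real_character (4 * N) (\<lambda>n. chi4 n * jacobi3_character N n)"
      by (rule real_character_mult[OF chi4_real_character(1) rc])
    have supp: "p dvd 4 * N" if "prime p" "chi4 p * jacobi3_character N p = 0" for p
    proof -
      have "\<not> coprime p (4 * N)" using that(2) rcp by (auto simp: real_character_def dirichlet_character_def)
      thus ?thesis using that(1) prime_imp_coprime by blast
    qed
    have "\<exists>p. prime p \<and> chi4 p = 1 \<and> jacobi3_character N p = -1 \<and> real p \<le> C * (1 + ln (real (4 * N))) ^ 16"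
      using C(2)[of 4 chi4 N "jacobi3_character N" "4 * N" "4 * N"] chi4_real_character np npp rc rcp supp N(1) by simp
    then obtain p where p: "prime p" "chi4 p = 1" "jacobi3_character N p = -1" "real p \<le> C * (1 + ln (real (4 * N))) ^ 16"
      by blast
    have p4: "p mod 4 = 1" using p(2) by (auto simp: chi4_def split: if_splits)
    have pJ: "coprime p N" "jacobi3 N (int p) = -1"
    proof -
      show "coprime p N" using p(3) by (auto simp: jacobi3_character_def split: if_splits)
      hence "of_int (jacobi3 N (int p)) = (of_int (-1) :: complex)" using p(3) by (simp add: jacobi3_character_def)
      thus "jacobi3 N (int p) = -1" by (simp only: of_int_eq_iff)
    qed
    have "0 \<le> ln (real (4 * N))" using N(1) by (intro ln_ge_zero) auto
    hence "C * (1 + ln (real (4 * N))) ^ 16 \<le> C * (4 * real L) ^ 16"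
      using ln_le_floorlog[OF N(1)] C(1) by (intro mult_left_mono power_mono) (auto simp: L_def)
    also have "\<dots> = C * 4 ^ 16 * real L ^ 16" by (simp only: power_mult_distrib mult.assoc)
    also have "\<dots> < real D * real L ^ 16" using D \<open>L > 0\<close> by (intro mult_strict_right_mono) auto
    finally have "real p < real (D * L ^ 16)" using p(4) by simp
    hence pL: "p < D * L ^ 16" by (simp only: of_nat_less_iff)
    obtain u v where uv: "p = norm_pair u v" using prime_1_mod_4_norm_pair[OF p(1) p4] .
    have "u \<le> p" unfolding uv by (simp add: power2_eq_square algebra_simps)
    have "v \<le> (2 * v)\<^sup>2" by (cases v) (auto simp: power2_eq_square)
    hence "v \<le> p" unfolding uv by (rule trans_le_add2)
    with \<open>u \<le> p\<close> show ?thesis using pL pJ unfolding uv[symmetric] L_def[symmetric]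
      by (intro exI[of _ u] exI[of _ v]) (auto simp: uv)
  qed
  thus ?thesis by blast
qed

subsection \<open>Counting witnesses\<close>

text \<open>There are at most two roots modulo \<open>p\<close>, and each residue class has
  \<open>N div p\<close> members below \<open>N\<close>.\<close>

lemma card_square_roots_le:
  assumes "prime p" "p > 2" "p dvd N"
  shows "card {x\<in>{..<N}. int p dvd (int x)\<^sup>2 + c} \<le> 2 * (N div p)"
proof -
  define R where "R = {r\<in>{..<p}. int p dvd (int r)\<^sup>2 + c}"
  have R2: "card R \<le> 2"
  proof (cases "R = {}")
    case False
    then obtain r0 where r0: "r0 \<in> R" by blast
    have "R \<subseteq> {r0, p - r0}"
    proof
      fix r assume r: "r \<in> R"
      have "int p dvd ((int r)\<^sup>2 + c) - ((int r0)\<^sup>2 + c)" using r r0 by (intro dvd_diff) (auto simp: R_def)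
      also have "((int r)\<^sup>2 + c) - ((int r0)\<^sup>2 + c) = (int r - int r0) * (int r + int r0)"
        by (simp add: power2_eq_square algebra_simps)
      finally have "int p dvd int r - int r0 \<or> int p dvd int r + int r0"
        using assms(1) prime_dvd_mult_iff[of "int p"] by simp
      moreover have "r < p" "r0 < p" using r r0 by (auto simp: R_def)
      moreover have "r = r0" if "int p dvd int r - int r0"
        using dvd_imp_le_int[of "int r - int r0" "int p"] that \<open>r < p\<close> \<open>r0 < p\<close> by linarith
      moreover have "r \<in> {r0, p - r0}" if "int p dvd int r + int r0"
      proof -
        have "p dvd r + r0" using that by (metis of_nat_add of_nat_dvd_iff)
        then obtain k where k: "r + r0 = p * k" by blast
        have "p * k < p * 2" using k \<open>r < p\<close> \<open>r0 < p\<close> by linarith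
        hence "k = 0 \<or> k = 1" by auto
        thus ?thesis using k by auto
      qed
      ultimately show "r \<in> {r0, p - r0}" by blast
    qed
    hence "card R \<le> card {r0, p - r0}" by (intro card_mono) auto
    also have "\<dots> \<le> 2" by (simp add: card_insert_if)
    finally show ?thesis .
  qed simp
  have "(\<lambda>x. (x div p, x mod p)) ` {x\<in>{..<N}. int p dvd (int x)\<^sup>2 + c} \<subseteq> {..<N div p} \<times> R"
  proof (rule image_subsetI)
    fix x assume x: "x \<in> {x\<in>{..<N}. int p dvd (int x)\<^sup>2 + c}"
    have "x div p < N div p" using x assms by (auto elim!: dvdE simp: div_less_iff_less_mult mult.commute)
    moreover have "[(int (x mod p))\<^sup>2 + c = (int x)\<^sup>2 + c] (mod int p)"
      by (intro cong_add cong_pow) (auto simp: unique_euclidean_semiring_class.cong_def of_nat_mod)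
    hence "int p dvd (int (x mod p))\<^sup>2 + c" using x by (auto simp: cong_dvd_iff)
    ultimately show "(x div p, x mod p) \<in> {..<N div p} \<times> R" using assms by (auto simp: R_def)
  qed
  hence "card ((\<lambda>x. (x div p, x mod p)) ` {x\<in>{..<N}. int p dvd (int x)\<^sup>2 + c}) \<le> card ({..<N div p} \<times> R)"
    by (intro card_mono) (auto simp: R_def)
  moreover have "inj_on (\<lambda>x. (x div p, x mod p)) A" for A
    by (rule inj_onI) (metis Pair_inject div_mult_mod_eq)
  ultimately have "card {x\<in>{..<N}. int p dvd (int x)\<^sup>2 + c} \<le> (N div p) * card R"
    by (simp add: card_image card_cartesian_product)
  also have "\<dots> \<le> (N div p) * 2" using R2 by simp
  finally show ?thesis by simp
qed

lemma card_prime_factors_le_floorlog: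
  assumes "N > 0"
  shows "card (prime_factors N) \<le> floorlog 2 N"
proof -
  have "2 ^ card (prime_factors N) = (\<Prod>p\<in>prime_factors N. 2::nat)" by simp
  also have "\<dots> \<le> (\<Prod>p\<in>prime_factors N. p ^ multiplicity p N)"
  proof (rule prod_mono)
    fix p assume p: "p \<in> prime_factors N"
    hence "multiplicity p N > 0" using assms by (auto simp: prime_factors_multiplicity)
    moreover have "p \<ge> 2" using p by (auto dest: in_prime_factors_imp_prime prime_ge_2_nat)
    ultimately have "p \<le> p ^ multiplicity p N" by (intro self_le_power) auto
    thus "0 \<le> (2::nat) \<and> 2 \<le> p ^ multiplicity p N" using \<open>p \<ge> 2\<close> by simp
  qed
  also have "\<dots> = N" using prime_factorization_nat[of N] assms by simp
  also have "N < 2 ^ floorlog 2 N" using floorlog_bounds[of N 2] assms by simp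
  finally show ?thesis by simp
qed

text \<open>Union bound: a prime \<open>p\<close> of \<open>N\<close> spoils at most
  \<open>2 * N\<^sup>2 / p\<close> pairs, and there are at most \<open>L\<close> such primes, each
  at least \<open>8 * L\<close>. The bound of trial division is chosen for this. In the application
  \<open>L\<close> belongs to the original input and \<open>N\<close> is what trial division leaves,
  hence only \<open>floorlog 2 N \<le> L\<close>.\<close>

lemma card_nonunits_le:
  assumes N: "N > 0" "odd N" and big: "\<And>p. prime p \<Longrightarrow> p dvd N \<Longrightarrow> 8 * L \<le> p" and L: "floorlog 2 N \<le> L"
  shows "4 * card {(x, y). x < N \<and> y < N \<and> \<not> coprime ((int x)\<^sup>2 + (int y)\<^sup>2) (int N)} \<le> N\<^sup>2"
proof -
  have L0: "L > 0" using L floorlog_pos[OF N(1)] by simp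
  define X where "X = (\<lambda>p y. {x\<in>{..<N}. int p dvd (int x)\<^sup>2 + (int y)\<^sup>2})"
  define E where "E = (\<lambda>p. \<Union>y<N. (\<lambda>x. (x, y)) ` X p y)"
  have Efin: "finite (E p)" for p by (auto simp: E_def X_def)
  have Ecard: "8 * L * card (E p) \<le> 2 * N\<^sup>2" if p: "p \<in> prime_factors N" for p
  proof -
    have pp: "prime p" "p dvd N" "p > 2" using pf_odd_prime[OF N(2) p] by auto
    have "card (E p) \<le> (\<Sum>y<N. card ((\<lambda>x. (x, y)) ` X p y))" unfolding E_def by (rule card_UN_le) simp
    also have "\<dots> \<le> (\<Sum>y<N. 2 * (N div p))"
    proof (rule sum_mono)
      fix y
      have "card ((\<lambda>x. (x, y)) ` X p y) \<le> card (X p y)" by (rule card_image_le) (simp add: X_def)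
      also have "\<dots> \<le> 2 * (N div p)" unfolding X_def by (rule card_square_roots_le[OF pp(1,3,2)])
      finally show "card ((\<lambda>x. (x, y)) ` X p y) \<le> 2 * (N div p)" .
    qed
    also have "\<dots> = 2 * N * (N div p)" by simp
    finally have "8 * L * card (E p) \<le> p * (2 * N * (N div p))"
      using big[OF pp(1,2)] by (intro mult_le_mono)
    also have "\<dots> = 2 * N\<^sup>2" using pp(2) by (auto elim!: dvdE simp: power2_eq_square)
    finally show ?thesis .
  qed
  have sub: "{(x, y). x < N \<and> y < N \<and> \<not> coprime ((int x)\<^sup>2 + (int y)\<^sup>2) (int N)} \<subseteq> (\<Union>p\<in>prime_factors N. E p)"
  proof clarify
    fix x y assume xy: "x < N" "y < N" "\<not> coprime ((int x)\<^sup>2 + (int y)\<^sup>2) (int N)"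
    have "(int x)\<^sup>2 + (int y)\<^sup>2 = int (x\<^sup>2 + y\<^sup>2)" by simp
    hence "\<not> coprime (x\<^sup>2 + y\<^sup>2) N" using xy(3) coprime_int_iff[of "x\<^sup>2 + y\<^sup>2" N] by metis
    hence "gcd (x\<^sup>2 + y\<^sup>2) N \<noteq> 1" unfolding coprime_iff_gcd_eq_1 .
    from prime_factor_nat[OF this] obtain p where p: "prime p" "p dvd gcd (x\<^sup>2 + y\<^sup>2) N" by blast
    have pd: "p dvd x\<^sup>2 + y\<^sup>2" "p dvd N" using p(2) dvd_trans gcd_dvd1 gcd_dvd2 by blast+
    have "int p dvd int (x\<^sup>2 + y\<^sup>2)" using pd(1) unfolding of_nat_dvd_iff .
    hence "int p dvd (int x)\<^sup>2 + (int y)\<^sup>2" by simp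
    moreover have "p \<in> prime_factors N" using p(1) pd(2) N(1) by (simp add: in_prime_factors_iff)
    ultimately show "(x, y) \<in> (\<Union>p\<in>prime_factors N. E p)" using xy by (auto simp: E_def X_def)
  qed
  have "card {(x, y). x < N \<and> y < N \<and> \<not> coprime ((int x)\<^sup>2 + (int y)\<^sup>2) (int N)} \<le> card (\<Union>p\<in>prime_factors N. E p)"
    by (rule card_mono[OF _ sub]) (auto simp: Efin)
  also have "\<dots> \<le> (\<Sum>p\<in>prime_factors N. card (E p))" by (rule card_UN_le) simp
  finally have "8 * L * card {(x, y). x < N \<and> y < N \<and> \<not> coprime ((int x)\<^sup>2 + (int y)\<^sup>2) (int N)} \<le>
      (\<Sum>p\<in>prime_factors N. 8 * L * card (E p))"
    by (simp flip: sum_distrib_left)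
  also have "\<dots> \<le> (\<Sum>p\<in>prime_factors N. 2 * N\<^sup>2)" by (intro sum_mono Ecard)
  also have "\<dots> \<le> L * (2 * N\<^sup>2)" using card_prime_factors_le_floorlog[OF N(1)] L by simp
  finally show ?thesis using L0 by simp
qed

text \<open>Multiplication by a Gaussian integer A + Bi whose norm has sign -1 is injective modulo
  \<open>N\<close> and sends units of sign 1 to units of sign -1. So at least half of the units are
  witnesses, and at least three quarters of all pairs are units.\<close>

lemma card_witness_residues:
  assumes N: "N > 0" "odd N" "\<not> sum_of_two_squares N"
    and big: "\<And>p. prime p \<Longrightarrow> p dvd N \<Longrightarrow> 8 * L \<le> p" and L: "floorlog 2 N \<le> L"
  shows "3 * N\<^sup>2 \<le> 8 * card {(x, y). x < N \<and> y < N \<and> coprime ((int x)\<^sup>2 + (int y)\<^sup>2) (int N) \<and>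
      jacobi3 N ((int x)\<^sup>2 + (int y)\<^sup>2) = -1}" (is "_ \<le> 8 * card ?G")
proof -
  define nm where "nm = (\<lambda>x y. (int x)\<^sup>2 + (int y)\<^sup>2)"
  obtain A B where AB: "jacobi3 N (A\<^sup>2 + B\<^sup>2) = -1" "coprime (A\<^sup>2 + B\<^sup>2) (int N)"
    using not_two_squares_witnesses(1)[OF N] by blast
  define P where "P = {(x, y). x < N \<and> y < N \<and> coprime (nm x y) (int N) \<and> jacobi3 N (nm x y) = 1}"
  define G where "G = {(x, y). x < N \<and> y < N \<and> coprime (nm x y) (int N) \<and> jacobi3 N (nm x y) = -1}"
  define Z where "Z = {(x, y). x < N \<and> y < N \<and> \<not> coprime (nm x y) (int N)}"
  have fin: "finite P" "finite G" "finite Z"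
    by (rule finite_subset[of _ "{..<N} \<times> {..<N}"], auto simp: P_def G_def Z_def)+
  \<comment> \<open>Multiplication of x + yi by A + Bi, reduced modulo \<open>N\<close>.\<close>
  define T where "T = (\<lambda>(x,y). (nat ((A * int x - B * int y) mod int N), nat ((B * int x + A * int y) mod int N)))"
  have Tmod: "[int (fst (T (x,y))) = A * int x - B * int y] (mod int N)" "[int (snd (T (x,y))) = B * int x + A * int y] (mod int N)"
    "fst (T (x,y)) < N" "snd (T (x,y)) < N" for x y
    using N(1) by (auto simp: T_def unique_euclidean_semiring_class.cong_def nat_less_iff)
  have Tnm: "[nm (fst (T (x,y))) (snd (T (x,y))) = (A\<^sup>2 + B\<^sup>2) * nm x y] (mod int N)" for x y
  proof -
    have "[nm (fst (T (x,y))) (snd (T (x,y))) = (A * int x - B * int y)\<^sup>2 + (B * int x + A * int y)\<^sup>2] (mod int N)"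
      unfolding nm_def by (intro cong_add cong_pow Tmod)
    also have "(A * int x - B * int y)\<^sup>2 + (B * int x + A * int y)\<^sup>2 = (A\<^sup>2 + B\<^sup>2) * nm x y"
      by (simp add: nm_def power2_eq_square algebra_simps)
    finally show ?thesis .
  qed
  have "T ` P \<subseteq> G"
  proof (rule image_subsetI)
    fix z assume z: "z \<in> P"
    obtain x y where xy: "z = (x, y)" by (cases z)
    have P: "coprime (nm x y) (int N)" "jacobi3 N (nm x y) = 1" using z by (auto simp: P_def xy)
    have "coprime ((A\<^sup>2 + B\<^sup>2) * nm x y) (int N)" using P AB by (simp add: coprime_mult_left_iff)
    hence "coprime (nm (fst (T (x,y))) (snd (T (x,y)))) (int N)"
      using cong_imp_coprime[OF cong_sym[OF Tnm[of x y]]] by simp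
    moreover have "jacobi3 N (nm (fst (T (x,y))) (snd (T (x,y)))) = -1"
      using jacobi3_cong[OF Tnm[of x y]] jacobi3_mult[OF N(2)] P AB by simp
    ultimately show "T z \<in> G" using Tmod(3,4)[of x y] unfolding xy G_def by (auto simp: case_prod_unfold)
  qed
  moreover have "inj_on T P"
  proof (rule inj_onI)
    fix z z' assume zz: "z \<in> P" "z' \<in> P" "T z = T z'"
    obtain x y where xy: "z = (x, y)" by (cases z)
    obtain x' y' where xy': "z' = (x', y')" by (cases z')
    have 1: "[A * int x - B * int y = A * int x' - B * int y'] (mod int N)"
      using Tmod(1)[of x y] Tmod(1)[of x' y'] zz(3) unfolding xy xy' by (metis cong_sym cong_trans)
    have 2: "[B * int x + A * int y = B * int x' + A * int y'] (mod int N)"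
      using Tmod(2)[of x y] Tmod(2)[of x' y'] zz(3) unfolding xy xy' by (metis cong_sym cong_trans)
    \<comment> \<open>Multiplying by the conjugate A - Bi recovers
      \<open>A\<^sup>2 + B\<^sup>2\<close> times the pair, and this factor is a unit.\<close>
    have "[A * (A * int x - B * int y) + B * (B * int x + A * int y) = A * (A * int x' - B * int y') + B * (B * int x' + A * int y')] (mod int N)"
      by (intro cong_add cong_mult cong_refl 1 2)
    hence "[(A\<^sup>2 + B\<^sup>2) * int x = (A\<^sup>2 + B\<^sup>2) * int x'] (mod int N)" by (simp add: power2_eq_square algebra_simps)
    hence "[int x = int x'] (mod int N)" using AB(2) by (simp add: cong_mult_lcancel)
    moreover have "[A * (B * int x + A * int y) - B * (A * int x - B * int y) = A * (B * int x' + A * int y') - B * (A * int x' - B * int y')] (mod int N)"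
      by (intro cong_diff cong_mult cong_refl 1 2)
    hence "[(A\<^sup>2 + B\<^sup>2) * int y = (A\<^sup>2 + B\<^sup>2) * int y'] (mod int N)" by (simp add: power2_eq_square algebra_simps)
    hence "[int y = int y'] (mod int N)" using AB(2) by (simp add: cong_mult_lcancel)
    ultimately have "[x = x'] (mod N)" "[y = y'] (mod N)" by (simp_all add: cong_int_iff)
    thus "z = z'" using zz(1,2) unfolding xy xy' P_def by (auto simp: unique_euclidean_semiring_class.cong_def)
  qed
  ultimately have PG: "card P \<le> card G" using fin by (metis card_inj_on_le)
  have "{..<N} \<times> {..<N} \<subseteq> P \<union> G \<union> Z" using jacobi3_signs by (auto simp: P_def G_def Z_def)
  hence "card ({..<N} \<times> {..<N}) \<le> card (P \<union> G \<union> Z)" using fin by (intro card_mono) auto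
  also have "\<dots> \<le> card P + card G + card Z" by (metis add.commute add_left_mono card_Un_le order_trans)
  finally have "N\<^sup>2 \<le> 2 * card G + card Z" using PG by (simp add: power2_eq_square)
  moreover have "4 * card Z \<le> N\<^sup>2" unfolding Z_def nm_def by (rule card_nonunits_le[OF N(1,2) big L])
  ultimately show ?thesis unfolding G_def nm_def by linarith
qed

text \<open>Coins yield pairs below a power of 2 rather than below \<open>N\<close>, and the norm is
  formed from \<open>2 * u + 1\<close> and \<open>2 * v\<close>. As 2 is invertible modulo the odd
  \<open>N\<close>, every residue pair is still reached; and
  \<open>2 ^ floorlog 2 N \<le> 2 * N\<close> costs a factor of at most 4, so the proportion 3/8
  becomes 3/32, more than 1/16.\<close>

lemma card_witnesses:
  assumes N: "N > 0" "odd N" "\<not> sum_of_two_squares N"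
    and big: "\<And>p. prime p \<Longrightarrow> p dvd N \<Longrightarrow> 8 * L \<le> p" and L: "floorlog 2 N \<le> L"
  shows "4 ^ floorlog 2 N \<le> 16 * card {(u, v). u < 2 ^ floorlog 2 N \<and> v < 2 ^ floorlog 2 N \<and>
      coprime (norm_pair u v) N \<and> jacobi3 N (int (norm_pair u v)) = -1}" (is "_ \<le> 16 * card ?W")
proof -
  define nm where "nm = (\<lambda>x y. (int x)\<^sup>2 + (int y)\<^sup>2)"
  define G where "G = {(x, y). x < N \<and> y < N \<and> coprime (nm x y) (int N) \<and> jacobi3 N (nm x y) = -1}"
  define f where "f = (\<lambda>(u, v). ((2 * u + 1) mod N, 2 * v mod N))"
  have l: "2 ^ (floorlog 2 N - 1) \<le> N" "N < 2 ^ floorlog 2 N" "floorlog 2 N > 0"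
    using floorlog_bounds[of N 2] floorlog_pos[OF N(1)] N(1) by auto
  have finW: "finite ?W"
    by (rule finite_subset[of _ "{..<2 ^ floorlog 2 N} \<times> {..<2 ^ floorlog 2 N}"]) auto
  have "G \<subseteq> f ` ?W"
  proof
    fix z assume z: "z \<in> G"
    obtain x y where xy: "z = (x, y)" by (cases z)
    \<comment> \<open>\<open>h\<close> is the inverse of 2 modulo \<open>N\<close>, and
      \<open>x + (N - 1)\<close> below stands for \<open>x - 1\<close> without leaving the natural
      numbers.\<close>
    define h where "h = (N + 1) div 2"
    have h: "2 * h = N + 1" using N(2) by (simp add: h_def)
    define u v where "u = (x + (N - 1)) * h mod N" and "v = y * h mod N"
    have "[2 * u + 1 = 2 * ((x + (N - 1)) * h) + 1] (mod N)"
      unfolding u_def by (intro cong_add cong_mult) (auto simp: unique_euclidean_semiring_class.cong_def)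
    also have "2 * ((x + (N - 1)) * h) + 1 = (x + (N - 1)) * (2 * h) + 1" by (simp add: mult.left_commute)
    also have "\<dots> = (x + (N - 1)) * (N + 1) + 1" unfolding h ..
    also have "\<dots> = x + N * (x + N)" using N(1) by (cases N) (auto simp: algebra_simps)
    also have "[x + N * (x + N) = x] (mod N)" by (simp add: unique_euclidean_semiring_class.cong_def)
    finally have ux: "[2 * u + 1 = x] (mod N)" .
    have "[2 * v = 2 * (y * h)] (mod N)"
      unfolding v_def by (intro cong_mult) (auto simp: unique_euclidean_semiring_class.cong_def)
    also have "2 * (y * h) = y * (2 * h)" by (simp add: mult.left_commute)
    also have "\<dots> = y + N * y" unfolding h by simp
    also have "[y + N * y = y] (mod N)" by (simp add: unique_euclidean_semiring_class.cong_def)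
    finally have vy: "[2 * v = y] (mod N)" .
    have G: "x < N" "y < N" "coprime (nm x y) (int N)" "jacobi3 N (nm x y) = -1" using z by (auto simp: G_def xy)
    have "[norm_pair u v = x\<^sup>2 + y\<^sup>2] (mod N)" by (intro cong_add cong_pow ux vy)
    hence "[int (norm_pair u v) = int (x\<^sup>2 + y\<^sup>2)] (mod int N)" by (subst cong_int_iff)
    hence c: "[int (norm_pair u v) = nm x y] (mod int N)" by (simp add: nm_def)
    have "coprime (int (norm_pair u v)) (int N)" using cong_imp_coprime[OF cong_sym[OF c] G(3)] .
    hence "coprime (norm_pair u v) N" by (simp only: coprime_int_iff)
    moreover have "jacobi3 N (int (norm_pair u v)) = -1" using jacobi3_cong[OF c] G(4) by simp
    moreover have "u < N" "v < N" using N(1) by (auto simp: u_def v_def)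
    ultimately have "(u, v) \<in> ?W" using l(2) by auto
    moreover have "f (u, v) = z" using ux vy G(1,2) by (simp add: f_def xy unique_euclidean_semiring_class.cong_def)
    ultimately show "z \<in> f ` ?W" by force
  qed
  hence "card G \<le> card ?W" by (rule surj_card_le[OF finW])
  moreover have "3 * N\<^sup>2 \<le> 8 * card G" unfolding G_def nm_def by (rule card_witness_residues[OF N big L])
  moreover have "4 ^ floorlog 2 N \<le> 4 * N\<^sup>2"
  proof -
    have "(2 ^ floorlog 2 N :: nat) = 2 * 2 ^ (floorlog 2 N - 1)" using l(3) by (cases "floorlog 2 N") auto
    hence "(2 ^ floorlog 2 N :: nat) \<le> 2 * N" using l(1) by simp
    hence "(2 ^ floorlog 2 N :: nat)\<^sup>2 \<le> (2 * N)\<^sup>2" by (intro power_mono) auto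
    moreover have "(2 ^ floorlog 2 N :: nat)\<^sup>2 = 4 ^ floorlog 2 N" by (simp flip: power_mult_distrib power_mult add: power2_eq_square)
    ultimately show ?thesis by (simp add: power_mult_distrib)
  qed
  ultimately show ?thesis by linarith
qed

subsection \<open>A program logic with running times\<close>

text \<open>The size of a result is at most the sum of the sizes of the operands
  (\<open>int_size_arith\<close>), so sizes add up along an expression.\<close>

fun size_factor :: "aexp \<Rightarrow> nat" where
  "size_factor (Num c) = int_size c"
| "size_factor (Reg i) = 1"
| "size_factor (Op f a b) = size_factor a + size_factor b"

fun cost_factor :: "aexp \<Rightarrow> nat" where
  "cost_factor (Num c) = int_size c"
| "cost_factor (Reg i) = 1"
| "cost_factor (Op f a b) = cost_factor a + cost_factor b + size_factor a + size_factor b"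

fun cmd_factor :: "cmd \<Rightarrow> nat" where
  "cmd_factor (Assign i a) = cost_factor a + 1"
| "cmd_factor (Seq c d) = cmd_factor c + cmd_factor d"
| "cmd_factor (Cond a c d) = cost_factor a + 1 + cmd_factor c + cmd_factor d"
| "cmd_factor (While a c) = cost_factor a + 1 + cmd_factor c"
| "cmd_factor _ = 1"

fun loop_depth :: "cmd \<Rightarrow> nat" where
  "loop_depth (Seq c d) = max (loop_depth c) (loop_depth d)"
| "loop_depth (Cond a c d) = max (loop_depth c) (loop_depth d)"
| "loop_depth (While a c) = Suc (loop_depth c)"
| "loop_depth _ = 0"

definition bounded_store :: "nat \<Rightarrow> store \<Rightarrow> bool" where
  "bounded_store S s \<longleftrightarrow> (\<forall>i. \<bar>s i\<bar> < 2 ^ S)"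

text \<open>If all registers keep at most \<open>S\<close> bits and every loop makes fewer than \<open>F\<close> iterations, the
  running time is bounded by an expression that depends on the syntax of the program only.\<close>

definition time_bound :: "nat \<Rightarrow> nat \<Rightarrow> cmd \<Rightarrow> nat" where
  "time_bound S F c = cmd_factor c * (S + 1) * F ^ loop_depth c"

text \<open>Total correctness with a time bound; \<open>Q\<close> also speaks of the coins left
  over. The bounds \<open>S\<close> and \<open>F\<close> are shared by a whole program, so that
  correctness proofs never have to add up running times.\<close>

definition runs :: "oracle_fun \<Rightarrow> nat \<Rightarrow> nat \<Rightarrow> cmd \<Rightarrow> store \<Rightarrow> bool list \<Rightarrow> (store \<Rightarrow> bool list \<Rightarrow> bool) \<Rightarrow> bool" where
  "runs orc S F c s bs Q \<longleftrightarrow> (\<exists>t s' bs'. exec orc c s bs t s' bs' \<and> t \<le> time_bound S F c \<and> Q s' bs')"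

lemma int_size_le_iff: "int_size x \<le> Suc k \<longleftrightarrow> \<bar>x\<bar> < 2 ^ k"
proof -
  have "floorlog 2 n \<le> k \<longleftrightarrow> n < 2 ^ k" for n
  proof
    assume "floorlog 2 n \<le> k"
    thus "n < 2 ^ k" using floorlog_bounds[of n 2]
      by (cases "n = 0") (auto intro: order.strict_trans2 power_increasing)
  next
    assume n: "n < 2 ^ k"
    show "floorlog 2 n \<le> k"
    proof (cases "n = 0")
      case False
      hence "2 ^ (floorlog 2 n - 1) \<le> n" using floorlog_bounds[of n 2] by simp
      hence "(2::nat) ^ (floorlog 2 n - 1) < 2 ^ k" using n by linarith
      hence "floorlog 2 n - 1 < k" by simp
      thus ?thesis by simp
    qed (simp add: floorlog_def)
  qed
  moreover have "nat \<bar>x\<bar> < 2 ^ k \<longleftrightarrow> \<bar>x\<bar> < 2 ^ k" by (simp add: nat_less_iff)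
  ultimately show ?thesis by (simp add: int_size_def)
qed

lemma int_size_le: "\<bar>x\<bar> < 2 ^ k \<Longrightarrow> int_size x \<le> Suc k"
  by (simp add: int_size_le_iff)

lemma abs_less_int_size: "\<bar>x\<bar> < 2 ^ (int_size x - 1)"
proof -
  have "int_size x = Suc (int_size x - 1)" by (simp add: int_size_def)
  thus ?thesis using int_size_le_iff[of x "int_size x - 1"] by simp
qed

lemma int_size_ge_1: "int_size x \<ge> 1"
  by (simp add: int_size_def)

text \<open>The digit charged for the sign pays for the carry of an addition. Division by 0 is
  covered too, as it yields 0 with the dividend as remainder.\<close>

lemma int_size_arith: "int_size (arith_val f x y) \<le> int_size x + int_size y"
proof -
  define a where "a = int_size x - 1"
  define b where "b = int_size y - 1"
  have ab: "int_size x = Suc a" "int_size y = Suc b" using int_size_ge_1[of x] int_size_ge_1[of y] by (simp_all add: a_def b_def)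
  have xy: "\<bar>x\<bar> < 2 ^ a" "\<bar>y\<bar> < 2 ^ b" using abs_less_int_size[of x] abs_less_int_size[of y] by (simp_all add: a_def b_def)
  have p: "(2::int) ^ a \<ge> 1" "(2::int) ^ b \<ge> 1" by simp_all
  define c :: int where "c = 2 ^ (a + b)"
  have le: "2 ^ a \<le> c" "2 ^ b \<le> c" by (simp_all add: c_def power_increasing)
  have pc: "2 ^ (a + b + 1) = 2 * c" by (simp add: c_def)
  have dv: "\<bar>x div y\<bar> \<le> \<bar>x\<bar>"
  proof (cases "y = 0")
    case False
    have 1: "\<bar>m div n\<bar> \<le> \<bar>m\<bar>" if "n > 0" for m n :: int
    proof (cases "m \<ge> 0")
      case True
      have "m div n \<le> m" using zdiv_mono2[of m 1 n] True that by simp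
      thus ?thesis using True that by (simp add: pos_imp_zdiv_nonneg_iff)
    next
      case False
      have "m \<le> m div n" using zdiv_mono2_neg[of m 1 n] that False by simp
      moreover have "m div n < 0" using False that by (simp add: pos_imp_zdiv_neg_iff)
      ultimately show ?thesis by simp
    qed
    show ?thesis
    proof (cases "y > 0")
      case True
      thus ?thesis by (rule 1)
    next
      case False
      hence "\<bar>(-x) div (-y)\<bar> \<le> \<bar>-x\<bar>" using \<open>y \<noteq> 0\<close> by (intro 1) auto
      thus ?thesis by simp
    qed
  qed simp
  have md: "\<bar>x mod y\<bar> \<le> max \<bar>x\<bar> \<bar>y\<bar>"
  proof (cases "y = 0")
    case False
    thus ?thesis using abs_mod_less[of y x] by simp
  qed simp
  have "\<bar>arith_val f x y\<bar> < 2 ^ (a + b + 1)"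
  proof (cases f)
    case Add
    show ?thesis unfolding Add arith_val.simps pc using xy le by linarith
  next
    case Sub
    show ?thesis unfolding Sub arith_val.simps pc using xy le by linarith
  next
    case Mul
    have "\<bar>x * y\<bar> < 2 ^ a * 2 ^ b" unfolding abs_mult by (rule mult_strict_mono) (use xy p in auto)
    hence "\<bar>x * y\<bar> < c" by (simp add: c_def power_add)
    thus ?thesis unfolding Mul arith_val.simps pc by linarith
  next
    case Quo
    show ?thesis unfolding Quo arith_val.simps pc using dv xy le p by linarith
  next
    case Rem
    show ?thesis unfolding Rem arith_val.simps pc using md xy le p by linarith
  qed
  hence "int_size (arith_val f x y) \<le> Suc (a + b + 1)" by (rule int_size_le)
  thus ?thesis using ab by simp
qed

lemma int_size_aval:
  assumes "bounded_store S s"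
  shows "int_size (aval a s) \<le> size_factor a * (S + 1)"
proof (induction a)
  case (Reg i)
  thus ?case using assms int_size_le[of "s i" S] by (simp add: bounded_store_def)
next
  case (Op f a b)
  have "int_size (aval (Op f a b) s) \<le> int_size (aval a s) + int_size (aval b s)"
    by (simp add: int_size_arith)
  also have "\<dots> \<le> size_factor a * (S + 1) + size_factor b * (S + 1)" by (rule add_mono[OF Op])
  finally show ?case by (simp add: algebra_simps)
qed simp

lemma acost_le:
  assumes "bounded_store S s"
  shows "acost a s \<le> cost_factor a * (S + 1)"
proof (induction a)
  case (Reg i)
  thus ?case using assms int_size_le[of "s i" S] by (simp add: bounded_store_def)
next
  case (Op f a b)
  have "acost (Op f a b) s \<le> cost_factor a * (S + 1) + cost_factor b * (S + 1) + size_factor a * (S + 1) + size_factor b * (S + 1)"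
    unfolding acost.simps by (intro add_mono Op int_size_aval assms)
  thus ?case by (simp add: algebra_simps)
qed simp

lemma runs_mono: "runs orc S F c s bs Q \<Longrightarrow> (\<And>s bs. Q s bs \<Longrightarrow> Q' s bs) \<Longrightarrow> runs orc S F c s bs Q'"
  unfolding runs_def by blast

lemma runs_Skip: "Q s bs \<Longrightarrow> runs orc S F Skip s bs Q"
  unfolding runs_def using exec.Skip by (fastforce simp: time_bound_def)

lemma runs_Assign:
  assumes "bounded_store S s" "Q (s(i := aval a s)) bs"
  shows "runs orc S F (Assign i a) s bs Q"
  unfolding runs_def
proof (intro exI conjI)
  show "exec orc (Assign i a) s bs (acost a s + 1) (s(i := aval a s)) bs" by (rule exec.Assign)
  show "acost a s + 1 \<le> time_bound S F (Assign i a)" using acost_le[OF assms(1), of a] by (simp add: time_bound_def)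
qed (rule assms)

lemma runs_Toss: "bs = b # bs' \<Longrightarrow> Q (s(i := of_bool b)) bs' \<Longrightarrow> runs orc S F (Toss i) s bs Q"
  unfolding runs_def using exec.Toss[of orc i s b bs'] by (fastforce simp: time_bound_def)

lemma runs_Query: "Q (s(i := orc (nat (s j)) (nat (s l)))) bs \<Longrightarrow> runs orc S F (Query i j l) s bs Q"
  unfolding runs_def using exec.Query[of orc i j l s bs] by (fastforce simp: time_bound_def)

lemma time_bound_depth_mono:
  assumes "F > 0" "loop_depth c \<le> n"
  shows "time_bound S F c \<le> cmd_factor c * (S + 1) * F ^ n"
  unfolding time_bound_def using assms by (intro mult_left_mono power_increasing) auto

text \<open>Weakest precondition style: the run of \<open>d\<close> is the postcondition of
  \<open>c\<close>, so no intermediate assertion has to be invented.\<close>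

lemma runs_Seq:
  assumes "F > 0" "runs orc S F c s bs (\<lambda>s' bs'. runs orc S F d s' bs' Q)"
  shows "runs orc S F (Seq c d) s bs Q"
proof -
  obtain t s' bs' u s'' bs'' where 1: "exec orc c s bs t s' bs'" "t \<le> time_bound S F c"
     "exec orc d s' bs' u s'' bs''" "u \<le> time_bound S F d" "Q s'' bs''"
    using assms(2) by (auto simp: runs_def)
  have "t + u \<le> cmd_factor c * (S + 1) * F ^ loop_depth (Seq c d) + cmd_factor d * (S + 1) * F ^ loop_depth (Seq c d)"
    using 1(2,4) time_bound_depth_mono[OF assms(1), of c "loop_depth (Seq c d)" S]
      time_bound_depth_mono[OF assms(1), of d "loop_depth (Seq c d)" S] by (intro add_mono) auto
  hence "t + u \<le> time_bound S F (Seq c d)" by (simp add: time_bound_def algebra_simps)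
  thus ?thesis unfolding runs_def using exec.Seq[OF 1(1,3)] 1(5) by blast
qed

lemma runs_Cond:
  assumes "F > 0" "bounded_store S s" "aval a s > 0 \<Longrightarrow> runs orc S F c s bs Q" "\<not> aval a s > 0 \<Longrightarrow> runs orc S F d s bs Q"
  shows "runs orc S F (Cond a c d) s bs Q"
proof -
  define n where "n = loop_depth (Cond a c d)"
  have F: "F ^ n > 0" using assms(1) by simp
  have ca: "acost a s + 1 \<le> (cost_factor a + 1) * (S + 1) * F ^ n"
  proof -
    have "acost a s + 1 \<le> (cost_factor a + 1) * (S + 1) * 1" using acost_le[OF assms(2), of a] by simp
    also have "\<dots> \<le> (cost_factor a + 1) * (S + 1) * F ^ n" by (rule mult_le_mono2) (use F in linarith)
    finally show ?thesis .
  qed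
  have tc: "time_bound S F c \<le> cmd_factor c * (S + 1) * F ^ n" "time_bound S F d \<le> cmd_factor d * (S + 1) * F ^ n"
    by (rule time_bound_depth_mono[OF assms(1)], simp add: n_def)+
  have tb: "time_bound S F (Cond a c d) = (cost_factor a + 1) * (S + 1) * F ^ n + cmd_factor c * (S + 1) * F ^ n + cmd_factor d * (S + 1) * F ^ n"
    unfolding time_bound_def n_def[symmetric] by (simp add: algebra_simps)
  show ?thesis
  proof (cases "aval a s > 0")
    case True
    obtain t s' bs' where 1: "exec orc c s bs t s' bs'" "t \<le> time_bound S F c" "Q s' bs'"
      using assms(3)[OF True] by (auto simp: runs_def)
    have "acost a s + 1 + t \<le> time_bound S F (Cond a c d)" using ca tc 1(2) tb by linarith
    thus ?thesis unfolding runs_def using exec.CondTrue[OF True 1(1)] 1(3) by blast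
  next
    case False
    obtain t s' bs' where 1: "exec orc d s bs t s' bs'" "t \<le> time_bound S F d" "Q s' bs'"
      using assms(4)[OF False] by (auto simp: runs_def)
    have "acost a s + 1 + t \<le> time_bound S F (Cond a c d)" using ca tc 1(2) tb by linarith
    thus ?thesis unfolding runs_def using exec.CondFalse[OF False 1(1)] 1(3) by blast
  qed
qed

text \<open>The number in the invariant is a variant that bounds the remaining iterations. The bound
  \<open>n < F\<close> is strict because a loop with \<open>n\<close> iterations evaluates its test
  \<open>n + 1\<close> times.\<close>

lemma runs_While:
  assumes F: "n < F" and I: "I n s bs"
    and bnd: "\<And>n s bs. I n s bs \<Longrightarrow> bounded_store S s"
    and step: "\<And>n s bs. I n s bs \<Longrightarrow> aval a s > 0 \<Longrightarrow> runs orc S F c s bs (\<lambda>s' bs'. \<exists>m<n. I m s' bs')"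
    and leave: "\<And>n s bs. I n s bs \<Longrightarrow> \<not> aval a s > 0 \<Longrightarrow> Q s bs"
  shows "runs orc S F (While a c) s bs Q"
proof -
  define B where "B = cost_factor a * (S + 1) + 1 + time_bound S F c"
  have "\<exists>t s' bs'. exec orc (While a c) s bs t s' bs' \<and> t \<le> (n + 1) * B \<and> Q s' bs'"
    using I
  proof (induction n arbitrary: s bs rule: less_induct)
    case (less n)
    have ca: "acost a s \<le> cost_factor a * (S + 1)" by (rule acost_le[OF bnd[OF less.prems]])
    show ?case
    proof (cases "aval a s > 0")
      case True
      obtain t s' bs' m where 1: "exec orc c s bs t s' bs'" "t \<le> time_bound S F c" "m < n" "I m s' bs'"
        using step[OF less.prems True] by (auto simp: runs_def)
      obtain u s'' bs'' where 2: "exec orc (While a c) s' bs' u s'' bs''" "u \<le> (m + 1) * B" "Q s'' bs''"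
        using less.IH[OF 1(3,4)] by blast
      have "(m + 1) * B \<le> n * B" using 1(3) by (intro mult_right_mono) auto
      hence "acost a s + 1 + t + u \<le> (n + 1) * B" using ca 1(2) 2(2) by (simp add: B_def)
      thus ?thesis using exec.WhileTrue[OF True 1(1) 2(1)] 2(3) by blast
    next
      case False
      have "acost a s + 1 \<le> (n + 1) * B" using ca by (simp add: B_def)
      thus ?thesis using exec.WhileFalse[OF False] leave[OF less.prems False] by blast
    qed
  qed
  moreover have "(n + 1) * B \<le> time_bound S F (While a c)"
  proof -
    define e where "e = F ^ loop_depth c"
    have "e > 0" using F by (simp add: e_def)
    have "B \<le> (cost_factor a * (S + 1) + (S + 1)) * e + cmd_factor c * (S + 1) * e"
    proof -
      have "cost_factor a * (S + 1) + 1 \<le> (cost_factor a * (S + 1) + (S + 1)) * 1" by simp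
      also have "\<dots> \<le> (cost_factor a * (S + 1) + (S + 1)) * e" using \<open>e > 0\<close> by (intro mult_left_mono) auto
      finally show ?thesis unfolding B_def time_bound_def e_def by simp
    qed
    hence "(n + 1) * B \<le> F * ((cost_factor a * (S + 1) + (S + 1)) * e + cmd_factor c * (S + 1) * e)"
      using F by (intro mult_mono) auto
    also have "\<dots> = time_bound S F (While a c)" by (simp add: time_bound_def e_def algebra_simps)
    finally show ?thesis .
  qed
  ultimately show ?thesis unfolding runs_def by (meson order_trans)
qed

lemma bounded_store_update: "bounded_store S s \<Longrightarrow> \<bar>x\<bar> < 2 ^ S \<Longrightarrow> bounded_store S (s(i := x))"
  by (simp add: bounded_store_def)

subsection \<open>The programs\<close>

text \<open>
  Register 0 holds \<open>N\<close> and loses its small prime factors, 1 the error parameter, 2 the trial divisor, 3 its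
  bound, 6 the size of \<open>N\<close>, 7 and 8 the pair \<open>(u, v)\<close>, 9 the number \<open>w = (2u+1)\<^sup>2 + (2v)\<^sup>2\<close>, and 17 the
  remaining rounds. Register 4 is the answer: it starts as 1 and is cleared by a witness. As tests are for
  positivity, the square of a difference tests for inequality, and \<open>1 - x mod y\<close> for divisibility.
\<close>

abbreviation "square_exp e \<equiv> Op Mul e e"

definition size_prog :: cmd where
  "size_prog = Seq (Assign 5 (Reg 0)) (Seq (Assign 6 (Num 0))
     (While (Reg 5) (Seq (Assign 5 (Op Quo (Reg 5) (Num 2))) (Assign 6 (Op Add (Reg 6) (Num 1))))))"

text \<open>Trial division up to \<open>8 floorlog 2 N\<close>. It removes the prime 2, and makes a random pair of
  residues a unit of \<open>\<int>[i] / N\<close> with probability at least \<open>3/4\<close>.\<close>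

definition strip_body :: cmd where
  "strip_body = Cond (Op Sub (Num 1) (Op Rem (Reg 0) (square_exp (Reg 2))))
     (Assign 0 (Op Quo (Reg 0) (square_exp (Reg 2))))
     (Cond (Op Sub (Num 1) (Op Rem (Reg 0) (Reg 2)))
        (Seq (Cond (Op Sub (Op Rem (Reg 2) (Num 4)) (Num 2)) (Assign 4 (Num 0)) Skip)
             (Assign 0 (Op Quo (Reg 0) (Reg 2))))
        (Assign 2 (Op Add (Reg 2) (Num 1))))"

definition strip_prog :: cmd where
  "strip_prog = Seq (Assign 3 (Op Mul (Num 8) (Reg 6))) (Seq (Assign 2 (Num 2)) (Seq (Assign 4 (Num 1))
     (While (Op Sub (Op Add (Reg 3) (Num 1)) (Reg 2)) strip_body)))"

definition gcd_loop :: cmd where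
  "gcd_loop = While (Reg 11) (Seq (Assign 12 (Op Rem (Reg 10) (Reg 11))) (Seq (Assign 10 (Reg 11)) (Assign 11 (Reg 12))))"

definition query_prog :: cmd where
  "query_prog = Seq (Assign 13 (square_exp (Reg 9))) (Seq (Assign 14 (square_exp (Reg 0)))
     (Seq (Query 15 0 13) (Seq (Query 16 9 14)
       (Cond (square_exp (Op Sub (Reg 15) (Reg 16))) (Assign 4 (Num 0)) Skip))))"

text \<open>The gcd keeps both queries inside the promise of the problem: only on coprime arguments
  is the answer determined.\<close>

definition test_prog :: cmd where
  "test_prog = Seq (Assign 9 (Op Add (square_exp (Op Add (Op Mul (Num 2) (Reg 7)) (Num 1))) (square_exp (Op Mul (Num 2) (Reg 8)))))
     (Seq (Assign 10 (Reg 9)) (Seq (Assign 11 (Reg 0)) (Seq gcd_loop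
       (Cond (Op Sub (Num 2) (Reg 10)) query_prog Skip))))"

text \<open>Halving a copy of \<open>N\<close> runs the loop once per binary digit, so
  \<open>u\<close> and \<open>v\<close> each receive \<open>floorlog 2 N\<close> fair bits, in
  alternation.\<close>

definition draw_prog :: cmd where
  "draw_prog = Seq (Assign 5 (Reg 0)) (Seq (Assign 7 (Num 0)) (Seq (Assign 8 (Num 0))
     (While (Reg 5) (Seq (Toss 18) (Seq (Assign 7 (Op Add (Op Mul (Num 2) (Reg 7)) (Reg 18)))
       (Seq (Toss 18) (Seq (Assign 8 (Op Add (Op Mul (Num 2) (Reg 8)) (Reg 18)))
         (Assign 5 (Op Quo (Reg 5) (Num 2))))))))))"

section \<open>Correctness and running time of the programs\<close>

definition agree :: "nat set \<Rightarrow> store \<Rightarrow> store \<Rightarrow> bool" where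
  "agree X s s' \<longleftrightarrow> (\<forall>i. i \<notin> X \<longrightarrow> s' i = s i)"

lemma agree_refl [simp]: "agree X s s"
  by (simp add: agree_def)

lemma agree_update [simp]: "i \<in> X \<Longrightarrow> agree X s (s'(i := x)) \<longleftrightarrow> agree X s s'"
  by (auto simp: agree_def)

lemma agreeD: "agree X s s' \<Longrightarrow> i \<notin> X \<Longrightarrow> s' i = s i"
  by (simp add: agree_def)

lemma floorlog_half: "r > 0 \<Longrightarrow> floorlog 2 r = Suc (floorlog 2 (r div 2))"
  by (subst compute_floorlog) simp

lemma floorlog_2_le: "floorlog 2 n \<le> n"
proof (induction n rule: less_induct)
  case (less n)
  show ?case
  proof (cases "n = 0")
    case False
    hence "floorlog 2 (n div 2) \<le> n div 2" by (intro less.IH) auto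
    thus ?thesis using floorlog_half[of n] False by simp
  qed (simp add: floorlog_def)
qed

lemma floorlog_2_mono: "m \<le> n \<Longrightarrow> floorlog 2 m \<le> floorlog 2 n"
  by (simp add: floorlog_mono)

lemma size_prog_runs:
  assumes bnd: "bounded_store S s" and N: "s 0 = int N" and F: "floorlog 2 N < F"
  shows "runs orc S F size_prog s bs (\<lambda>s' bs'. bs' = bs \<and> bounded_store S s' \<and> agree {5, 6} s s' \<and>
      s' 6 = int (floorlog 2 N))"
proof -
  have F0: "F > 0" using F by simp
  have NS: "int N < 2 ^ S" using bnd N by (auto simp: bounded_store_def dest: spec[of _ 0])
  have LS: "int (floorlog 2 N) < 2 ^ S" using floorlog_2_le[of N] NS by linarith
  define I where "I = (\<lambda>n s' bs'. bs' = bs \<and> bounded_store S s' \<and> agree {5, 6} s s' \<and>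
      (\<exists>r. s' 5 = int r \<and> n = floorlog 2 r \<and> n \<le> floorlog 2 N \<and> s' 6 = int (floorlog 2 N - n)))"
  have loop: "runs orc S F (While (Reg 5) (Seq (Assign 5 (Op Quo (Reg 5) (Num 2))) (Assign 6 (Op Add (Reg 6) (Num 1)))))
      (s(5 := int N, 6 := 0)) bs (\<lambda>s' bs'. bs' = bs \<and> bounded_store S s' \<and> agree {5, 6} s s' \<and> s' 6 = int (floorlog 2 N))"
  proof (rule runs_While[where I = I, OF F])
    show "I (floorlog 2 N) (s(5 := int N, 6 := 0)) bs"
      unfolding I_def using bnd NS by (auto intro!: bounded_store_update)
    fix n s' bs' assume I: "I n s' bs'"
    then obtain r where r: "bs' = bs" "bounded_store S s'" "agree {5, 6} s s'" "s' 5 = int r" "n = floorlog 2 r"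
      "n \<le> floorlog 2 N" "s' 6 = int (floorlog 2 N - n)" by (auto simp: I_def)
    show "bounded_store S s'" by (rule r)
    have rS: "int r < 2 ^ S" using r(2,4) by (auto simp: bounded_store_def dest: spec[of _ 5])
    show "runs orc S F (Seq (Assign 5 (Op Quo (Reg 5) (Num 2))) (Assign 6 (Op Add (Reg 6) (Num 1)))) s' bs' (\<lambda>s' bs'. \<exists>m<n. I m s' bs')"
      if "aval (Reg 5) s' > 0"
    proof -
      have "r > 0" using that r(4) by simp
      have fl: "floorlog 2 r = Suc (floorlog 2 (r div 2))" by (rule floorlog_half[OF \<open>r > 0\<close>])
      define s1 where "s1 = s'(5 := int (r div 2))"
      have b1: "bounded_store S s1" unfolding s1_def using rS r(2) by (intro bounded_store_update) auto
      have "I (n - 1) (s1(6 := s1 6 + 1)) bs"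
        unfolding I_def
      proof (intro conjI exI[of _ "r div 2"])
        show "bounded_store S (s1(6 := s1 6 + 1))"
        proof (rule bounded_store_update[OF b1])
          have "s1 6 = int (floorlog 2 N - n)" using r by (simp add: s1_def)
          thus "\<bar>s1 6 + 1\<bar> < 2 ^ S" using LS r(5,6) fl by linarith
        qed
      qed (use r fl in \<open>auto simp: s1_def\<close>)
      hence "\<exists>m<n. I m (s1(6 := s1 6 + 1)) bs" using fl r(5) by (intro exI[of _ "n - 1"]) auto
      moreover have "s'(5 := aval (Op Quo (Reg 5) (Num 2)) s') = s1" by (simp add: s1_def r(4) zdiv_int)
      ultimately show ?thesis
        using b1 r(1,2) by (intro runs_Seq[OF F0] runs_Assign) simp_all
    qed
    show "bs' = bs \<and> bounded_store S s' \<and> agree {5, 6} s s' \<and> s' 6 = int (floorlog 2 N)" if "\<not> aval (Reg 5) s' > 0"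
    proof -
      have "r = 0" using that r(4) by simp
      hence "n = 0" using r(5) by (simp add: floorlog_def)
      thus ?thesis using r by simp
    qed
  qed
  have "bounded_store S (s(5 := int N))" using bnd NS by (intro bounded_store_update) auto
  thus ?thesis unfolding size_prog_def using loop bnd N
    by (intro runs_Seq[OF F0] runs_Assign) (simp_all)
qed

text \<open>\<open>d\<close> is a lower bound for the prime factors left. Once the answer in
  register 4 is 0 it is final, and \<open>M\<close> no longer has to agree with \<open>N\<close> on
  being a sum of two squares.\<close>

definition strip_inv :: "nat \<Rightarrow> nat \<Rightarrow> store \<Rightarrow> bool" where
  "strip_inv N d s \<longleftrightarrow> (\<exists>M>0. s 0 = int M \<and> M \<le> N \<and> (\<forall>p. prime p \<and> p dvd M \<longrightarrow> d \<le> p) \<and>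
     (s 4 = 1 \<and> (sum_of_two_squares M \<longleftrightarrow> sum_of_two_squares N) \<or> s 4 = 0 \<and> \<not> sum_of_two_squares N))"

text \<open>Either \<open>M\<close> loses a binary digit or the divisor advances, which makes the
  sum of the remaining range and \<open>floorlog 2 M\<close> a variant.\<close>

definition strip_step :: "nat \<Rightarrow> nat \<Rightarrow> nat \<Rightarrow> store \<Rightarrow> bool" where
  "strip_step N d M s \<longleftrightarrow> (\<exists>d' M'. s 2 = int d' \<and> s 0 = int M' \<and> strip_inv N d' s \<and>
     (d' = d \<and> floorlog 2 M' < floorlog 2 M \<or> d' = Suc d \<and> M' = M))"

lemma strip_stepI:
  assumes "s 2 = int d'" "s 0 = int M'" "strip_inv N d' s"
    "d' = d \<and> floorlog 2 M' < floorlog 2 M \<or> d' = Suc d \<and> M' = M"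
  shows "strip_step N d M s"
  using assms unfolding strip_step_def by blast

text \<open>Spares the program a primality test: smaller primes have already been removed, so a
  trial divisor that divides is prime.\<close>

lemma smallest_divisor_prime:
  fixes d M :: nat
  assumes "d dvd M" "d \<ge> 2" "\<And>p. prime p \<Longrightarrow> p dvd M \<Longrightarrow> d \<le> p"
  shows "prime d"
proof -
  obtain p where p: "prime p" "p dvd d" using prime_factor_nat[of d] assms(2) by auto
  have "d \<le> p" using assms(1,3) p dvd_trans by blast
  moreover have "p \<le> d" using p(2) assms(2) by (intro dvd_imp_le) auto
  ultimately show ?thesis using p(1) by simp
qed

lemma strip_body_runs:
  assumes F0: "F > 0" and bnd: "bounded_store S s" and d: "s 2 = int d" "d \<ge> 2" "int d + 1 < 2 ^ S"
    and M: "s 0 = int M" and inv: "strip_inv N d s"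
  shows "runs orc S F strip_body s bs (\<lambda>s' bs'. bs' = bs \<and> bounded_store S s' \<and> agree {0, 2, 4} s s' \<and> strip_step N d M s')"
proof -
  from inv M have Mp: "M > 0" and MN: "M \<le> N" and pr: "\<And>p. prime p \<Longrightarrow> p dvd M \<Longrightarrow> d \<le> p"
    and fl: "s 4 = 1 \<and> (sum_of_two_squares M \<longleftrightarrow> sum_of_two_squares N) \<or> s 4 = 0 \<and> \<not> sum_of_two_squares N"
    by (auto simp: strip_inv_def)
  have MS: "int M < 2 ^ S" using bnd M by (auto simp: bounded_store_def dest: spec[of _ 0])
  have "(2::int) ^ 1 < 2 ^ S" using d by simp
  hence one: "(1::int) < 2 ^ S" by simp
  have shrink: "floorlog 2 (M div e) < floorlog 2 M" if "e dvd M" "e \<ge> 2" for e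
  proof -
    have "M div e \<le> M div 2" using that by (intro div_le_mono2) auto
    hence "floorlog 2 (M div e) \<le> floorlog 2 (M div 2)" by (rule floorlog_2_mono)
    thus ?thesis using floorlog_half[OF Mp] by simp
  qed
  have dS: "int (M div e) < 2 ^ S" for e using MS div_le_dividend[of M e] by linarith
  show ?thesis
    unfolding strip_body_def
  proof (rule runs_Cond[OF F0 bnd])
    assume "aval (Op Sub (Num 1) (Op Rem (Reg 0) (square_exp (Reg 2)))) s > 0"
    hence "int M mod (int d * int d) < 1" by (simp add: d M)
    hence "int (M mod (d * d)) < 1" by (simp add: zmod_int)
    hence dd: "d * d dvd M" by (simp add: dvd_eq_mod_eq_0)
    define M' where "M' = M div (d * d)"
    have MM': "M = d\<^sup>2 * M'" using dd by (simp add: M'_def power2_eq_square)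
    have M'p: "M' > 0" using MM' Mp by (auto intro!: Nat.gr0I)
    have S': "sum_of_two_squares M \<longleftrightarrow> sum_of_two_squares M'"
      unfolding MM' by (rule two_squares_div_square) (use M'p d in auto)
    have pr': "d \<le> p" if "prime p" "p dvd M'" for p using pr[OF that(1)] that(2) MM' by simp
    have M'N: "M' \<le> N" unfolding M'_def using MN div_le_dividend[of M "d * d"] by linarith
    have v: "aval (Op Quo (Reg 0) (square_exp (Reg 2))) s = int M'" by (simp add: d M M'_def zdiv_int)
    have si: "strip_inv N d (s(0 := int M'))"
      unfolding strip_inv_def using M'p M'N pr' fl S' by (intro exI[of _ M']) auto
    show "runs orc S F (Assign 0 (Op Quo (Reg 0) (square_exp (Reg 2)))) s bs (\<lambda>s' bs'. bs' = bs \<and> bounded_store S s' \<and> agree {0, 2, 4} s s' \<and> strip_step N d M s')"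
    proof (rule runs_Assign[OF bnd], unfold v, intro conjI strip_stepI[of _ d M'])
      show "bounded_store S (s(0 := int M'))" using bnd dS by (intro bounded_store_update) (auto simp: M'_def)
      have "d \<le> d * d" by simp
      hence "d * d \<ge> 2" using d(2) by linarith
      thus "d = d \<and> floorlog 2 M' < floorlog 2 M \<or> d = Suc d \<and> M' = M" unfolding M'_def using shrink[OF dd] by simp
    qed (use d si in auto)
  next
    assume ndd: "\<not> aval (Op Sub (Num 1) (Op Rem (Reg 0) (square_exp (Reg 2)))) s > 0"
    have ndd: "\<not> d * d dvd M"
    proof
      assume "d * d dvd M"
      hence "int M mod (int d * int d) = 0" by (metis dvd_imp_mod_0 of_nat_dvd_iff of_nat_mult)
      thus False using ndd by (simp add: d M)
    qed
    show "runs orc S F (Cond (Op Sub (Num 1) (Op Rem (Reg 0) (Reg 2)))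
        (Seq (Cond (Op Sub (Op Rem (Reg 2) (Num 4)) (Num 2)) (Assign 4 (Num 0)) Skip)
             (Assign 0 (Op Quo (Reg 0) (Reg 2))))
        (Assign 2 (Op Add (Reg 2) (Num 1)))) s bs (\<lambda>s' bs'. bs' = bs \<and> bounded_store S s' \<and> agree {0, 2, 4} s s' \<and> strip_step N d M s')" (is "runs _ _ _ _ _ _ ?Q")
    proof (rule runs_Cond[OF F0 bnd])
      assume "aval (Op Sub (Num 1) (Op Rem (Reg 0) (Reg 2))) s > 0"
      hence "int M mod int d < 1" by (simp add: d M)
      hence "int (M mod d) < 1" by (simp add: zmod_int)
      hence dM: "d dvd M" by (simp add: dvd_eq_mod_eq_0)
      have dp: "prime d" by (rule smallest_divisor_prime[OF dM d(2) pr])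
      define M' where "M' = M div d"
      have MM': "M = d * M'" using dM by (simp add: M'_def)
      have M'p: "M' > 0" using MM' Mp by (auto intro!: Nat.gr0I)
      \<comment> \<open>As the test for \<open>d * d\<close> has failed, \<open>d\<close> divides
        \<open>M\<close> exactly once, which rules out a sum of two squares if \<open>d\<close> is 3
        modulo 4.\<close>
      have ndM': "\<not> d dvd M'" using ndd MM' by (metis dvd_refl mult_dvd_mono)
      have pr': "d \<le> p" if "prime p" "p dvd M'" for p using pr[OF that(1)] that(2) MM' by simp
      have M'N: "M' \<le> N" unfolding M'_def using MN div_le_dividend[of M d] by linarith
      have fin: "?Q (t(0 := int M')) bs" if t: "t = s \<and> d mod 4 \<noteq> 3 \<or> t = s(4 := 0) \<and> d mod 4 = 3" for t
      proof (intro conjI strip_stepI[of _ d M'])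
        have "bounded_store S t" using t bnd by (auto intro!: bounded_store_update)
        thus "bounded_store S (t(0 := int M'))" using dS by (intro bounded_store_update) (auto simp: M'_def)
        show "agree {0, 2, 4} s (t(0 := int M'))" using t by auto
        show "(t(0 := int M')) 2 = int d" using t d by auto
        show "d = d \<and> floorlog 2 M' < floorlog 2 M \<or> d = Suc d \<and> M' = M" unfolding M'_def using shrink[OF dM d(2)] by simp
        show "strip_inv N d (t(0 := int M'))"
        proof (cases "d mod 4 = 3")
          case True
          hence "\<not> sum_of_two_squares M" using two_squares_mult_prime(2)[OF M'p dp True ndM'] MM' by simp
          hence "\<not> sum_of_two_squares N" using fl by blast
          thus ?thesis unfolding strip_inv_def using M'p M'N pr' t True by (intro exI[of _ M']) auto
        next
          case False
          hence "sum_of_two_squares M \<longleftrightarrow> sum_of_two_squares M'" using two_squares_mult_prime(1)[OF M'p dp False] MM' by simp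
          thus ?thesis unfolding strip_inv_def using M'p M'N pr' t False fl by (intro exI[of _ M']) auto
        qed
      qed auto
      show "runs orc S F (Seq (Cond (Op Sub (Op Rem (Reg 2) (Num 4)) (Num 2)) (Assign 4 (Num 0)) Skip)
             (Assign 0 (Op Quo (Reg 0) (Reg 2)))) s bs ?Q"
      proof (intro runs_Seq[OF F0] runs_Cond[OF F0 bnd])
        have m4: "int d mod 4 = int (d mod 4)" by (simp add: zmod_int)
        {
          assume "aval (Op Sub (Op Rem (Reg 2) (Num 4)) (Num 2)) s > 0"
          hence "d mod 4 > 2" by (simp add: d m4)
          hence "d mod 4 = 3" by presburger
          have b4: "bounded_store S (s(4 := 0))" using bnd by (intro bounded_store_update) auto
          have v: "aval (Op Quo (Reg 0) (Reg 2)) (s(4 := 0)) = int M'" by (simp add: d M M'_def zdiv_int)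
          show "runs orc S F (Assign 4 (Num 0)) s bs (\<lambda>s' bs'. runs orc S F (Assign 0 (Op Quo (Reg 0) (Reg 2))) s' bs' ?Q)"
            using fin[of "s(4 := 0)"] \<open>d mod 4 = 3\<close> unfolding v[symmetric] 
            by (intro runs_Assign[OF bnd]) (simp only: aval.simps(1), intro runs_Assign[OF b4], blast)
        next
          assume "\<not> aval (Op Sub (Op Rem (Reg 2) (Num 4)) (Num 2)) s > 0"
          hence "d mod 4 \<noteq> 3" by (auto simp: d m4)
          have v: "aval (Op Quo (Reg 0) (Reg 2)) s = int M'" by (simp add: d M M'_def zdiv_int)
          show "runs orc S F Skip s bs (\<lambda>s' bs'. runs orc S F (Assign 0 (Op Quo (Reg 0) (Reg 2))) s' bs' ?Q)"
            using fin[of s] \<open>d mod 4 \<noteq> 3\<close> unfolding v[symmetric] by (intro runs_Skip runs_Assign[OF bnd]) blast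
        }
      qed
    next
      assume nd: "\<not> aval (Op Sub (Num 1) (Op Rem (Reg 0) (Reg 2))) s > 0"
      have nd: "\<not> d dvd M"
      proof
        assume "d dvd M"
        hence "int M mod int d = 0" by (metis dvd_imp_mod_0 of_nat_dvd_iff)
        thus False using nd by (simp add: d M)
      qed
      have pr': "Suc d \<le> p" if "prime p" "p dvd M" for p
        using pr[OF that] nd that by (cases "p = d") auto
      have v: "aval (Op Add (Reg 2) (Num 1)) s = int (Suc d)" by (simp add: d)
      show "runs orc S F (Assign 2 (Op Add (Reg 2) (Num 1))) s bs ?Q"
      proof (rule runs_Assign[OF bnd], unfold v, intro conjI strip_stepI[of _ "Suc d" M])
        show "bounded_store S (s(2 := int (Suc d)))" using bnd d by (intro bounded_store_update) auto
        show "strip_inv N (Suc d) (s(2 := int (Suc d)))"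
          unfolding strip_inv_def using Mp MN pr' fl M by (intro exI[of _ M]) auto
      qed (use M in auto)
    qed
  qed
qed

lemma strip_prog_runs:
  assumes bnd: "bounded_store S s" and N: "s 0 = int N" "N > 0" and L: "s 6 = int L" and S: "8 * int L + 2 < 2 ^ S"
    and L0: "L > 0" and F: "8 * L + floorlog 2 N < F"
  shows "runs orc S F strip_prog s bs (\<lambda>s' bs'. bs' = bs \<and> bounded_store S s' \<and> agree {0, 2, 3, 4} s s' \<and>
      strip_inv N (8 * L + 1) s')"
proof -
  have F0: "F > 0" using F by simp
  define s0 where "s0 = s(3 := 8 * int L, 2 := 2, 4 := 1)"
  define I where "I = (\<lambda>n s' bs'. bs' = bs \<and> bounded_store S s' \<and> agree {0, 2, 3, 4} s s' \<and> s' 3 = 8 * int L \<and>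
      (\<exists>d M. s' 2 = int d \<and> d \<ge> 2 \<and> d \<le> 8 * L + 1 \<and> s' 0 = int M \<and> strip_inv N d s' \<and> n = (8 * L + 1 - d) + floorlog 2 M))"
  have two: "(2::int) < 2 ^ S" using S by linarith
  have b1: "bounded_store S (s(3 := 8 * int L))" using bnd S by (intro bounded_store_update) auto
  have b2: "bounded_store S (s(3 := 8 * int L, 2 := 2))" using b1 two by (intro bounded_store_update[OF b1]) auto
  have b3: "bounded_store S s0" unfolding s0_def using two by (intro bounded_store_update[OF b2]) auto
  have "runs orc S F (While (Op Sub (Op Add (Reg 3) (Num 1)) (Reg 2)) strip_body) s0 bs
     (\<lambda>s' bs'. bs' = bs \<and> bounded_store S s' \<and> agree {0, 2, 3, 4} s s' \<and> strip_inv N (8 * L + 1) s')"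
  proof (rule runs_While[where I = I])
    show "8 * L + 1 - 2 + floorlog 2 N < F" using F by linarith
    have "strip_inv N 2 s0" unfolding strip_inv_def s0_def using N prime_ge_2_nat by auto
    show "I (8 * L + 1 - 2 + floorlog 2 N) s0 bs"
    proof -
      have "s0 2 = int 2" "s0 0 = int N" "s0 3 = 8 * int L" "agree {0, 2, 3, 4} s s0" using N by (simp_all add: s0_def)
      moreover have "(2::nat) \<le> 8 * L + 1" using L0 by simp
      ultimately show ?thesis unfolding I_def using b3 \<open>strip_inv N 2 s0\<close> by blast
    qed
    fix n s' bs' assume "I n s' bs'"
    then obtain d M where I: "bs' = bs" "bounded_store S s'" "agree {0, 2, 3, 4} s s'" "s' 3 = 8 * int L"
      "s' 2 = int d" "d \<ge> 2" "d \<le> 8 * L + 1" "s' 0 = int M" "strip_inv N d s'" "n = (8 * L + 1 - d) + floorlog 2 M"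
      by (auto simp: I_def)
    show "bounded_store S s'" by (rule I)
    show "runs orc S F strip_body s' bs' (\<lambda>s' bs'. \<exists>m<n. I m s' bs')"
      if "aval (Op Sub (Op Add (Reg 3) (Num 1)) (Reg 2)) s' > 0"
    proof -
      have dL: "d \<le> 8 * L" using that I by simp
      hence dS: "int d + 1 < 2 ^ S" using S by linarith
      show ?thesis
      proof (rule runs_mono[OF strip_body_runs[OF F0 I(2,5,6) dS I(8,9), of orc bs']])
        fix t cs assume "cs = bs' \<and> bounded_store S t \<and> agree {0, 2, 4} s' t \<and> strip_step N d M t"
        then obtain d' M' where t: "cs = bs'" "bounded_store S t" "agree {0, 2, 4} s' t" "t 2 = int d'" "t 0 = int M'"
          "strip_inv N d' t" "d' = d \<and> floorlog 2 M' < floorlog 2 M \<or> d' = Suc d \<and> M' = M" unfolding strip_step_def by blast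
        have "I ((8 * L + 1 - d') + floorlog 2 M') t cs"
        proof -
          have "agree {0, 2, 3, 4} s t" using I(3) t(3) by (auto simp: agree_def)
          moreover have "t 3 = 8 * int L" using agreeD[OF t(3), of 3] I(4) by simp
          moreover have "d' \<ge> 2" "d' \<le> 8 * L + 1" using t(7) I(6) dL by auto
          ultimately show ?thesis unfolding I_def using t(1,2,4,5,6) I(1) by blast
        qed
        moreover have "(8 * L + 1 - d') + floorlog 2 M' < n" unfolding I(10) using t(7) dL by auto
        ultimately show "\<exists>m<n. I m t cs" by blast
      qed
    qed
    show "bs' = bs \<and> bounded_store S s' \<and> agree {0, 2, 3, 4} s s' \<and> strip_inv N (8 * L + 1) s'"
      if "\<not> aval (Op Sub (Op Add (Reg 3) (Num 1)) (Reg 2)) s' > 0"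
    proof -
      have "d = 8 * L + 1" using that I by simp
      thus ?thesis using I by simp
    qed
  qed
  thus ?thesis unfolding strip_prog_def
    using bnd b1 b2 L by (intro runs_Seq[OF F0] runs_Assign) (simp_all add: s0_def)
qed

lemma int_less_pow2: "n < 2 ^ S \<Longrightarrow> int n < 2 ^ S"
  by (metis of_nat_less_iff of_nat_numeral of_nat_power)

lemma gcd_loop_runs:
  assumes bnd: "bounded_store S s" and ab: "s 10 = int a" "s 11 = int b" and F: "floorlog 2 a + floorlog 2 b + 1 < F"
  shows "runs orc S F gcd_loop s bs (\<lambda>s' bs'. bs' = bs \<and> bounded_store S s' \<and> agree {10, 11, 12} s s' \<and> s' 10 = int (gcd a b))"
proof -
  have F0: "F > 0" using F by simp
  \<comment> \<open>While \<open>y \<le> x\<close>, the remainder is at most \<open>x div 2\<close>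
    and the total size drops; the extra 1 pays for the step that merely exchanges the arguments when
    \<open>x < y\<close>.\<close>
  define V where "V = (\<lambda>x y. floorlog 2 x + floorlog 2 y + (if x < y then 1 else 0 :: nat))"
  define I where "I = (\<lambda>n s' bs'. bs' = bs \<and> bounded_store S s' \<and> agree {10, 11, 12} s s' \<and>
      (\<exists>x y. s' 10 = int x \<and> s' 11 = int y \<and> gcd x y = gcd a b \<and> n = V x y))"
  have V: "V y (x mod y) < V x y" if "y > 0" for x y
  proof -
    have ny: "\<not> y < x mod y" using that by (simp add: not_less less_imp_le)
    show ?thesis
    proof (cases "x < y")
      case True
      thus ?thesis by (simp add: V_def)
    next
      case False
      have "x = y * (x div y) + x mod y" by simp
      moreover have "y * 1 \<le> y * (x div y)" using False that by (intro mult_le_mono2) (simp add: div_greater_zero_iff Suc_le_eq)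
      moreover have "x mod y < y" using that by simp
      ultimately have "x mod y \<le> x div 2" by linarith
      hence "floorlog 2 (x mod y) \<le> floorlog 2 (x div 2)" by (rule floorlog_2_mono)
      moreover have "floorlog 2 x = Suc (floorlog 2 (x div 2))" using False that by (intro floorlog_half) auto
      ultimately show ?thesis using False ny by (simp add: V_def)
    qed
  qed
  show ?thesis
    unfolding gcd_loop_def
  proof (rule runs_While[where I = I and n = "V a b"])
    show "V a b < F" using F by (simp add: V_def)
    show "I (V a b) s bs" unfolding I_def using bnd ab agree_refl by blast
    fix n s' bs' assume "I n s' bs'"
    then obtain x y where I: "bs' = bs" "bounded_store S s'" "agree {10, 11, 12} s s'" "s' 10 = int x" "s' 11 = int y"
      "gcd x y = gcd a b" "n = V x y" by (auto simp: I_def)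
    show "bounded_store S s'" by (rule I)
    have yS: "int y < 2 ^ S" using I(2,5) by (auto simp: bounded_store_def dest: spec[of _ 11])
    show "runs orc S F (Seq (Assign 12 (Op Rem (Reg 10) (Reg 11))) (Seq (Assign 10 (Reg 11)) (Assign 11 (Reg 12)))) s' bs' (\<lambda>s' bs'. \<exists>m<n. I m s' bs')"
      if "aval (Reg 11) s' > 0"
    proof -
      have y: "y > 0" using that I(5) by simp
      have "x mod y < y" using y by simp
      hence mS: "int (x mod y) < 2 ^ S" using yS by linarith
      have e: "int x mod int y = int (x mod y)" by (simp add: zmod_int)
      define s1 where "s1 = s'(12 := int (x mod y))"
      define s2 where "s2 = s1(10 := int y)"
      define s3 where "s3 = s2(11 := int (x mod y))"
      have b1: "bounded_store S s1" unfolding s1_def using mS by (intro bounded_store_update[OF I(2)]) simp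
      have b2: "bounded_store S s2" unfolding s2_def using yS by (intro bounded_store_update[OF b1]) simp
      have b3: "bounded_store S s3" unfolding s3_def using mS by (intro bounded_store_update[OF b2]) simp
      have "s3 10 = int y" "s3 11 = int (x mod y)" "agree {10, 11, 12} s s3"
        using I(3) by (simp_all add: s3_def s2_def s1_def)
      moreover have "gcd y (x mod y) = gcd a b" using I(6) y by (simp add: gcd.commute[of x] gcd_red_nat[symmetric])
      ultimately have "I (V y (x mod y)) s3 bs'" unfolding I_def using b3 I(1) by blast
      hence "\<exists>m<n. I m s3 bs'" using V[OF y, of x] I(7) by blast
      moreover have "s'(12 := aval (Op Rem (Reg 10) (Reg 11)) s') = s1" "s1(10 := aval (Reg 11) s1) = s2" "s2(11 := aval (Reg 12) s2) = s3"
        using I(4,5) e by (simp_all add: s1_def s2_def s3_def)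
      ultimately show ?thesis using I(2) b1 b2 by (intro runs_Seq[OF F0] runs_Assign) simp_all
    qed
    show "bs' = bs \<and> bounded_store S s' \<and> agree {10, 11, 12} s s' \<and> s' 10 = int (gcd a b)" if "\<not> aval (Reg 11) s' > 0"
    proof -
      have "y = 0" using that I(5) by simp
      thus ?thesis using I by simp
    qed
  qed
qed

definition witness :: "nat \<Rightarrow> nat \<Rightarrow> nat \<Rightarrow> bool" where
  "witness N u v \<longleftrightarrow> coprime (norm_pair u v) N \<and> jacobi3 N (int (norm_pair u v)) = -1"

lemma test_prog_runs:
  assumes orc: "solves_CRS 2 orc" and bnd: "bounded_store S s" and N: "s 0 = int N" "N > 0" "odd N"
    and uv: "s 7 = int u" "s 8 = int v" and wS: "(norm_pair u v)\<^sup>2 < 2 ^ S" and NS: "N\<^sup>2 < 2 ^ S"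
    and F: "floorlog 2 (norm_pair u v) + floorlog 2 N + 1 < F"
  shows "runs orc S F test_prog s bs (\<lambda>s' bs'. bs' = bs \<and> bounded_store S s' \<and> agree {4, 9, 10, 11, 12, 13, 14, 15, 16} s s' \<and>
      s' 4 = (if witness N u v then 0 else s 4))"
proof -
  have F0: "F > 0" using F by simp
  define w where "w = norm_pair u v"
  have w0: "w > 0" "odd w" by (simp_all add: w_def)
  have w2: "sum_of_two_squares w"
  proof -
    have "int w = (int (2 * u + 1))\<^sup>2 + (int (2 * v))\<^sup>2" by (simp add: w_def)
    thus ?thesis unfolding sum_of_two_squares_def by blast
  qed
  have sqS: "int (w\<^sup>2) < 2 ^ S" "int (N\<^sup>2) < 2 ^ S"
    by (rule int_less_pow2, use wS NS in \<open>simp add: w_def\<close>)+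
  have "w \<le> w\<^sup>2" by (simp add: power2_eq_square)
  hence wS': "int w < 2 ^ S" using sqS(1) by linarith
  have NS': "int N < 2 ^ S" using bnd N by (auto simp: bounded_store_def dest: spec[of _ 0])
  define Q where "Q = (\<lambda>s' bs'. bs' = bs \<and> bounded_store S s' \<and> agree {4, 9, 10, 11, 12, 13, 14, 15, 16} s s' \<and>
      s' 4 = (if witness N u v then 0 else s 4))"
  define s1 where "s1 = s(9 := int w)"
  define s2 where "s2 = s1(10 := int w)"
  define s3 where "s3 = s2(11 := int N)"
  have b1: "bounded_store S s1" unfolding s1_def using wS' by (intro bounded_store_update[OF bnd]) simp
  have b2: "bounded_store S s2" unfolding s2_def using wS' by (intro bounded_store_update[OF b1]) simp
  have b3: "bounded_store S s3" unfolding s3_def using NS' by (intro bounded_store_update[OF b2]) simp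
  have rest: "runs orc S F (Seq gcd_loop (Cond (Op Sub (Num 2) (Reg 10)) query_prog Skip)) s3 bs Q"
  proof (rule runs_Seq[OF F0], rule runs_mono[OF gcd_loop_runs[OF b3, of w N]])
    show "s3 10 = int w" "s3 11 = int N" by (simp_all add: s3_def s2_def)
    show "floorlog 2 w + floorlog 2 N + 1 < F" using F by (simp add: w_def)
    fix t cs assume "cs = bs \<and> bounded_store S t \<and> agree {10, 11, 12} s3 t \<and> t 10 = int (gcd w N)"
    hence t: "cs = bs" "bounded_store S t" "agree {10, 11, 12} s3 t" "t 10 = int (gcd w N)" by auto
    have tv: "t 0 = int N" "t 9 = int w" "t 4 = s 4"
      using agreeD[OF t(3), of 0] agreeD[OF t(3), of 9] agreeD[OF t(3), of 4] N(1) by (simp_all add: s3_def s2_def s1_def)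
    have ta: "agree {4, 9, 10, 11, 12, 13, 14, 15, 16} s t"
      using t(3) by (auto simp: agree_def s3_def s2_def s1_def)
    have g1: "gcd w N \<ge> 1" using w0(1) by (simp add: Suc_le_eq)
    show "runs orc S F (Cond (Op Sub (Num 2) (Reg 10)) query_prog Skip) t cs Q"
    proof (rule runs_Cond[OF F0 t(2)])
      assume "\<not> aval (Op Sub (Num 2) (Reg 10)) t > 0"
      hence "gcd w N \<noteq> 1" by (auto simp: t(4))
      hence "\<not> witness N u v" unfolding witness_def w_def[symmetric] coprime_iff_gcd_eq_1 by simp
      thus "runs orc S F Skip t cs Q" using t ta tv by (intro runs_Skip) (simp add: Q_def)
    next
      assume "aval (Op Sub (Num 2) (Reg 10)) t > 0"
      hence "gcd w N = 1" using g1 by (simp add: t(4))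
      hence cop: "coprime w N" unfolding coprime_iff_gcd_eq_1 .
      define q1 where "q1 = orc N (w\<^sup>2)"
      define q2 where "q2 = orc w (N\<^sup>2)"
      \<comment> \<open>The promise holds, so both answers are signs and fit into a register;
        elsewhere nothing bounds the answers of a solver.\<close>
      have q1: "q1 \<in> {-1, 1}" and q2: "q2 = q1 * jacobi3 N (int w)"
        using two_queries[OF orc N(2,3) w0 w2 cop] by (simp_all add: q1_def q2_def)
      have J: "jacobi3 N (int w) \<in> {-1, 1}" using cop by (intro jacobi3_signs) simp
      have wit: "witness N u v \<longleftrightarrow> q1 \<noteq> q2"
        using cop q1 q2 J unfolding witness_def w_def[symmetric] by auto
      have one: "(1::int) < 2 ^ S"
      proof -
        have "w\<^sup>2 \<ge> 1" using w0(1) by (simp add: Suc_le_eq)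
        hence "(2::nat) ^ S > 1" using wS unfolding w_def[symmetric] by linarith
        thus ?thesis using int_less_pow2[of 1 S] by simp
      qed
      define t1 where "t1 = t(13 := int (w\<^sup>2))"
      define t2 where "t2 = t1(14 := int (N\<^sup>2))"
      define t3 where "t3 = t2(15 := q1)"
      define t4 where "t4 = t3(16 := q2)"
      have c1: "bounded_store S t1" unfolding t1_def using sqS by (intro bounded_store_update[OF t(2)]) simp
      have c2: "bounded_store S t2" unfolding t2_def using sqS by (intro bounded_store_update[OF c1]) simp
      have c3: "bounded_store S t3" unfolding t3_def using q1 one by (intro bounded_store_update[OF c2]) auto
      have c4: "bounded_store S t4" unfolding t4_def using q1 q2 J one by (intro bounded_store_update[OF c3]) auto
      have a4: "agree {4, 9, 10, 11, 12, 13, 14, 15, 16} s t4" using ta by (simp add: t4_def t3_def t2_def t1_def)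
      have t4v: "t4 4 = s 4" "t4 15 = q1" "t4 16 = q2" using tv by (simp_all add: t4_def t3_def t2_def t1_def)
      have last: "runs orc S F (Cond (square_exp (Op Sub (Reg 15) (Reg 16))) (Assign 4 (Num 0)) Skip) t4 cs Q"
      proof (rule runs_Cond[OF F0 c4])
        assume "aval (square_exp (Op Sub (Reg 15) (Reg 16))) t4 > 0"
        hence "q1 \<noteq> q2" by (auto simp: t4v)
        hence "Q (t4(4 := 0)) cs" using wit t(1) a4 c4 by (auto simp: Q_def intro!: bounded_store_update)
        thus "runs orc S F (Assign 4 (Num 0)) t4 cs Q" by (intro runs_Assign[OF c4]) simp
      next
        assume "\<not> aval (square_exp (Op Sub (Reg 15) (Reg 16))) t4 > 0"
        hence "q1 = q2" by (auto simp: t4v not_less mult_le_0_iff)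
        thus "runs orc S F Skip t4 cs Q" using wit t(1) a4 c4 t4v by (intro runs_Skip) (simp add: Q_def)
      qed
      have e1: "t(13 := aval (square_exp (Reg 9)) t) = t1" by (simp add: t1_def tv power2_eq_square)
      have e2: "t1(14 := aval (square_exp (Reg 0)) t1) = t2" by (simp add: t2_def t1_def tv power2_eq_square)
      have e3: "t2(15 := orc (nat (t2 0)) (nat (t2 13))) = t3"
        unfolding t3_def q1_def by (simp add: t2_def t1_def tv flip: of_nat_power)
      have e4: "t3(16 := orc (nat (t3 9)) (nat (t3 14))) = t4"
        unfolding t4_def q2_def by (simp add: t3_def t2_def t1_def tv flip: of_nat_power)
      have "runs orc S F (Seq (Query 16 9 14) (Cond (square_exp (Op Sub (Reg 15) (Reg 16))) (Assign 4 (Num 0)) Skip)) t3 cs Q"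
        by (rule runs_Seq[OF F0], rule runs_Query, unfold e4, rule last)
      hence "runs orc S F (Seq (Query 15 0 13) (Seq (Query 16 9 14) (Cond (square_exp (Op Sub (Reg 15) (Reg 16))) (Assign 4 (Num 0)) Skip))) t2 cs Q"
        by (intro runs_Seq[OF F0, of _ _ "Query 15 0 13"] runs_Query) (unfold e3)
      thus "runs orc S F query_prog t cs Q"
        unfolding query_prog_def using t(2) c1 e1 e2
        by (intro runs_Seq[OF F0, of _ _ "Assign _ _"] runs_Assign) simp_all
    qed
  qed
  have f1: "s(9 := aval (Op Add (square_exp (Op Add (Op Mul (Num 2) (Reg 7)) (Num 1))) (square_exp (Op Mul (Num 2) (Reg 8)))) s) = s1"
    by (simp add: s1_def w_def uv power2_eq_square algebra_simps)
  have f2: "s1(10 := aval (Reg 9) s1) = s2" by (simp add: s2_def s1_def)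
  have f3: "s2(11 := aval (Reg 0) s2) = s3" by (simp add: s3_def s2_def s1_def N)
  have "runs orc S F test_prog s bs Q"
    unfolding test_prog_def
    by (rule runs_Seq[OF F0], rule runs_Assign[OF bnd], unfold f1, rule runs_Seq[OF F0], rule runs_Assign[OF b1], unfold f2,
        rule runs_Seq[OF F0], rule runs_Assign[OF b2], unfold f3, rule rest)
  thus ?thesis by (simp add: Q_def)
qed

text \<open>Functional model of \<open>draw_prog\<close>: the bits feed \<open>u\<close> and
  \<open>v\<close> in turn, leading bits first.\<close>

fun decode :: "nat \<Rightarrow> nat \<Rightarrow> bool list \<Rightarrow> nat \<times> nat" where
  "decode u v (b # c # bs) = decode (2 * u + of_bool b) (2 * v + of_bool c) bs"
| "decode u v _ = (u, v)"

lemma list_double_SucE: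
  assumes "length bs = 2 * Suc n"
  obtains b c cs where "bs = b # c # cs" "length cs = 2 * n"
  \<comment> \<open>The rule \<open>remdups_adj.cases\<close> distinguishes lists of length 0, of
    length 1 and of length at least 2.\<close>
  using assms by (cases bs rule: remdups_adj.cases) auto

lemma decode_bounds:
  "length bs = 2 * n \<Longrightarrow> fst (decode u v bs) < Suc u * 2 ^ n \<and> snd (decode u v bs) < Suc v * 2 ^ n"
proof (induction n arbitrary: u v bs)
  case (Suc n)
  obtain b c cs where bs: "bs = b # c # cs" "length cs = 2 * n" using list_double_SucE[OF Suc.prems] .
  have le: "Suc (2 * x + of_bool e) * 2 ^ n \<le> Suc x * 2 ^ Suc n" for x and e :: bool
  proof -
    have "Suc (2 * x + of_bool e) * 2 ^ n \<le> (2 * Suc x) * 2 ^ n" by (intro mult_le_mono1) (cases e, auto)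
    thus ?thesis by simp
  qed
  show ?case using Suc.IH[OF bs(2), of "2 * u + of_bool b" "2 * v + of_bool c"] le[of u b] le[of v c] unfolding bs(1) by simp
qed simp

text \<open>The accumulators are generalised for the induction: an equality of values
  \<open>2 * u + of_bool b\<close> splits by parity into that of \<open>u\<close> and that of the
  bit.\<close>

lemma decode_inj:
  "length bs = 2 * n \<Longrightarrow> length cs = 2 * n \<Longrightarrow> decode u v bs = decode u' v' cs \<Longrightarrow> u = u' \<and> v = v' \<and> bs = cs"
proof (induction n arbitrary: u v u' v' bs cs)
  case (Suc n)
  obtain b c ds where bs: "bs = b # c # ds" "length ds = 2 * n" using list_double_SucE[OF Suc.prems(1)] .
  obtain b' c' ds' where cs: "cs = b' # c' # ds'" "length ds' = 2 * n" using list_double_SucE[OF Suc.prems(2)] .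
  have 1: "2 * u + of_bool b = 2 * u' + of_bool b'" "2 * v + of_bool c = 2 * v' + of_bool c'" "ds = ds'"
    using Suc.IH[OF bs(2) cs(2)] Suc.prems(3) unfolding bs(1) cs(1) by auto
  have par: "x = y \<and> e = f" if "2 * x + of_bool e = (2 * y + of_bool f :: nat)" for x y e f
    using that by (cases e; cases f) (auto, presburger+)
  show ?case using par[OF 1(1)] par[OF 1(2)] 1(3) bs cs by simp
qed simp

lemma bij_betw_decode:
  "bij_betw (decode 0 0) {bs. length bs = 2 * n} ({..<2 ^ n} \<times> {..<2 ^ n})"
proof -
  have inj: "inj_on (decode 0 0) {bs. length bs = 2 * n}" 
  proof (rule inj_onI)
    fix x y :: "bool list" assume "x \<in> {bs. length bs = 2 * n}" "y \<in> {bs. length bs = 2 * n}" "decode 0 0 x = decode 0 0 y"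
    thus "x = y" using decode_inj[of x n y 0 0 0 0] by simp
  qed
  have sub: "decode 0 0 ` {bs. length bs = 2 * n} \<subseteq> {..<2 ^ n} \<times> {..<2 ^ n}"
  proof (rule image_subsetI)
    fix x :: "bool list" assume "x \<in> {bs. length bs = 2 * n}"
    thus "decode 0 0 x \<in> {..<2 ^ n} \<times> {..<2 ^ n}" using decode_bounds[of x n 0 0] by (simp add: mem_Times_iff)
  qed
  have "card {bs :: bool list. length bs = 2 * n} = 2 ^ (2 * n)"
    using card_lists_length_eq[of "UNIV :: bool set" "2 * n"] by simp
  hence "card (decode 0 0 ` {bs. length bs = 2 * n}) = card ({..<2 ^ n :: nat} \<times> {..<2 ^ n :: nat})"
    unfolding card_image[OF inj] by (simp add: card_cartesian_product mult_2 power_add)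
  hence "decode 0 0 ` {bs. length bs = 2 * n} = {..<2 ^ n} \<times> {..<2 ^ n}"
    by (intro card_subset_eq sub) auto
  thus ?thesis using inj by (simp add: bij_betw_def)
qed

lemma draw_prog_runs:
  assumes bnd: "bounded_store S s" and N: "s 0 = int N" and bs: "2 * floorlog 2 N \<le> length bs"
    and S: "(2::nat) ^ floorlog 2 N < 2 ^ S" and F: "floorlog 2 N < F"
  shows "runs orc S F draw_prog s bs (\<lambda>s' bs'. bs' = drop (2 * floorlog 2 N) bs \<and> bounded_store S s' \<and> agree {5, 7, 8, 18} s s' \<and>
      (\<exists>u v. decode 0 0 (take (2 * floorlog 2 N) bs) = (u, v) \<and> s' 7 = int u \<and> s' 8 = int v))"
proof -
  have F0: "F > 0" using F by simp
  define L where "L = floorlog 2 N"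
  have NS: "int N < 2 ^ S" using bnd N by (auto simp: bounded_store_def dest: spec[of _ 0])
  have one: "(1::int) < 2 ^ S"
  proof -
    have "(1::nat) \<le> 2 ^ L" by simp
    hence "(1::nat) < 2 ^ S" using S unfolding L_def by linarith
    thus ?thesis using int_less_pow2[of 1 S] by simp
  qed
  define D where "D = decode 0 0 (take (2 * L) bs)"
  define I where "I = (\<lambda>n s' bs'. bounded_store S s' \<and> agree {5, 7, 8, 18} s s' \<and>
     (\<exists>r u v. s' 5 = int r \<and> n = floorlog 2 r \<and> n \<le> L \<and> s' 7 = int u \<and> s' 8 = int v \<and> u < 2 ^ (L - n) \<and> v < 2 ^ (L - n) \<and>
        2 * n \<le> length bs' \<and> decode u v (take (2 * n) bs') = D \<and> drop (2 * n) bs' = drop (2 * L) bs))"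
  define s0 where "s0 = s(5 := int N, 7 := 0, 8 := 0)"
  have b1: "bounded_store S (s(5 := int N))" using NS by (intro bounded_store_update[OF bnd]) simp
  have b2: "bounded_store S (s(5 := int N, 7 := 0))" by (intro bounded_store_update[OF b1]) simp
  have b3: "bounded_store S s0" unfolding s0_def by (intro bounded_store_update[OF b2]) simp
  have loop: "runs orc S F (While (Reg 5) (Seq (Toss 18) (Seq (Assign 7 (Op Add (Op Mul (Num 2) (Reg 7)) (Reg 18)))
       (Seq (Toss 18) (Seq (Assign 8 (Op Add (Op Mul (Num 2) (Reg 8)) (Reg 18)))
         (Assign 5 (Op Quo (Reg 5) (Num 2)))))))) s0 bs (\<lambda>s' bs'. bs' = drop (2 * L) bs \<and> bounded_store S s' \<and> agree {5, 7, 8, 18} s s' \<and>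
      (\<exists>u v. D = (u, v) \<and> s' 7 = int u \<and> s' 8 = int v))"
  proof (rule runs_While[where I = I and n = L])
    show "L < F" using F by (simp add: L_def)
    have "s0 5 = int N" "s0 7 = int 0" "s0 8 = int 0" "agree {5, 7, 8, 18} s s0" by (simp_all add: s0_def)
    moreover have "(0::nat) < 2 ^ (L - L)" "L = floorlog 2 N" "L \<le> L" "2 * L \<le> length bs" using bs by (simp_all add: L_def)
    ultimately show "I L s0 bs" unfolding I_def D_def using b3 by blast
    fix n s' bs' assume "I n s' bs'"
    then obtain r u v where I: "bounded_store S s'" "agree {5, 7, 8, 18} s s'" "s' 5 = int r" "n = floorlog 2 r" "n \<le> L"
      "s' 7 = int u" "s' 8 = int v" "u < 2 ^ (L - n)" "v < 2 ^ (L - n)" "2 * n \<le> length bs'"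
      "decode u v (take (2 * n) bs') = D" "drop (2 * n) bs' = drop (2 * L) bs"
      by (auto simp: I_def)
    show "bounded_store S s'" by (rule I)
    have rS: "int r < 2 ^ S" using I(1,3) by (auto simp: bounded_store_def dest: spec[of _ 5])
    show "runs orc S F (Seq (Toss 18) (Seq (Assign 7 (Op Add (Op Mul (Num 2) (Reg 7)) (Reg 18)))
       (Seq (Toss 18) (Seq (Assign 8 (Op Add (Op Mul (Num 2) (Reg 8)) (Reg 18)))
         (Assign 5 (Op Quo (Reg 5) (Num 2))))))) s' bs' (\<lambda>s' bs'. \<exists>m<n. I m s' bs')"
      if "aval (Reg 5) s' > 0"
    proof -
      have r: "r > 0" using that I(3) by simp
      define m where "m = floorlog 2 (r div 2)"
      have nm: "n = Suc m" unfolding I(4) m_def by (rule floorlog_half[OF r])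
      obtain b c cs where cs: "bs' = b # c # cs" using I(10) nm by (cases bs' rule: remdups_adj.cases) auto
      define u' where "u' = 2 * u + of_bool b"
      define v' where "v' = 2 * v + of_bool c"
      have Lm: "L - m = Suc (L - n)" using I(5) nm by simp
      have u'L: "u' < 2 ^ (L - m)" unfolding Lm u'_def using I(8) by (cases b) auto
      have v'L: "v' < 2 ^ (L - m)" unfolding Lm v'_def using I(9) by (cases c) auto
      have "(2::nat) ^ (L - m) \<le> 2 ^ L" by (intro power_increasing) auto
      hence "u' < 2 ^ S" "v' < 2 ^ S" using u'L v'L S unfolding L_def[symmetric] by linarith+
      hence uS: "int u' < 2 ^ S" and vS: "int v' < 2 ^ S" by (auto intro: int_less_pow2)
      define t1 where "t1 = s'(18 := of_bool b)"
      define t2 where "t2 = t1(7 := int u')"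
      define t3 where "t3 = t2(18 := of_bool c)"
      define t4 where "t4 = t3(8 := int v')"
      define t5 where "t5 = t4(5 := int (r div 2))"
      have c1: "bounded_store S t1" unfolding t1_def using one by (intro bounded_store_update[OF I(1)]) auto
      have c2: "bounded_store S t2" unfolding t2_def using uS by (intro bounded_store_update[OF c1]) auto
      have c3: "bounded_store S t3" unfolding t3_def using one by (intro bounded_store_update[OF c2]) auto
      have c4: "bounded_store S t4" unfolding t4_def using vS by (intro bounded_store_update[OF c3]) auto
      have c5: "bounded_store S t5" unfolding t5_def using rS by (intro bounded_store_update[OF c4]) auto
      have "t5 5 = int (r div 2)" "t5 7 = int u'" "t5 8 = int v'" "agree {5, 7, 8, 18} s t5"
        using I(2) by (simp_all add: t5_def t4_def t3_def t2_def t1_def)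
      moreover have "m \<le> L" using nm I(5) by simp
      moreover have "2 * m \<le> length cs" using I(10) by (simp add: cs nm)
      moreover have "decode u' v' (take (2 * m) cs) = D" "drop (2 * m) cs = drop (2 * L) bs"
        using I(11,12) by (simp_all add: cs nm u'_def v'_def)
      ultimately have "I m t5 cs" unfolding I_def using c5 u'L v'L m_def by blast
      hence fin: "\<exists>m<n. I m t5 cs" using nm by blast
      have e2: "t1(7 := aval (Op Add (Op Mul (Num 2) (Reg 7)) (Reg 18)) t1) = t2"
        by (simp add: t2_def t1_def I(6) u'_def)
      have e4: "t3(8 := aval (Op Add (Op Mul (Num 2) (Reg 8)) (Reg 18)) t3) = t4"
        by (simp add: t4_def t3_def t2_def t1_def I(7) v'_def)
      have e5: "t4(5 := aval (Op Quo (Reg 5) (Num 2)) t4) = t5"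
        by (simp add: t5_def t4_def t3_def t2_def t1_def I(3) zdiv_int)
      show ?thesis
        by (rule runs_Seq[OF F0], rule runs_Toss[OF cs], fold t1_def, rule runs_Seq[OF F0], rule runs_Assign[OF c1], unfold e2,
            rule runs_Seq[OF F0], rule runs_Toss[OF refl], fold t3_def, rule runs_Seq[OF F0], rule runs_Assign[OF c3], unfold e4,
            rule runs_Assign[OF c4], unfold e5, rule fin)
    qed
    show "bs' = drop (2 * L) bs \<and> bounded_store S s' \<and> agree {5, 7, 8, 18} s s' \<and> (\<exists>u v. D = (u, v) \<and> s' 7 = int u \<and> s' 8 = int v)"
      if "\<not> aval (Reg 5) s' > 0"
    proof -
      have "r = 0" using that I(3) by simp
      hence "n = 0" using I(4) by (simp add: floorlog_def)
      thus ?thesis using I by auto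
    qed
  qed
  show ?thesis unfolding draw_prog_def L_def[symmetric] D_def[symmetric]
    using loop bnd b1 b2 N by (intro runs_Seq[OF F0, of _ _ "Assign _ _"] runs_Assign) (simp_all add: s0_def)
qed

definition pre_prog :: cmd where
  "pre_prog = Seq size_prog strip_prog"

definition prob_loop :: cmd where
  "prob_loop = While (Reg 17) (Seq draw_prog (Seq test_prog (Assign 17 (Op Sub (Reg 17) (Num 1)))))"

text \<open>A round finds an existing witness with probability at least \<open>1/16\<close>, and \<open>(15/16)^11 < 1/2\<close>.\<close>

definition prob_prog :: cmd where
  "prob_prog = Seq pre_prog (Seq (Assign 17 (Op Mul (Num 11) (Reg 1))) (Seq prob_loop (Assign 0 (Reg 4))))"

primrec power_exp :: "nat \<Rightarrow> aexp \<Rightarrow> aexp" where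
  "power_exp 0 e = Num 1"
| "power_exp (Suc n) e = Op Mul e (power_exp n e)"

lemma aval_power_exp [simp]: "aval (power_exp n e) s = aval e s ^ n"
  by (induction n) auto

text \<open>A single counter encodes the pair as quotient and remainder by the range in register 19,
  which avoids a nested loop. It is decremented first, so the codes used run from
  \<open>Y * Y - 1\<close> down to 0, with \<open>Y\<close> the range.\<close>

definition det_loop :: cmd where
  "det_loop = While (Reg 17) (Seq (Assign 17 (Op Sub (Reg 17) (Num 1))) (Seq (Assign 7 (Op Quo (Reg 17) (Reg 19)))
     (Seq (Assign 8 (Op Rem (Reg 17) (Reg 19))) test_prog)))"

definition det_prog :: "nat \<Rightarrow> cmd" where
  "det_prog C = Seq pre_prog (Seq (Assign 19 (Op Mul (Num (int C)) (power_exp 16 (Reg 6))))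
     (Seq (Assign 17 (square_exp (Reg 19))) (Seq det_loop (Assign 0 (Reg 4)))))"

abbreviation "loop_regs \<equiv> {4, 5, 7, 8, 9, 10, 11, 12, 13, 14, 15, 16, 17, 18 :: nat}"

lemma agree_trans: "agree X s t \<Longrightarrow> agree Y t u \<Longrightarrow> X \<subseteq> Z \<Longrightarrow> Y \<subseteq> Z \<Longrightarrow> agree Z s u"
  unfolding agree_def by (metis subsetD)

lemma pre_prog_runs:
  assumes bnd: "bounded_store S s" and N: "s 0 = int N" "N > 0" and S: "8 * int N + 2 < 2 ^ S"
    and F: "9 * floorlog 2 N < F"
  shows "runs orc S F pre_prog s bs (\<lambda>s' bs'. bs' = bs \<and> bounded_store S s' \<and> agree {0, 2, 3, 4, 5, 6} s s' \<and>
      s' 6 = int (floorlog 2 N) \<and> strip_inv N (8 * floorlog 2 N + 1) s')"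
proof -
  define L where "L = floorlog 2 N"
  have L0: "L > 0" using floorlog_pos[OF N(2)] by (simp add: L_def)
  have F0: "F > 0" and FL: "floorlog 2 N < F" using F by linarith+
  show ?thesis
    unfolding pre_prog_def
  proof (rule runs_Seq[OF F0], rule runs_mono[OF size_prog_runs[OF bnd N(1) FL]])
    fix t cs assume "cs = bs \<and> bounded_store S t \<and> agree {5, 6} s t \<and> t 6 = int (floorlog 2 N)"
    hence t: "cs = bs" "bounded_store S t" "agree {5, 6} s t" "t 6 = int L" by (auto simp: L_def)
    have t0: "t 0 = int N" using agreeD[OF t(3), of 0] N by simp
    have "L \<le> N" unfolding L_def by (rule floorlog_2_le)
    hence LS: "8 * int L + 2 < 2 ^ S" using S by linarith
    have FL': "8 * L + floorlog 2 N < F" using F by (simp add: L_def)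
    show "runs orc S F strip_prog t cs (\<lambda>s' bs'. bs' = bs \<and> bounded_store S s' \<and> agree {0, 2, 3, 4, 5, 6} s s' \<and>
      s' 6 = int (floorlog 2 N) \<and> strip_inv N (8 * floorlog 2 N + 1) s')"
    proof (rule runs_mono[OF strip_prog_runs[OF t(2) t0 N(2) t(4) LS L0 FL']])
      fix u ds assume u: "ds = cs \<and> bounded_store S u \<and> agree {0, 2, 3, 4} t u \<and> strip_inv N (8 * L + 1) u"
      have "agree {0, 2, 3, 4, 5, 6} s u" by (rule agree_trans[OF t(3), of "{0, 2, 3, 4}"]) (use u in auto)
      moreover have "u 6 = int L" using u t(4) by (auto simp: agree_def)
      ultimately show "ds = bs \<and> bounded_store S u \<and> agree {0, 2, 3, 4, 5, 6} s u \<and>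
        u 6 = int (floorlog 2 N) \<and> strip_inv N (8 * floorlog 2 N + 1) u" using u t(1) by (simp add: L_def)
    qed
  qed
qed

lemma norm_pair_bound:
  assumes "u < m" "v < m"
  shows "(norm_pair u v)\<^sup>2 \<le> 64 * m ^ 4"
proof -
  have "norm_pair u v \<le> (2 * m)\<^sup>2 + (2 * m)\<^sup>2" using assms by (intro add_mono power_mono) auto
  also have "\<dots> = 8 * m\<^sup>2" by (simp add: power2_eq_square)
  finally have "(norm_pair u v)\<^sup>2 \<le> (8 * m\<^sup>2)\<^sup>2" by (rule power_mono) simp
  also have "\<dots> = 64 * m ^ 4" by (simp add: power_mult_distrib flip: power_mult)
  finally show ?thesis .
qed

lemma floorlog_le_of_less: "n < 2 ^ S \<Longrightarrow> floorlog 2 n \<le> S"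
  using int_size_le[of "int n" S] int_less_pow2[of n S] by (simp add: int_size_def)

text \<open>A single bound \<open>m\<close> on \<open>N\<close>, \<open>u\<close> and
  \<open>v\<close> replaces the separate size conditions, so that one pair of constants
  \<open>S\<close>, \<open>F\<close> serves a whole program.\<close>

lemma test_prog_runs':
  assumes orc: "solves_CRS 2 orc" and bnd: "bounded_store S s" and N: "s 0 = int N" "N > 0" "odd N"
    and uv: "s 7 = int u" "s 8 = int v" "u < m" "v < m" "N \<le> m" and S: "64 * m ^ 4 < 2 ^ S" and F: "2 * S + 1 < F"
  shows "runs orc S F test_prog s bs (\<lambda>s' bs'. bs' = bs \<and> bounded_store S s' \<and> agree {4, 9, 10, 11, 12, 13, 14, 15, 16} s s' \<and>
      s' 4 = (if witness N u v then 0 else s 4))"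
proof (rule test_prog_runs[OF orc bnd N uv(1,2)])
  show w: "(norm_pair u v)\<^sup>2 < 2 ^ S" using norm_pair_bound[OF uv(3,4)] S by linarith
  have "m\<^sup>2 \<le> m ^ 4" using uv(3) by (intro power_increasing) auto
  moreover have "N\<^sup>2 \<le> m\<^sup>2" using uv(5) by (intro power_mono) auto
  ultimately show n: "N\<^sup>2 < 2 ^ S" using S by linarith
  have sq: "x \<le> x\<^sup>2" for x :: nat by (simp add: power2_eq_square)
  have "norm_pair u v \<le> (norm_pair u v)\<^sup>2" by (rule sq)
  hence "floorlog 2 (norm_pair u v) \<le> S" using w by (intro floorlog_le_of_less) linarith
  moreover have "N \<le> N\<^sup>2" by (rule sq)
  hence "floorlog 2 N \<le> S" using n by (intro floorlog_le_of_less) linarith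
  ultimately show "floorlog 2 (norm_pair u v) + floorlog 2 N + 1 < F" using F by linarith
qed

definition witness_bits :: "nat \<Rightarrow> bool list \<Rightarrow> bool" where
  "witness_bits N xs = (case decode 0 0 xs of (u, v) \<Rightarrow> witness N u v)"

definition hit :: "nat \<Rightarrow> nat \<Rightarrow> nat \<Rightarrow> bool list \<Rightarrow> bool" where
  "hit N L n bs \<longleftrightarrow> (\<exists>j<n. witness_bits N (take (2 * L) (drop (2 * L * j) bs)))"

lemma hit_Suc: "hit N L (Suc n) bs \<longleftrightarrow> hit N L n bs \<or> witness_bits N (take (2 * L) (drop (2 * L * n) bs))"
  by (auto simp: hit_def less_Suc_eq)

text \<open>For fixed coins the loop is deterministic, and its outcome is expressed by
  \<open>hit\<close>; probability enters only afterwards, by counting coin sequences.\<close>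

lemma prob_loop_runs:
  assumes orc: "solves_CRS 2 orc" and bnd: "bounded_store S s" and N: "s 0 = int N" "N > 0" "odd N"
    and k: "s 17 = int k" and bs: "2 * floorlog 2 N * k \<le> length bs"
    and m: "2 * N \<le> m" and S: "64 * m ^ 4 < 2 ^ S" and F: "2 * S + 1 < F" "k < F"
  shows "runs orc S F prob_loop s bs (\<lambda>s' bs'. bounded_store S s' \<and> s' 4 = (if hit N (floorlog 2 N) k bs then 0 else s 4))"
proof -
  have F0: "F > 0" using F by simp
  define L where "L = floorlog 2 N"
  have lb: "2 ^ (L - 1) \<le> N" "N < 2 ^ L" "L > 0" using floorlog_bounds[of N 2] floorlog_pos[OF N(2)] N(2) by (auto simp: L_def)
  have "(2::nat) ^ L = 2 * 2 ^ (L - 1)" using lb(3) by (cases L) auto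
  hence Lm: "2 ^ L \<le> m" using lb(1) m by linarith
  have m0: "m > 0" using m N(2) by linarith
  have "m \<le> m ^ 4" using m0 by (intro self_le_power) auto
  hence "m < 2 ^ S" using S by linarith
  hence LS: "(2::nat) ^ L < 2 ^ S" using Lm by linarith
  hence LS': "L < S" by simp
  have FL: "floorlog 2 N < F" using LS' F unfolding L_def by linarith
  define I where "I = (\<lambda>n s' bs'. bounded_store S s' \<and> agree loop_regs s s' \<and> n \<le> k \<and> s' 17 = int n \<and>
      bs' = drop (2 * L * (k - n)) bs \<and> s' 4 = (if hit N L (k - n) bs then 0 else s 4))"
  show ?thesis
    unfolding prob_loop_def L_def[symmetric]
  proof (rule runs_While[where I = I and n = k])
    show "k < F" by (rule F)
    show "I k s bs" using bnd k by (simp add: I_def hit_def)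
    fix n s' bs' assume I: "I n s' bs'"
    hence b: "bounded_store S s'" and a: "agree loop_regs s s'" and nk: "n \<le> k" and s17: "s' 17 = int n"
      and bs': "bs' = drop (2 * L * (k - n)) bs" and s4: "s' 4 = (if hit N L (k - n) bs then 0 else s 4)"
      by (auto simp: I_def)
    show "bounded_store S s'" by (rule b)
    show "bounded_store S s' \<and> s' 4 = (if hit N L k bs then 0 else s 4)" if "\<not> aval (Reg 17) s' > 0"
      using that s17 b s4 by simp
    assume "aval (Reg 17) s' > 0"
    hence n0: "n > 0" using s17 by simp
    define j where "j = k - n"
    have kj: "k - (n - 1) = Suc j" using n0 nk by (simp add: j_def)
    have "2 * L * (k - n) + 2 * L \<le> 2 * L * k"
    proof -
      have "2 * L * (k - n) + 2 * L = 2 * L * (k - n + 1)" by simp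
      also have "\<dots> \<le> 2 * L * k" using n0 nk by (intro mult_le_mono2) auto
      finally show ?thesis .
    qed
    hence len: "2 * floorlog 2 N \<le> length bs'" using bs unfolding bs' L_def by simp
    have s0: "s' 0 = int N" using agreeD[OF a, of 0] N(1) by simp
    show "runs orc S F (Seq draw_prog (Seq test_prog (Assign 17 (Op Sub (Reg 17) (Num 1))))) s' bs' (\<lambda>s' bs'. \<exists>m<n. I m s' bs')"
    proof (rule runs_Seq[OF F0], rule runs_mono[OF draw_prog_runs[OF b s0 len LS[unfolded L_def] FL]])
      fix t cs assume "cs = drop (2 * floorlog 2 N) bs' \<and> bounded_store S t \<and> agree {5, 7, 8, 18} s' t \<and>
        (\<exists>u v. decode 0 0 (take (2 * floorlog 2 N) bs') = (u, v) \<and> t 7 = int u \<and> t 8 = int v)"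
      then obtain u v where t: "cs = drop (2 * L) bs'" "bounded_store S t" "agree {5, 7, 8, 18} s' t"
        "decode 0 0 (take (2 * L) bs') = (u, v)" "t 7 = int u" "t 8 = int v" by (auto simp: L_def)
      have t0: "t 0 = int N" "t 4 = s' 4" "t 17 = int n"
        using agreeD[OF t(3), of 0] agreeD[OF t(3), of 4] agreeD[OF t(3), of 17] s0 s17 by simp_all
      have "length (take (2 * L) bs') = 2 * L" using len by (simp add: L_def)
      hence "u < 2 ^ L" "v < 2 ^ L" using decode_bounds[of "take (2 * L) bs'" L 0 0] t(4) by simp_all
      hence uv: "u < m" "v < m" using Lm by linarith+
      have Nm: "N \<le> m" using m by simp
      show "runs orc S F (Seq test_prog (Assign 17 (Op Sub (Reg 17) (Num 1)))) t cs (\<lambda>s' bs'. \<exists>m<n. I m s' bs')"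
      proof (rule runs_Seq[OF F0], rule runs_mono[OF test_prog_runs'[OF orc t(2) t0(1) N(2,3) t(5,6) uv Nm S F(1)]])
        fix w ds assume "ds = cs \<and> bounded_store S w \<and> agree {4, 9, 10, 11, 12, 13, 14, 15, 16} t w \<and> w 4 = (if witness N u v then 0 else t 4)"
        hence w: "ds = cs" "bounded_store S w" "agree {4, 9, 10, 11, 12, 13, 14, 15, 16} t w" "w 4 = (if witness N u v then 0 else t 4)" by auto
        have w17: "w 17 = int n" using agreeD[OF w(3), of 17] t0 by simp
        have nS: "int n < 2 ^ S" using w(2) w17 by (auto simp: bounded_store_def dest: spec[of _ 17])
        define w' where "w' = w(17 := int (n - 1))"
        have "I (n - 1) w' ds"
          unfolding I_def
        proof (intro conjI)
          show "bounded_store S w'" unfolding w'_def using nS by (intro bounded_store_update[OF w(2)]) linarith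
          have "agree loop_regs s t" by (rule agree_trans[OF a t(3)]) auto
          hence "agree loop_regs s w" by (rule agree_trans[OF _ w(3)]) auto
          thus "agree loop_regs s w'" by (simp add: w'_def)
          show "n - 1 \<le> k" using nk by simp
          show "w' 17 = int (n - 1)" by (simp add: w'_def)
          show "ds = drop (2 * L * (k - (n - 1))) bs" unfolding kj w(1) t(1) bs' j_def[symmetric] by (simp add: add.commute)
          have "hit N L (Suc j) bs \<longleftrightarrow> hit N L j bs \<or> witness N u v"
            using t(4) unfolding hit_Suc bs' j_def[symmetric] witness_bits_def by simp
          thus "w' 4 = (if hit N L (k - (n - 1)) bs then 0 else s 4)"
            unfolding kj w'_def using w(4) t0(2) s4 by (auto simp: j_def)
        qed
        hence "\<exists>m<n. I m w' ds" using n0 by (intro exI[of _ "n - 1"]) auto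
        moreover have "w(17 := aval (Op Sub (Reg 17) (Num 1)) w) = w'" using n0 by (simp add: w'_def w17 of_nat_diff)
        ultimately show "runs orc S F (Assign 17 (Op Sub (Reg 17) (Num 1))) w ds (\<lambda>s' bs'. \<exists>m<n. I m s' bs')"
          by (intro runs_Assign[OF w(2)]) simp
      qed
    qed
  qed
qed

lemma det_loop_runs:
  assumes orc: "solves_CRS 2 orc" and bnd: "bounded_store S s" and N: "s 0 = int N" "N > 0" "odd N"
    and Y: "s 19 = int Y" "s 17 = int (Y * Y)" and m: "N \<le> m" "Y \<le> m" and S: "64 * m ^ 4 < 2 ^ S" and F: "2 * S + 1 < F" "Y * Y < F"
  shows "runs orc S F det_loop s bs (\<lambda>s' bs'. bs' = bs \<and> bounded_store S s' \<and>
      s' 4 = (if \<exists>u<Y. \<exists>v<Y. witness N u v then 0 else s 4))"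
proof -
  have F0: "F > 0" using F by simp
  \<comment> \<open>As the counter runs downwards, \<open>P n\<close> says that a witness is among
    the codes already visited.\<close>
  define P where "P = (\<lambda>n. \<exists>c. n \<le> c \<and> c < Y * Y \<and> witness N (c div Y) (c mod Y))"
  define I where "I = (\<lambda>n s' bs'. bs' = bs \<and> bounded_store S s' \<and> agree loop_regs s s' \<and> n \<le> Y * Y \<and> s' 17 = int n \<and>
      s' 4 = (if P n then 0 else s 4))"
  have P0: "P 0 \<longleftrightarrow> (\<exists>u<Y. \<exists>v<Y. witness N u v)"
  proof
    assume "P 0"
    then obtain c where c: "c < Y * Y" "witness N (c div Y) (c mod Y)" by (auto simp: P_def)
    have "Y > 0" using c(1) by (cases Y) auto
    hence "c div Y < Y" "c mod Y < Y" using c(1) by (auto simp: div_less_iff_less_mult)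
    thus "\<exists>u<Y. \<exists>v<Y. witness N u v" using c(2) by blast
  next
    assume "\<exists>u<Y. \<exists>v<Y. witness N u v"
    then obtain u v where uv: "u < Y" "v < Y" "witness N u v" by blast
    have "u * Y + v < Suc u * Y" using uv(2) by simp
    also have "\<dots> \<le> Y * Y" using uv(1) by (intro mult_le_mono1) simp
    finally have "u * Y + v < Y * Y" .
    moreover have "(u * Y + v) div Y = u" "(u * Y + v) mod Y = v" using uv(2) by auto
    ultimately show "P 0" unfolding P_def using uv(3) by (intro exI[of _ "u * Y + v"]) simp
  qed
  show ?thesis
    unfolding det_loop_def P0[symmetric]
  proof (rule runs_While[where I = I and n = "Y * Y"])
    show "Y * Y < F" by (rule F)
    have "\<not> P (Y * Y)" by (auto simp: P_def)
    thus "I (Y * Y) s bs" using bnd Y by (simp add: I_def)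
    fix n s' bs' assume I: "I n s' bs'"
    hence bs': "bs' = bs" and b: "bounded_store S s'" and a: "agree loop_regs s s'" and nY: "n \<le> Y * Y" and s17: "s' 17 = int n"
      and s4: "s' 4 = (if P n then 0 else s 4)" by (auto simp: I_def)
    show "bounded_store S s'" by (rule b)
    show "bs' = bs \<and> bounded_store S s' \<and> s' 4 = (if P 0 then 0 else s 4)" if "\<not> aval (Reg 17) s' > 0"
      using that s17 b s4 bs' by simp
    assume "aval (Reg 17) s' > 0"
    hence n0: "n > 0" using s17 by simp
    have Y0: "Y > 0" using n0 nY by (cases Y) auto
    define c where "c = n - 1"
    have nc: "n = Suc c" using n0 by (simp add: c_def)
    have cY: "c < Y * Y" using nY nc by simp
    define u where "u = c div Y"
    define v where "v = c mod Y"
    have uv: "u < Y" "v < Y" using cY Y0 by (auto simp: u_def v_def div_less_iff_less_mult)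
    hence uvm: "u < m" "v < m" using m by linarith+
    have cS: "int n < 2 ^ S" using b s17 by (auto simp: bounded_store_def dest: spec[of _ 17])
    have "u \<le> c" "v \<le> c" by (simp_all add: u_def v_def)
    hence uS: "int u < 2 ^ S" "int v < 2 ^ S" "int c < 2 ^ S" using cS nc by linarith+
    define t1 where "t1 = s'(17 := int c)"
    define t2 where "t2 = t1(7 := int u)"
    define t3 where "t3 = t2(8 := int v)"
    have b1: "bounded_store S t1" unfolding t1_def using uS by (intro bounded_store_update[OF b]) simp
    have b2: "bounded_store S t2" unfolding t2_def using uS by (intro bounded_store_update[OF b1]) simp
    have b3: "bounded_store S t3" unfolding t3_def using uS by (intro bounded_store_update[OF b2]) simp
    have s19: "s' 19 = int Y" using agreeD[OF a, of 19] Y by simp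
    have s0: "s' 0 = int N" using agreeD[OF a, of 0] N(1) by simp
    have e1: "s'(17 := aval (Op Sub (Reg 17) (Num 1)) s') = t1" by (simp add: t1_def s17 nc)
    have e2: "t1(7 := aval (Op Quo (Reg 17) (Reg 19)) t1) = t2" by (simp add: t2_def t1_def s19 u_def zdiv_int)
    have e3: "t2(8 := aval (Op Rem (Reg 17) (Reg 19)) t2) = t3" by (simp add: t3_def t2_def t1_def s19 v_def zmod_int)
    have t3v: "t3 0 = int N" "t3 7 = int u" "t3 8 = int v" "t3 17 = int c" "t3 4 = s' 4"
      using s0 by (simp_all add: t3_def t2_def t1_def)
    have Pn: "P c \<longleftrightarrow> P n \<or> witness N u v"
    proof -
      have "P c \<longleftrightarrow> (\<exists>d. (d = c \<or> Suc c \<le> d) \<and> d < Y * Y \<and> witness N (d div Y) (d mod Y))"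
        unfolding P_def by (metis Suc_leD Suc_leI le_eq_less_or_eq)
      thus ?thesis unfolding P_def nc u_def v_def using cY by blast
    qed
    have tst: "runs orc S F test_prog t3 bs' (\<lambda>s' bs'. \<exists>m<n. I m s' bs')"
    proof (rule runs_mono[OF test_prog_runs'[OF orc b3 t3v(1) N(2,3) t3v(2,3) uvm m(1) S F(1)]])
      fix w ds assume "ds = bs' \<and> bounded_store S w \<and> agree {4, 9, 10, 11, 12, 13, 14, 15, 16} t3 w \<and> w 4 = (if witness N u v then 0 else t3 4)"
      hence w: "ds = bs'" "bounded_store S w" "agree {4, 9, 10, 11, 12, 13, 14, 15, 16} t3 w" "w 4 = (if witness N u v then 0 else t3 4)" by auto
      have "agree loop_regs s t3" using a by (simp add: t3_def t2_def t1_def)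
      hence "agree loop_regs s w" by (rule agree_trans[OF _ w(3)]) auto
      moreover have "w 17 = int c" using agreeD[OF w(3), of 17] t3v by simp
      ultimately have "I c w ds" unfolding I_def using w bs' cY t3v s4 Pn by auto
      thus "\<exists>m<n. I m w ds" using nc by blast
    qed
    show "runs orc S F (Seq (Assign 17 (Op Sub (Reg 17) (Num 1))) (Seq (Assign 7 (Op Quo (Reg 17) (Reg 19)))
     (Seq (Assign 8 (Op Rem (Reg 17) (Reg 19))) test_prog))) s' bs' (\<lambda>s' bs'. \<exists>m<n. I m s' bs')"
      by (rule runs_Seq[OF F0], rule runs_Assign[OF b], unfold e1, rule runs_Seq[OF F0], rule runs_Assign[OF b1], unfold e2,
          rule runs_Seq[OF F0], rule runs_Assign[OF b2], unfold e3, rule tst)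
  qed
qed

section \<open>Counting coin sequences\<close>

lemma toss_free_exec:
  "exec orc c s bs t s' bs' \<Longrightarrow> toss_free c \<Longrightarrow> bs' = bs \<and> (\<forall>cs. exec orc c s cs t s' cs)"
  by (induction rule: exec.induct) (auto intro: exec.intros simp del: One_nat_def)

text \<open>The preprocessing tosses no coin, so its final store is the same for all coin sequences.
  This lets the number left by trial division be fixed before any coins are considered.\<close>

lemma toss_free_runs:
  assumes "toss_free c" "runs orc S F c s [] Q"
  obtains s' where "Q s' []" "\<And>bs R. R s' bs \<Longrightarrow> runs orc S F c s bs R"
proof -
  obtain t s' bs' where 1: "exec orc c s [] t s' bs'" "t \<le> time_bound S F c" "Q s' bs'"
    using assms(2) by (auto simp: runs_def)
  have 2: "bs' = []" "\<And>cs. exec orc c s cs t s' cs" using toss_free_exec[OF 1(1) assms(1)] by auto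
  show ?thesis
  proof (rule that[of s'])
    show "Q s' []" using 1(3) 2(1) by simp
    show "runs orc S F c s bs R" if "R s' bs" for bs R unfolding runs_def using 1(2) 2(2)[of bs] that by blast
  qed
qed

lemma pre_prog_toss_free: "toss_free pre_prog"
  by (simp add: pre_prog_def size_prog_def strip_prog_def strip_body_def)

text \<open>The bound \<open>(15/16) ^ n\<close> for \<open>n\<close> independent rounds, in
  integers; \<open>r\<close> counts the coins left over. The block of the first round is split off,
  since the later rounds form a sequence of the same kind.\<close>

lemma card_no_hit:
  assumes W: "4 ^ L \<le> 16 * card {(u, v). u < 2 ^ L \<and> v < 2 ^ L \<and> witness N u v}"
  shows "card {bs. length bs = 2 * L * n + r \<and> \<not> hit N L n bs} * 16 ^ n \<le> 15 ^ n * 2 ^ (2 * L * n + r)"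
proof (induction n)
  case 0
  have "card {bs :: bool list. length bs = r} = 2 ^ r"
    using card_lists_length_eq[of "UNIV :: bool set" r] by simp
  thus ?case by (simp add: hit_def)
next
  case (Suc n)
  define w where "w = witness_bits N"
  define X where "X = {xs. length xs = 2 * L \<and> \<not> w xs}"
  define Y where "Y = {bs. length bs = 2 * L * n + r \<and> \<not> hit N L n bs}"
  have fin: "finite {xs :: bool list. length xs = l}" for l
    using finite_lists_length_eq[of "UNIV :: bool set" l] by simp
  have "{bs. length bs = 2 * L * Suc n + r \<and> \<not> hit N L (Suc n) bs} \<subseteq> (\<lambda>(xs, ys). xs @ ys) ` (X \<times> Y)"
  proof
    fix bs assume "bs \<in> {bs. length bs = 2 * L * Suc n + r \<and> \<not> hit N L (Suc n) bs}"
    hence bs: "length bs = 2 * L * Suc n + r" "\<not> hit N L (Suc n) bs" by auto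
    have nw: "\<not> w (take (2 * L) (drop (2 * L * j) bs))" if "j < Suc n" for j
      using bs(2) that unfolding hit_def w_def by blast
    have "take (2 * L) bs \<in> X" using nw[of 0] bs(1) by (simp add: X_def)
    moreover have "drop (2 * L) bs \<in> Y"
    proof -
      have "\<not> w (take (2 * L) (drop (2 * L * j) (drop (2 * L) bs)))" if "j < n" for j
        using nw[of "Suc j"] that by (simp add: add.commute)
      hence "\<not> hit N L n (drop (2 * L) bs)" unfolding hit_def w_def by blast
      thus ?thesis using bs(1) unfolding Y_def by simp
    qed
    ultimately show "bs \<in> (\<lambda>(xs, ys). xs @ ys) ` (X \<times> Y)"
      by (intro image_eqI[of _ _ "(take (2 * L) bs, drop (2 * L) bs)"]) auto
  qed
  moreover have "finite X" by (rule finite_subset[OF _ fin[of "2 * L"]]) (auto simp: X_def)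
  moreover have "finite Y" by (rule finite_subset[OF _ fin[of "2 * L * n + r"]]) (auto simp: Y_def)
  ultimately have "card {bs. length bs = 2 * L * Suc n + r \<and> \<not> hit N L (Suc n) bs} \<le> card ((\<lambda>(xs, ys). xs @ ys) ` (X \<times> Y))"
    by (intro card_mono) auto
  also have "\<dots> \<le> card X * card Y"
    using card_image_le[of "X \<times> Y" "\<lambda>(xs, ys). xs @ ys"] \<open>finite X\<close> \<open>finite Y\<close> by (simp add: card_cartesian_product)
  finally have le: "card {bs. length bs = 2 * L * Suc n + r \<and> \<not> hit N L (Suc n) bs} \<le> card X * card Y" .
  have X: "16 * card X \<le> 15 * 4 ^ L"
  proof -
    define B where "B = {xs. length xs = 2 * L \<and> w xs}"
    have "bij_betw (decode 0 0) B {(u, v). u < 2 ^ L \<and> v < 2 ^ L \<and> witness N u v}"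
    proof (rule bij_betw_imageI)
      show "inj_on (decode 0 0) B"
        by (rule inj_on_subset[OF bij_betw_imp_inj_on[OF bij_betw_decode[of L]]]) (auto simp: B_def)
      have im: "decode 0 0 ` {bs. length bs = 2 * L} = {..<2 ^ L} \<times> {..<2 ^ L}"
        by (rule bij_betw_imp_surj_on[OF bij_betw_decode])
      show "decode 0 0 ` B = {(u, v). u < 2 ^ L \<and> v < 2 ^ L \<and> witness N u v}"
      proof (intro equalityI subsetI)
        fix z assume "z \<in> decode 0 0 ` B"
        then obtain xs where xs: "z = decode 0 0 xs" "length xs = 2 * L" "w xs" by (auto simp: B_def)
        hence "z \<in> {..<2 ^ L} \<times> {..<2 ^ L}" using im by blast
        thus "z \<in> {(u, v). u < 2 ^ L \<and> v < 2 ^ L \<and> witness N u v}" using xs by (auto simp: w_def witness_bits_def split: prod.splits)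
      next
        fix z assume z: "z \<in> {(u, v). u < 2 ^ L \<and> v < 2 ^ L \<and> witness N u v}"
        hence "z \<in> decode 0 0 ` {bs. length bs = 2 * L}" unfolding im by auto
        then obtain xs where xs: "z = decode 0 0 xs" "length xs = 2 * L" by auto
        obtain u v where uv: "z = (u, v)" by (cases z)
        hence "w xs" using z xs(1) by (simp add: w_def witness_bits_def)
        thus "z \<in> decode 0 0 ` B" using xs by (auto simp: B_def)
      qed
    qed
    hence "card B = card {(u, v). u < 2 ^ L \<and> v < 2 ^ L \<and> witness N u v}" by (rule bij_betw_same_card)
    moreover have "card X + card B = card {xs :: bool list. length xs = 2 * L}"
    proof -
      have "finite B" by (rule finite_subset[OF _ fin[of "2 * L"]]) (auto simp: B_def)
      hence "card (X \<union> B) = card X + card B" using \<open>finite X\<close> by (intro card_Un_disjoint) (auto simp: X_def B_def)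
      moreover have "X \<union> B = {xs. length xs = 2 * L}" by (auto simp: X_def B_def)
      ultimately show ?thesis by simp
    qed
    moreover have "card {xs :: bool list. length xs = 2 * L} = 4 ^ L"
      using card_lists_length_eq[of "UNIV :: bool set" "2 * L"] by (simp add: power_mult)
    ultimately show ?thesis using W by linarith
  qed
  have "card {bs. length bs = 2 * L * Suc n + r \<and> \<not> hit N L (Suc n) bs} * 16 ^ Suc n \<le> (card X * card Y) * 16 ^ Suc n"
    by (rule mult_le_mono1[OF le])
  also have "\<dots> = (16 * card X) * (card Y * 16 ^ n)" by simp
  also have "\<dots> \<le> (15 * 4 ^ L) * (15 ^ n * 2 ^ (2 * L * n + r))"
    by (rule mult_le_mono[OF X Suc.IH[folded Y_def]])
  also have "\<dots> = 15 ^ Suc n * 2 ^ (2 * L * Suc n + r)"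
  proof -
    have "(4::nat) ^ L = 2 ^ (2 * L)" by (simp add: power_mult)
    thus ?thesis by (simp add: power_add algebra_simps)
  qed
  finally show ?case .
qed

lemma card_no_hit_le:
  assumes "4 ^ L \<le> 16 * card {(u, v). u < 2 ^ L \<and> v < 2 ^ L \<and> witness N u v}" "2 * L * (11 * k) \<le> T"
  shows "2 ^ k * card {bs. length bs = T \<and> \<not> hit N L (11 * k) bs} \<le> 2 ^ T"
proof -
  obtain r where r: "T = 2 * L * (11 * k) + r" using assms(2) le_Suc_ex by blast
  define c where "c = card {bs. length bs = T \<and> \<not> hit N L (11 * k) bs}"
  have "c * 16 ^ (11 * k) \<le> 15 ^ (11 * k) * 2 ^ T" unfolding c_def r by (rule card_no_hit[OF assms(1)])
  hence "2 ^ k * (c * 16 ^ (11 * k)) \<le> 2 ^ k * (15 ^ (11 * k) * 2 ^ T)" by simp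
  also have "\<dots> = (2 * 15 ^ 11) ^ k * 2 ^ T" by (simp only: power_mult_distrib power_mult mult.assoc)
  also have "\<dots> \<le> (16 ^ 11) ^ k * 2 ^ T" by (intro mult_le_mono1 power_mono) simp_all
  also have "\<dots> = 16 ^ (11 * k) * 2 ^ T" by (simp only: power_mult)
  finally have "16 ^ (11 * k) * (2 ^ k * c) \<le> 16 ^ (11 * k) * 2 ^ T" by (simp only: mult_ac)
  thus ?thesis unfolding c_def by simp
qed

subsection \<open>The reductions\<close>

text \<open>\<open>K\<close> is the error parameter of the probabilistic program and the search
  range of the deterministic one. The factor 4 accounts for \<open>w\<^sup>2\<close>, of degree 4 in
  \<open>u\<close> and \<open>v\<close>, and the last summand 6 for the constant 64 of
  \<open>norm_pair_bound\<close>.\<close>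

definition reg_bits :: "nat \<Rightarrow> nat \<Rightarrow> nat" where
  "reg_bits L K = 4 * (L + K + 6) + 6"

text \<open>One bound for all loops: \<open>9 * L\<close> for trial division, twice the register
  size for Euclid's algorithm, \<open>11 * K\<close> for the random rounds and \<open>K * K\<close>
  for the exhaustive search.\<close>

definition max_iter :: "nat \<Rightarrow> nat \<Rightarrow> nat" where
  "max_iter L K = 9 * L + 2 * reg_bits L K + 11 * K + K * K + 5"

lemma reg_bits_bound:
  assumes "N < 2 ^ L"
  shows "64 * (2 * N + 11 * K + 10) ^ 4 < 2 ^ reg_bits L K"
proof -
  have e: "(2::nat) ^ (L + K + 6) = 2 ^ L * 2 ^ K * 64" by (simp add: power_add)
  have "K < 2 ^ K" by (rule less_exp)
  have LK: "(2::nat) ^ L \<le> 2 ^ L * 2 ^ K" "(2::nat) ^ K \<le> 2 ^ L * 2 ^ K" "1 \<le> (2::nat) ^ L * 2 ^ K" by simp_all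
  have "2 * N + 11 * K + 10 < 2 ^ (L + K + 6)" unfolding e using assms \<open>K < 2 ^ K\<close> LK by linarith
  hence "(2 * N + 11 * K + 10) ^ 4 < (2 ^ (L + K + 6)) ^ 4" by (intro power_strict_mono) auto
  also have "\<dots> = 2 ^ (4 * (L + K + 6))" by (simp only: power_mult[symmetric] mult.commute)
  finally show ?thesis unfolding reg_bits_def power_add by simp
qed

lemma input_bounded:
  assumes "\<And>x. x \<in> set xs \<Longrightarrow> x < 2 ^ S"
  shows "bounded_store S (input xs)"
  unfolding bounded_store_def input_def using int_less_pow2[OF assms] by auto

lemma strip_inv_result:
  assumes "strip_inv N (8 * L + 1) s" "L > 0"
  obtains M where "s 0 = int M" "M > 0" "odd M" "M \<le> N" "\<And>p. prime p \<Longrightarrow> p dvd M \<Longrightarrow> 8 * L \<le> p"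
    "sum_of_two_squares N \<Longrightarrow> s 4 = 1 \<and> sum_of_two_squares M"
    "\<not> sum_of_two_squares N \<Longrightarrow> s 4 = 0 \<or> s 4 = 1 \<and> \<not> sum_of_two_squares M"
proof -
  obtain M where M: "M > 0" "s 0 = int M" "M \<le> N" "\<And>p. prime p \<Longrightarrow> p dvd M \<Longrightarrow> 8 * L + 1 \<le> p"
    "s 4 = 1 \<and> (sum_of_two_squares M \<longleftrightarrow> sum_of_two_squares N) \<or> s 4 = 0 \<and> \<not> sum_of_two_squares N"
    using assms(1) unfolding strip_inv_def by blast
  have "odd M"
  proof
    assume "even M"
    hence "8 * L + 1 \<le> 2" by (intro M(4)) auto
    thus False using assms(2) by simp
  qed
  show ?thesis
  proof (rule that[OF M(2,1) \<open>odd M\<close> M(3)])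
    show "8 * L \<le> p" if "prime p" "p dvd M" for p using M(4)[OF that] by simp
    show "s 4 = 1 \<and> sum_of_two_squares M" if "sum_of_two_squares N" using M(5) that by blast
    show "s 4 = 0 \<or> s 4 = 1 \<and> \<not> sum_of_two_squares M" if "\<not> sum_of_two_squares N" using M(5) that by blast
  qed
qed

lemma no_witness_two_squares: "N > 0 \<Longrightarrow> sum_of_two_squares N \<Longrightarrow> \<not> witness N u v"
proof
  assume N: "N > 0" "sum_of_two_squares N" and w: "witness N u v"
  have "coprime (int (norm_pair u v)) (int N)" using w unfolding witness_def coprime_int_iff by blast
  hence "jacobi3 N (int (norm_pair u v)) = 1" by (rule jacobi3_two_squares[OF N])
  moreover have "jacobi3 N (int (norm_pair u v)) = -1" using w unfolding witness_def by blast
  ultimately show False by linarith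
qed

text \<open>The number \<open>M\<close> left by trial division and the flag \<open>fl\<close> are
  quantified before the coins, since coin sequences are later counted for one fixed
  \<open>M\<close>.\<close>

lemma prob_prog_runs:
  assumes orc: "solves_CRS 2 orc" and N: "N > 0"
  defines "L \<equiv> floorlog 2 N"
  shows "\<exists>M fl :: nat. M > 0 \<and> odd M \<and> M \<le> N \<and> (sum_of_two_squares N \<longrightarrow> fl = 1 \<and> sum_of_two_squares M) \<and>
    (\<not> sum_of_two_squares N \<longrightarrow> fl = 0 \<or> \<not> sum_of_two_squares M) \<and> (\<forall>p. prime p \<and> p dvd M \<longrightarrow> 8 * L \<le> p) \<and>
    (\<forall>bs. 2 * L * (11 * k) \<le> length bs \<longrightarrow> runs orc (reg_bits L k) (max_iter L k) prob_prog (input [N, k]) bs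
       (\<lambda>s' bs'. s' 0 = (if hit M (floorlog 2 M) (11 * k) bs then 0 else int fl)))"
proof -
  define S where "S = reg_bits L k"
  define F where "F = max_iter L k"
  define m where "m = 2 * N + 11 * k + 10"
  have F0: "F > 0" by (simp add: F_def max_iter_def)
  have NL: "N < 2 ^ L" using floorlog_bounds[of N 2] N by (simp add: L_def)
  have mS: "64 * m ^ 4 < 2 ^ S" unfolding m_def S_def by (rule reg_bits_bound[OF NL])
  have "m \<le> m ^ 4" by (rule self_le_power) (auto simp: m_def)
  hence mS': "64 * m < 2 ^ S" using mS by linarith
  have small: "N < 2 ^ S" "k < 2 ^ S" "11 * k < 2 ^ S" "8 * N + 2 < 2 ^ S"
    by (rule le_less_trans[OF _ mS'], simp add: m_def)+
  have b0: "bounded_store S (input [N, k])" by (rule input_bounded) (use small in auto)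
  have i: "input [N, k] 0 = int N" "input [N, k] 1 = int k" by (simp_all add: input_def)
  have "8 * int N + 2 < 2 ^ S" using int_less_pow2[OF small(4)] by simp
  moreover have "9 * floorlog 2 N < F" by (simp add: F_def max_iter_def L_def)
  ultimately have "runs orc S F pre_prog (input [N, k]) [] (\<lambda>s' bs'. bs' = [] \<and> bounded_store S s' \<and> agree {0, 2, 3, 4, 5, 6} (input [N, k]) s' \<and>
      s' 6 = int (floorlog 2 N) \<and> strip_inv N (8 * floorlog 2 N + 1) s')"
    by (intro pre_prog_runs[OF b0 i(1) N])
  then obtain s where s: "bounded_store S s" "agree {0, 2, 3, 4, 5, 6} (input [N, k]) s" "strip_inv N (8 * L + 1) s"
    and run: "\<And>bs R. R s bs \<Longrightarrow> runs orc S F pre_prog (input [N, k]) bs R"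
    by (rule toss_free_runs[OF pre_prog_toss_free]) (auto simp: L_def)
  have L0: "L > 0" using floorlog_pos[OF N] by (simp add: L_def)
  obtain M where M: "s 0 = int M" "M > 0" "odd M" "M \<le> N" "\<And>p. prime p \<Longrightarrow> p dvd M \<Longrightarrow> 8 * L \<le> p"
    "sum_of_two_squares N \<Longrightarrow> s 4 = 1 \<and> sum_of_two_squares M"
    "\<not> sum_of_two_squares N \<Longrightarrow> s 4 = 0 \<or> s 4 = 1 \<and> \<not> sum_of_two_squares M"
    using strip_inv_result[OF s(3) L0] by metis
  have s4: "s 4 = 0 \<or> s 4 = 1" using M(6,7) by blast
  define fl where "fl = nat (s 4)"
  have fl: "s 4 = int fl" "fl = 0 \<or> fl = 1" using s4 by (auto simp: fl_def)
  have s1: "s 1 = int k" using agreeD[OF s(2), of 1] i by simp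
  have r5: "sum_of_two_squares N \<longrightarrow> fl = 1 \<and> sum_of_two_squares M" using M(6) fl(1) by simp
  have r6: "\<not> sum_of_two_squares N \<longrightarrow> fl = 0 \<or> \<not> sum_of_two_squares M" using M(7) fl(1) by auto
  have r7: "\<forall>p. prime p \<and> p dvd M \<longrightarrow> 8 * L \<le> p" using M(5) by blast
  have r8: "\<forall>bs. 2 * L * (11 * k) \<le> length bs \<longrightarrow> runs orc (reg_bits L k) (max_iter L k) prob_prog (input [N, k]) bs
       (\<lambda>s' bs'. s' 0 = (if hit M (floorlog 2 M) (11 * k) bs then 0 else int fl))"
  proof (intro allI impI)
    fix bs :: "bool list" assume bs: "2 * L * (11 * k) \<le> length bs"
    have flM: "floorlog 2 M \<le> L" unfolding L_def by (rule floorlog_2_mono[OF M(4)])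
    have "2 * floorlog 2 M * (11 * k) \<le> 2 * L * (11 * k)" using flM by (intro mult_le_mono1 mult_le_mono2)
    hence bs': "2 * floorlog 2 M * (11 * k) \<le> length bs" using bs by linarith
    define t where "t = s(17 := int (11 * k))"
    have bt: "bounded_store S t" unfolding t_def using int_less_pow2[OF small(3)] by (intro bounded_store_update[OF s(1)]) simp
    have tv: "t 0 = int M" "t 17 = int (11 * k)" "t 4 = int fl" using M(1) fl(1) by (simp_all add: t_def)
    have Fs: "2 * S + 1 < F" "11 * k < F" by (simp_all add: F_def S_def max_iter_def)
    have "2 * M \<le> m" using M(4) by (simp add: m_def)
    hence "runs orc S F prob_loop t bs (\<lambda>s' bs'. bounded_store S s' \<and> s' 4 = (if hit M (floorlog 2 M) (11 * k) bs then 0 else t 4))"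
      by (intro prob_loop_runs[OF orc bt tv(1) M(2,3) tv(2) bs' _ mS Fs])
    hence lp: "runs orc S F prob_loop t bs (\<lambda>s' bs'. runs orc S F (Assign 0 (Reg 4)) s' bs'
        (\<lambda>s' bs'. s' 0 = (if hit M (floorlog 2 M) (11 * k) bs then 0 else int fl)))"
      by (rule runs_mono) (auto intro!: runs_Assign simp: tv(3))
    have e: "s(17 := aval (Op Mul (Num 11) (Reg 1)) s) = t" by (simp add: t_def s1[simplified])
    show "runs orc (reg_bits L k) (max_iter L k) prob_prog (input [N, k]) bs
       (\<lambda>s' bs'. s' 0 = (if hit M (floorlog 2 M) (11 * k) bs then 0 else int fl))"
      unfolding prob_prog_def S_def[symmetric] F_def[symmetric]
      by (rule runs_Seq[OF F0], rule run, rule runs_Seq[OF F0], rule runs_Assign[OF s(1)], unfold e, rule runs_Seq[OF F0], rule lp)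
  qed
  show ?thesis by (rule exI[of _ M], rule exI[of _ fl]) (intro conjI M(2,3,4) r5 r6 r7 r8)
qed

lemma probabilistic_reduction: "probabilistic_poly_reduction sum_of_two_squares (solves_CRS 2) prob_prog"
  unfolding probabilistic_poly_reduction_def
proof
  fix k :: nat
  define c where "c = cmd_factor prob_prog"
  define d where "d = loop_depth prob_prog"
  \<comment> \<open>Its value has to bound the running time and also to provide the coins of all
    \<open>11 * k\<close> rounds, whence the last summand.\<close>
  define p :: "nat poly" where "p = [:c:] * [:4 * k + 31, 4:] * [:19 * k + k * k + 65, 17:] ^ d + [:0, 22 * k:]"
  have p: "poly p L = time_bound (reg_bits L k) (max_iter L k) prob_prog + 2 * L * (11 * k)" for L
  proof -
    have "reg_bits L k + 1 = 4 * k + 31 + L * 4" "max_iter L k = 19 * k + k * k + 65 + L * 17"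
      by (simp_all add: reg_bits_def max_iter_def)
    thus ?thesis unfolding time_bound_def p_def c_def[symmetric] d_def[symmetric]
      by (simp add: poly_power algebra_simps)
  qed
  show "\<exists>p :: nat poly. \<forall>orc. solves_CRS 2 orc \<longrightarrow> (\<forall>N>0.
        let T = poly p (floorlog 2 N); coins = {bs :: bool list. length bs = T} in
          (\<forall>bs\<in>coins. \<exists>t s' bs'. exec orc prob_prog (input [N, k]) bs t s' bs' \<and> t \<le> T) \<and>
          measure_pmf.prob (pmf_of_set coins)
            {bs. \<exists>t s' bs'. exec orc prob_prog (input [N, k]) bs t s' bs' \<and> s' 0 = of_bool (sum_of_two_squares N)}
          \<ge> 1 - 1 / 2 ^ k)"
  proof (rule exI[of _ p], intro allI impI)
    fix orc N assume orc: "solves_CRS 2 orc" and N: "N > (0::nat)"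
    define L where "L = floorlog 2 N"
    define T where "T = poly p L"
    define coins where "coins = {bs :: bool list. length bs = T}"
    define A where "A = {bs. \<exists>t s' bs'. exec orc prob_prog (input [N, k]) bs t s' bs' \<and> s' 0 = of_bool (sum_of_two_squares N)}"
    obtain M fl :: nat where M: "M > 0" "odd M" "M \<le> N" "sum_of_two_squares N \<longrightarrow> fl = 1 \<and> sum_of_two_squares M"
      "\<not> sum_of_two_squares N \<longrightarrow> fl = 0 \<or> \<not> sum_of_two_squares M" "\<forall>p. prime p \<and> p dvd M \<longrightarrow> 8 * L \<le> p"
      "\<forall>bs. 2 * L * (11 * k) \<le> length bs \<longrightarrow> runs orc (reg_bits L k) (max_iter L k) prob_prog (input [N, k]) bs
       (\<lambda>s' bs'. s' 0 = (if hit M (floorlog 2 M) (11 * k) bs then 0 else int fl))"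
      using prob_prog_runs[OF orc N, of k, folded L_def] by (elim exE conjE) (rule that; assumption)
    define H where "H = (\<lambda>bs. hit M (floorlog 2 M) (11 * k) bs)"
    have T: "time_bound (reg_bits L k) (max_iter L k) prob_prog \<le> T" "2 * L * (11 * k) \<le> T"
      unfolding T_def p by simp_all
    have run: "\<exists>t s' bs'. exec orc prob_prog (input [N, k]) bs t s' bs' \<and> t \<le> T \<and> s' 0 = (if H bs then 0 else int fl)"
      if "bs \<in> coins" for bs
    proof -
      have "2 * L * (11 * k) \<le> length bs" using that T(2) by (simp add: coins_def)
      hence "runs orc (reg_bits L k) (max_iter L k) prob_prog (input [N, k]) bs (\<lambda>s' bs'. s' 0 = (if H bs then 0 else int fl))"
        using M(7) unfolding H_def by blast
      thus ?thesis using T(1) unfolding runs_def using order_trans by blast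
    qed
    have fin: "finite coins" using finite_lists_length_eq[of "UNIV :: bool set" T] by (simp add: coins_def)
    have cc: "card coins = 2 ^ T" using card_lists_length_eq[of "UNIV :: bool set" T] by (simp add: coins_def)
    have ne: "coins \<noteq> {}" using cc by (metis card.empty power_eq_0_iff zero_neq_numeral)
    have inA: "bs \<in> A" if bs: "bs \<in> coins" and eq: "(if H bs then 0 else int fl) = of_bool (sum_of_two_squares N)" for bs
    proof -
      obtain t s' bs' where "exec orc prob_prog (input [N, k]) bs t s' bs'" "s' 0 = (if H bs then 0 else int fl)"
        using run[OF bs] by blast
      thus ?thesis unfolding A_def eq by blast
    qed
    \<comment> \<open>The error is one-sided: for sums of two squares there are no witnesses and
      every coin sequence is good. Otherwise a bad sequence misses all witnesses of
      \<open>M\<close>.\<close>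
    have bad: "2 ^ k * card (coins - A) \<le> 2 ^ T"
    proof (cases "sum_of_two_squares N")
      case True
      have "\<not> H bs" for bs
        unfolding H_def hit_def witness_bits_def using no_witness_two_squares[OF M(1)] M(4) True by (auto split: prod.splits)
      hence "coins \<subseteq> A" using inA M(4) True by (intro subsetI) simp
      hence "coins - A = {}" by (simp only: Diff_eq_empty_iff)
      thus ?thesis by (simp only: card.empty)
    next
      case False
      show ?thesis
      proof (cases "fl = 0")
        case True
        hence "coins \<subseteq> A" using inA False by (intro subsetI) simp
        hence "coins - A = {}" by (simp only: Diff_eq_empty_iff)
        thus ?thesis by (simp only: card.empty)
      next
        case fl: False
        hence nM: "\<not> sum_of_two_squares M" using M(5) False by simp
        have flM: "floorlog 2 M \<le> L" unfolding L_def by (rule floorlog_2_mono[OF M(3)])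
        have W: "4 ^ floorlog 2 M \<le> 16 * card {(u, v). u < 2 ^ floorlog 2 M \<and> v < 2 ^ floorlog 2 M \<and> witness M u v}"
          unfolding witness_def by (rule card_witnesses[OF M(1,2) nM _ flM]) (use M(6) in blast)
        have "2 * floorlog 2 M * (11 * k) \<le> 2 * L * (11 * k)" using flM by (intro mult_le_mono1 mult_le_mono2)
        hence "2 * floorlog 2 M * (11 * k) \<le> T" using T(2) by linarith
        from card_no_hit_le[OF W this]
        have nh: "2 ^ k * card {bs. length bs = T \<and> \<not> H bs} \<le> 2 ^ T" by (simp add: H_def)
        have "coins - A \<subseteq> {bs. length bs = T \<and> \<not> H bs}"
        proof
          fix bs assume bs: "bs \<in> coins - A"
          hence "\<not> H bs" using inA[of bs] False by auto
          thus "bs \<in> {bs. length bs = T \<and> \<not> H bs}" using bs by (simp add: coins_def)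
        qed
        hence "card (coins - A) \<le> card {bs. length bs = T \<and> \<not> H bs}"
          by (rule card_mono[rotated]) (rule finite_subset[OF _ fin], auto simp: coins_def)
        thus ?thesis using nh by (meson mult_le_mono2 order_trans)
      qed
    qed
    have "card coins = card (coins \<inter> A) + card (coins - A)"
      using card_Un_disjoint[of "coins \<inter> A" "coins - A"] fin by (simp add: Int_Diff_Un Int_Diff_disjoint)
    hence "real (card (coins \<inter> A)) = 2 ^ T - real (card (coins - A))"
      unfolding cc by (metis add_diff_cancel_right' of_nat_add of_nat_numeral of_nat_power)
    moreover have "measure_pmf.prob (pmf_of_set coins) A = real (card (coins \<inter> A)) / 2 ^ T"
      using measure_pmf_of_set[OF ne fin, of A] cc by simp
    moreover have "real (card (coins - A)) / 2 ^ T \<le> 1 / 2 ^ k"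
    proof -
      have "real (2 ^ k * card (coins - A)) \<le> real (2 ^ T)" using bad by (simp only: of_nat_le_iff)
      thus ?thesis by (simp add: field_simps)
    qed
    ultimately have "measure_pmf.prob (pmf_of_set coins) A \<ge> 1 - 1 / 2 ^ k" by (simp add: diff_divide_distrib)
    moreover have "\<forall>bs\<in>coins. \<exists>t s' bs'. exec orc prob_prog (input [N, k]) bs t s' bs' \<and> t \<le> T" using run by blast
    ultimately show "let T = poly p (floorlog 2 N); coins = {bs :: bool list. length bs = T} in
          (\<forall>bs\<in>coins. \<exists>t s' bs'. exec orc prob_prog (input [N, k]) bs t s' bs' \<and> t \<le> T) \<and>
          measure_pmf.prob (pmf_of_set coins)
            {bs. \<exists>t s' bs'. exec orc prob_prog (input [N, k]) bs t s' bs' \<and> s' 0 = of_bool (sum_of_two_squares N)}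
          \<ge> 1 - 1 / 2 ^ k"
      unfolding Let_def A_def coins_def T_def L_def by blast
  qed
qed

text \<open>The hypothesis enters only through the constant \<open>C\<close>, which is written into
  the program and fixes the search range as a polynomial in the size of the input.\<close>

lemma deterministic_reduction:
  assumes ERH: extended_riemann_hypothesis
  shows "\<exists>c. deterministic_poly_reduction sum_of_two_squares (solves_CRS 2) c"
proof -
  obtain C where C: "\<And>N. N > 0 \<Longrightarrow> odd N \<Longrightarrow> \<not> sum_of_two_squares N \<Longrightarrow>
    \<exists>u v. u < C * floorlog 2 N ^ 16 \<and> v < C * floorlog 2 N ^ 16 \<and> witness N u v"
    using small_witness[OF ERH] unfolding witness_def by blast
  define Yf where "Yf = (\<lambda>L::nat. C * L ^ 16)"
  define PY :: "nat poly" where "PY = Polynomial.monom C 16"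
  define c where "c = cmd_factor (det_prog C)"
  define d where "d = loop_depth (det_prog C)"
  define p :: "nat poly" where "p = [:c:] * ([:31, 4:] + [:4:] * PY) * ([:65, 17:] + [:19:] * PY + PY * PY) ^ d"
  have p: "poly p L = time_bound (reg_bits L (Yf L)) (max_iter L (Yf L)) (det_prog C)" for L
  proof -
    have Y: "poly PY L = Yf L" by (simp add: PY_def Yf_def poly_monom)
    have "reg_bits L (Yf L) + 1 = 31 + L * 4 + 4 * Yf L" "max_iter L (Yf L) = 65 + L * 17 + 19 * Yf L + Yf L * Yf L"
      by (simp_all add: reg_bits_def max_iter_def)
    thus ?thesis unfolding time_bound_def p_def c_def[symmetric] d_def[symmetric]
      by (simp add: poly_power Y)
  qed
  have tf: "toss_free (det_prog C)"
    by (simp add: det_prog_def pre_prog_toss_free det_loop_def test_prog_def gcd_loop_def query_prog_def)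
  have "\<exists>t s'. exec orc (det_prog C) (input [N]) [] t s' [] \<and> t \<le> poly p (floorlog 2 N) \<and> s' 0 = of_bool (sum_of_two_squares N)"
    if orc: "solves_CRS 2 orc" and N: "N > 0" for orc N
  proof -
    define L where "L = floorlog 2 N"
    define Y where "Y = Yf L"
    define S where "S = reg_bits L Y"
    define F where "F = max_iter L Y"
    define m where "m = 2 * N + 11 * Y + 10"
    have F0: "F > 0" by (simp add: F_def max_iter_def)
    have NL: "N < 2 ^ L" using floorlog_bounds[of N 2] N by (simp add: L_def)
    have L0: "L > 0" using floorlog_pos[OF N] by (simp add: L_def)
    have mS: "64 * m ^ 4 < 2 ^ S" unfolding m_def S_def by (rule reg_bits_bound[OF NL])
    have m1: "1 \<le> m" by (simp add: m_def)
    have "m \<le> m ^ 4" by (rule self_le_power[OF m1]) simp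
    hence mS': "64 * m < 2 ^ S" using mS by linarith
    have small: "N < 2 ^ S" "Y < 2 ^ S" "8 * N + 2 < 2 ^ S"
      by (rule le_less_trans[OF _ mS'], simp add: m_def)+
    have "Y * Y \<le> m * m" by (intro mult_le_mono) (simp_all add: m_def)
    also have "\<dots> \<le> m ^ 4" using power_increasing[of 2 4 m] m1 by (simp add: power2_eq_square)
    finally have YS: "Y * Y < 2 ^ S" using mS by linarith
    have b0: "bounded_store S (input [N])" by (rule input_bounded) (use small in auto)
    have i: "input [N] 0 = int N" by (simp add: input_def)
    have pS: "8 * int N + 2 < 2 ^ S" using int_less_pow2[OF small(3)] by simp
    have pF: "9 * floorlog 2 N < F" by (simp add: F_def max_iter_def L_def)
    have Fs: "2 * S + 1 < F" "Y * Y < F" by (simp_all add: F_def S_def max_iter_def)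
    have "runs orc S F (det_prog C) (input [N]) [] (\<lambda>s' bs'. bs' = [] \<and> s' 0 = of_bool (sum_of_two_squares N))"
      unfolding det_prog_def
    proof (rule runs_Seq[OF F0], rule runs_mono[OF pre_prog_runs[OF b0 i N pS pF]])
      fix s :: store and cs :: "bool list" assume "cs = [] \<and> bounded_store S s \<and> agree {0, 2, 3, 4, 5, 6} (input [N]) s \<and>
        s 6 = int (floorlog 2 N) \<and> strip_inv N (8 * floorlog 2 N + 1) s"
      hence s: "cs = []" "bounded_store S s" "s 6 = int L" "strip_inv N (8 * L + 1) s" by (auto simp: L_def)
      obtain M where M: "s 0 = int M" "M > 0" "odd M" "M \<le> N" "\<And>p. prime p \<Longrightarrow> p dvd M \<Longrightarrow> 8 * L \<le> p"
        "sum_of_two_squares N \<Longrightarrow> s 4 = 1 \<and> sum_of_two_squares M"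
        "\<not> sum_of_two_squares N \<Longrightarrow> s 4 = 0 \<or> s 4 = 1 \<and> \<not> sum_of_two_squares M"
        using strip_inv_result[OF s(4) L0] by metis
      define t where "t = s(19 := int Y)"
      define t' where "t' = t(17 := int (Y * Y))"
      have bt: "bounded_store S t" unfolding t_def using int_less_pow2[OF small(2)] by (intro bounded_store_update[OF s(2)]) simp
      have bt': "bounded_store S t'" unfolding t'_def using int_less_pow2[OF YS] by (intro bounded_store_update[OF bt]) simp
      have e1: "s(19 := aval (Op Mul (Num (int C)) (power_exp 16 (Reg 6))) s) = t"
        by (simp add: t_def s(3) Y_def Yf_def)
      have e2: "t(17 := aval (square_exp (Reg 19)) t) = t'" by (simp add: t'_def t_def)
      have tv: "t' 0 = int M" "t' 19 = int Y" "t' 17 = int (Y * Y)" "t' 4 = s 4" using M(1) by (simp_all add: t'_def t_def)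
      have mm: "M \<le> m" "Y \<le> m" using M(4) by (simp_all add: m_def)
      have res: "(if \<exists>u<Y. \<exists>v<Y. witness M u v then 0 else s 4) = of_bool (sum_of_two_squares N)"
      proof (cases "sum_of_two_squares N")
        case True
        thus ?thesis using M(6)[OF True] no_witness_two_squares[OF M(2)] by simp
      next
        case False
        show ?thesis
        proof (cases "s 4 = 0")
          case s4: False
          hence "\<not> sum_of_two_squares M" using M(7)[OF False] by blast
          then obtain u v where uv: "u < Yf (floorlog 2 M)" "v < Yf (floorlog 2 M)" "witness M u v"
            using C[OF M(2,3)] unfolding Yf_def by blast
          \<comment> \<open>The program computes its range from the size of \<open>N\<close>, while
            the witness is bounded in terms of the smaller \<open>M\<close>; monotonicity bridges
            this.\<close>
          have "floorlog 2 M \<le> L" unfolding L_def by (rule floorlog_2_mono[OF M(4)])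
          hence "Yf (floorlog 2 M) \<le> Y" unfolding Yf_def Y_def by (intro mult_le_mono2 power_mono) auto
          hence "\<exists>u<Y. \<exists>v<Y. witness M u v" using uv by (meson order.strict_trans2)
          thus ?thesis using False by simp
        qed (use False in simp)
      qed
      have "runs orc S F det_loop t' cs (\<lambda>s' bs'. bs' = cs \<and> bounded_store S s' \<and>
          s' 4 = (if \<exists>u<Y. \<exists>v<Y. witness M u v then 0 else t' 4))"
        by (rule det_loop_runs[OF orc bt' tv(1) M(2,3) tv(2,3) mm mS Fs])
      hence lp: "runs orc S F det_loop t' cs (\<lambda>s' bs'. runs orc S F (Assign 0 (Reg 4)) s' bs'
          (\<lambda>s' bs'. bs' = [] \<and> s' 0 = of_bool (sum_of_two_squares N)))"
        unfolding tv(4) res by (rule runs_mono) (auto intro!: runs_Assign simp: s(1))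
      show "runs orc S F (Seq (Assign 19 (Op Mul (Num (int C)) (power_exp 16 (Reg 6))))
         (Seq (Assign 17 (square_exp (Reg 19))) (Seq det_loop (Assign 0 (Reg 4))))) s cs
         (\<lambda>s' bs'. bs' = [] \<and> s' 0 = of_bool (sum_of_two_squares N))"
        by (rule runs_Seq[OF F0], rule runs_Assign[OF s(2)], unfold e1, rule runs_Seq[OF F0], rule runs_Assign[OF bt], unfold e2,
            rule runs_Seq[OF F0], rule lp)
    qed
    thus ?thesis unfolding runs_def p L_def[symmetric] S_def F_def Y_def by blast
  qed
  thus ?thesis unfolding deterministic_poly_reduction_def using tf by blast
qed

theorem theorem1:
  shows "(\<exists>c. probabilistic_poly_reduction sum_of_two_squares (solves_CRS 2) c) \<and>
    (extended_riemann_hypothesis \<longrightarrow>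
      (\<exists>c. deterministic_poly_reduction sum_of_two_squares (solves_CRS 2) c))"
  using probabilistic_reduction deterministic_reduction by blast

end
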